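(* Let $(M,D)$ be a locally flat manifold of dimension $m$ with universal covering $(\tilde M,\tilde D)$, whose linear holonomy group is unimodular (i.e. contained in the special linear group), and let $\tilde v$ be a $\tilde D$-parallel volume form on $\tilde M$. Regard $\tilde v$ as a cocycle of the KV-complex $C(\tilde{\mathcal{A}},\tilde W)$, where $\tilde{\mathcal{A}}=(\mathcal{X}(\tilde M),\tilde D)$ and $\tilde W=C^\infty(\tilde M,\mathbb{R})$. If $(M,D)$ is (geodesically) complete, then the cohomology class $[\tilde v]\in H^m(\tilde{\mathcal{A}},\tilde W)$ vanishes.
   Context: A locally flat manifold $(M,D)$ is a smooth manifold with a torsion free flat linear connection $D$. For such $(M,D)$ the space $\mathcal{X}(M)$ of smooth vector fields with multiplication $ab=D_ab$ is a KV-algebra $\mathcal{A}=(\mathcal{X}(M),D)$ over $\mathbb{R}$: its associator $(a,b,c)=(ab)c-a(bc)$ is symmetric in $a,b$. The space $W=C^\infty(M,\mathbb{R})$ is a left KV-module for it via $aw=\langle dw,a\rangle$ and $wa=0$. KV-complex: for $q\ge1$, $C_q(\mathcal{A},W)$ is the space of $\mathbb{R}$-$q$-linear maps from $\mathcal{A}$ to $W$, with $$(\delta f)(a_1,\dots,a_{q+1})=\sum_{j=1}^{q}(-1)^j\Big\{a_j\big(f(a_1,\dots,\widehat{a_j},\dots,a_{q+1})\big)-\sum_{i\ne j}f(a_1,\dots,\widehat{a_j},\dots,a_ja_i,\dots,a_{q+1})\Big\}$$ (the right-action terms of the general coboundary vanish since $W$ is a left module). Moreover $C_0(\mathcal{A},W)=J(W)=\{w\in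 W:(ab)w=a(bw)\ \forall a,b\in\mathcal{A}\}$ and $(\delta w)(a)=-aw$. One has $\delta\circ\delta=0$, and $H^q(\mathcal{A},W)$ is the $q$-th cohomology of this complex. A parallel volume form, regarded as an $m$-linear map $\tilde{\mathcal{A}}^m\to\tilde W$, is a $\delta$-cocycle. *)

theory Defs
  imports "HOL-Analysis.Analysis" "HOL-Library.Function_Algebras"
begin

text \<open>
  Function spaces carry the pointwise operations of \<open>Function_Algebras\<close>; in particular the real
  functions on a manifold form a ring, and tangent vectors, vector fields and cochains are added
  pointwise.
\<close>

section \<open>Smooth manifolds\<close>

text \<open>Meaningful for open \<open>U\<close> only.\<close>

primrec Ck_on :: "nat \<Rightarrow> 'a::real_normed_vector set \<Rightarrow> ('a \<Rightarrow> 'b::real_normed_vector) \<Rightarrow> bool" where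
  "Ck_on 0 U f \<longleftrightarrow> continuous_on U f"
| "Ck_on (Suc k) U f \<longleftrightarrow>
     (\<forall>x\<in>U. f differentiable (at x)) \<and> (\<forall>v. Ck_on k U (\<lambda>x. frechet_derivative f (at x) v))"

definition smooth_on :: "'a::real_normed_vector set \<Rightarrow> ('a \<Rightarrow> 'b::real_normed_vector) \<Rightarrow> bool" where
  "smooth_on U f \<longleftrightarrow> (\<forall>k. Ck_on k U f)"

text \<open>
  A chart is a pair of its domain and its coordinate map; the underlying set of a manifold is the
  whole type \<open>'a\<close>, the coordinates take values in \<open>'e\<close>.
\<close>

type_synonym ('a, 'e) atlas = "('a set \<times> ('a \<Rightarrow> 'e)) set"

definition smooth_manifold ::
    "('a::{t2_space, second_countable_topology}, 'e::euclidean_space) atlas \<Rightarrow> bool" where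
  "smooth_manifold A \<longleftrightarrow>
     (\<Union>(U, \<phi>)\<in>A. U) = UNIV \<and>
     (\<forall>(U, \<phi>)\<in>A. open U \<and> open (\<phi> ` U) \<and> homeomorphism U (\<phi> ` U) \<phi> (inv_into U \<phi>)) \<and>
     (\<forall>(U, \<phi>)\<in>A. \<forall>(V, \<psi>)\<in>A. smooth_on (\<phi> ` (U \<inter> V)) (\<psi> \<circ> inv_into U \<phi>))"

definition euclidean_atlas :: "('e, 'e) atlas" where
  "euclidean_atlas = {(UNIV, id)}"

text \<open>Smoothness of a map on an open subset \<open>S\<close> of its domain.\<close>

definition smooth_map_on ::
    "('a::topological_space, 'd::euclidean_space) atlas \<Rightarrow>
     ('b::topological_space, 'e::euclidean_space) atlas \<Rightarrow> 'a set \<Rightarrow> ('a \<Rightarrow> 'b) \<Rightarrow> bool" where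
  "smooth_map_on A B S F \<longleftrightarrow>
     continuous_on S F \<and>
     (\<forall>(U, \<phi>)\<in>A. \<forall>(V, \<psi>)\<in>B.
        smooth_on (\<phi> ` {x \<in> U \<inter> S. F x \<in> V}) (\<psi> \<circ> F \<circ> inv_into U \<phi>))"

definition smooth_functions ::
    "('a::topological_space, 'e::euclidean_space) atlas \<Rightarrow> ('a \<Rightarrow> real) set" where
  "smooth_functions A = {f. smooth_map_on A euclidean_atlas UNIV f}"

definition smooth_curve ::
    "('a::topological_space, 'e::euclidean_space) atlas \<Rightarrow> (real \<Rightarrow> 'a) \<Rightarrow> bool" where
  "smooth_curve A \<gamma> \<longleftrightarrow> smooth_map_on euclidean_atlas A UNIV \<gamma>"

definition local_diffeomorphism ::
    "('a::topological_space, 'd::euclidean_space) atlas \<Rightarrow>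
     ('b::topological_space, 'e::euclidean_space) atlas \<Rightarrow> ('a \<Rightarrow> 'b) \<Rightarrow> bool" where
  "local_diffeomorphism A B F \<longleftrightarrow>
     (\<forall>x. \<exists>S. x \<in> S \<and> open S \<and> open (F ` S) \<and> inj_on F S \<and>
        smooth_map_on A B S F \<and> smooth_map_on B A (F ` S) (inv_into S F))"


section \<open>Tangent vectors and vector fields\<close>

text \<open>
  Tangent vectors at \<open>x\<close> are the derivations of the algebra of smooth functions at \<open>x\<close>. Being
  HOL functions on all of \<open>'a \<Rightarrow> real\<close>, they are normalised to \<open>0\<close> on functions that are not
  smooth, so that equality of tangent vectors is HOL equality.
\<close>

type_synonym 'a tangent_vector = "('a \<Rightarrow> real) \<Rightarrow> real"
type_synonym 'a vector_field = "'a \<Rightarrow> 'a tangent_vector"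

definition tangent_space ::
    "('a::topological_space, 'e::euclidean_space) atlas \<Rightarrow> 'a \<Rightarrow> 'a tangent_vector set" where
  "tangent_space A x =
     {u. (\<forall>f\<in>smooth_functions A. \<forall>g\<in>smooth_functions A. u (f + g) = u f + u g) \<and>
         (\<forall>f\<in>smooth_functions A. \<forall>c. u (\<lambda>y. c * f y) = c * u f) \<and>
         (\<forall>f\<in>smooth_functions A. \<forall>g\<in>smooth_functions A. u (f * g) = u f * g x + f x * u g) \<and>
         (\<forall>f. f \<notin> smooth_functions A \<longrightarrow> u f = 0)}"

definition tscale :: "real \<Rightarrow> 'a tangent_vector \<Rightarrow> 'a tangent_vector" where
  "tscale c u = (\<lambda>f. c * u f)"

definition deriv_along :: "'a vector_field \<Rightarrow> ('a \<Rightarrow> real) \<Rightarrow> 'a \<Rightarrow> real" where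
  "deriv_along X f = (\<lambda>x. X x f)"

definition vector_fields ::
    "('a::topological_space, 'e::euclidean_space) atlas \<Rightarrow> 'a vector_field set" where
  "vector_fields A =
     {X. (\<forall>x. X x \<in> tangent_space A x) \<and>
         (\<forall>f\<in>smooth_functions A. deriv_along X f \<in> smooth_functions A)}"

definition vscale :: "('a \<Rightarrow> real) \<Rightarrow> 'a vector_field \<Rightarrow> 'a vector_field" where
  "vscale f X = (\<lambda>x. tscale (f x) (X x))"

definition lie_bracket :: "'a vector_field \<Rightarrow> 'a vector_field \<Rightarrow> 'a vector_field" where
  "lie_bracket X Y = (\<lambda>x f. X x (deriv_along Y f) - Y x (deriv_along X f))"

definition velocity ::
    "('a::topological_space, 'e::euclidean_space) atlas \<Rightarrow> (real \<Rightarrow> 'a) \<Rightarrow> real \<Rightarrow> 'a tangent_vector" where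
  "velocity A \<gamma> t = (\<lambda>f. if f \<in> smooth_functions A then deriv (f \<circ> \<gamma>) t else 0)"

text \<open>A basis of the tangent space at \<open>x\<close>, indexed by a finite type.\<close>

definition frame_at ::
    "('a::topological_space, 'e::euclidean_space) atlas \<Rightarrow> 'a \<Rightarrow> ('n::finite \<Rightarrow> 'a tangent_vector) \<Rightarrow> bool" where
  "frame_at A x e \<longleftrightarrow>
     (\<forall>i. e i \<in> tangent_space A x) \<and>
     (\<forall>u\<in>tangent_space A x. \<exists>!c. u = (\<Sum>i\<in>UNIV. tscale (c i) (e i)))"


section \<open>Linear connections and locally flat manifolds\<close>

type_synonym 'a connection = "'a vector_field \<Rightarrow> 'a vector_field \<Rightarrow> 'a vector_field"

definition linear_connection ::
    "('a::topological_space, 'e::euclidean_space) atlas \<Rightarrow> 'a connection \<Rightarrow> bool" where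
  "linear_connection A D \<longleftrightarrow>
     (\<forall>X\<in>vector_fields A. \<forall>Y\<in>vector_fields A. D X Y \<in> vector_fields A) \<and>
     (\<forall>X\<in>vector_fields A. \<forall>X'\<in>vector_fields A. \<forall>Y\<in>vector_fields A.
        D (X + X') Y = D X Y + D X' Y) \<and>
     (\<forall>f\<in>smooth_functions A. \<forall>X\<in>vector_fields A. \<forall>Y\<in>vector_fields A.
        D (vscale f X) Y = vscale f (D X Y)) \<and>
     (\<forall>X\<in>vector_fields A. \<forall>Y\<in>vector_fields A. \<forall>Y'\<in>vector_fields A.
        D X (Y + Y') = D X Y + D X Y') \<and>
     (\<forall>f\<in>smooth_functions A. \<forall>X\<in>vector_fields A. \<forall>Y\<in>vector_fields A.
        D X (vscale f Y) = vscale (deriv_along X f) Y + vscale f (D X Y))"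

definition torsion_free ::
    "('a::topological_space, 'e::euclidean_space) atlas \<Rightarrow> 'a connection \<Rightarrow> bool" where
  "torsion_free A D \<longleftrightarrow>
     (\<forall>X\<in>vector_fields A. \<forall>Y\<in>vector_fields A. D X Y - D Y X = lie_bracket X Y)"

definition flat_connection ::
    "('a::topological_space, 'e::euclidean_space) atlas \<Rightarrow> 'a connection \<Rightarrow> bool" where
  "flat_connection A D \<longleftrightarrow>
     (\<forall>X\<in>vector_fields A. \<forall>Y\<in>vector_fields A. \<forall>Z\<in>vector_fields A.
        D X (D Y Z) - D Y (D X Z) - D (lie_bracket X Y) Z = 0)"

definition locally_flat_manifold ::
    "('a::{t2_space, second_countable_topology}, 'e::euclidean_space) atlas \<Rightarrow> 'a connection \<Rightarrow> bool" where
  "locally_flat_manifold A D \<longleftrightarrow>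
     smooth_manifold A \<and> linear_connection A D \<and> torsion_free A D \<and> flat_connection A D"

text \<open>
  \<open>Y\<close> is a vector field along the curve \<open>\<gamma>\<close> and \<open>Z\<close> is its covariant derivative at time \<open>t\<close>. Near
  \<open>t\<close>, \<open>Y\<close> is written as \<open>\<Sum>i. y i \<cdot> (E i \<circ> \<gamma>)\<close> with vector fields \<open>E i\<close> of the manifold; then
  \<open>Z = \<Sum>i. y i' \<cdot> E i + y i \<cdot> D (\<gamma>') (E i)\<close> at \<open>\<gamma> t\<close>. As \<open>D X (E i)\<close> at a point depends on the value
  of \<open>X\<close> at this point only, \<open>\<gamma>' t\<close> is extended to a vector field \<open>X\<close>.
\<close>

definition has_covariant_derivative ::
    "('a::topological_space, 'e::euclidean_space) atlas \<Rightarrow> 'a connection \<Rightarrow> (real \<Rightarrow> 'a) \<Rightarrow>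
     (real \<Rightarrow> 'a tangent_vector) \<Rightarrow> 'a tangent_vector \<Rightarrow> real \<Rightarrow> bool" where
  "has_covariant_derivative A D \<gamma> Y Z t \<longleftrightarrow>
     (\<exists>(k::nat) E y y' X.
        (\<forall>i<k. E i \<in> vector_fields A) \<and>
        (\<forall>i<k. (y i has_real_derivative y' i) (at t)) \<and>
        (\<forall>\<^sub>F s in nhds t. Y s = (\<Sum>i<k. tscale (y i s) (E i (\<gamma> s)))) \<and>
        X \<in> vector_fields A \<and> X (\<gamma> t) = velocity A \<gamma> t \<and>
        Z = (\<Sum>i<k. tscale (y' i) (E i (\<gamma> t)) + tscale (y i t) (D X (E i) (\<gamma> t))))"

definition parallel_along ::
    "('a::topological_space, 'e::euclidean_space) atlas \<Rightarrow> 'a connection \<Rightarrow> (real \<Rightarrow> 'a) \<Rightarrow>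
     (real \<Rightarrow> 'a tangent_vector) \<Rightarrow> bool" where
  "parallel_along A D \<gamma> Y \<longleftrightarrow> (\<forall>t. has_covariant_derivative A D \<gamma> Y 0 t)"

definition geodesic ::
    "('a::topological_space, 'e::euclidean_space) atlas \<Rightarrow> 'a connection \<Rightarrow> (real \<Rightarrow> 'a) \<Rightarrow> bool" where
  "geodesic A D \<gamma> \<longleftrightarrow> smooth_curve A \<gamma> \<and> parallel_along A D \<gamma> (velocity A \<gamma>)"

definition geodesically_complete ::
    "('a::topological_space, 'e::euclidean_space) atlas \<Rightarrow> 'a connection \<Rightarrow> bool" where
  "geodesically_complete A D \<longleftrightarrow>
     (\<forall>x. \<forall>u\<in>tangent_space A x. \<exists>\<gamma>. geodesic A D \<gamma> \<and> \<gamma> 0 = x \<and> velocity A \<gamma> 0 = u)"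

text \<open>
  \<open>frame_transport A D x e y e'\<close>: parallel transport along some piecewise smooth curve from \<open>x\<close> to
  \<open>y\<close> takes the tuple \<open>e\<close> to the tuple \<open>e'\<close>. Each smooth piece is the restriction to \<open>[0, 1]\<close> of a
  smooth curve on the whole line.
\<close>

inductive frame_transport ::
    "('a::topological_space, 'e::euclidean_space) atlas \<Rightarrow> 'a connection \<Rightarrow>
     'a \<Rightarrow> ('n \<Rightarrow> 'a tangent_vector) \<Rightarrow> 'a \<Rightarrow> ('n \<Rightarrow> 'a tangent_vector) \<Rightarrow> bool"
  for A D x e where
  start: "frame_transport A D x e x e"
| piece: "\<lbrakk>frame_transport A D x e (\<gamma> 0) (\<lambda>i. Y i 0); smooth_curve A \<gamma>; \<And>i. parallel_along A D \<gamma> (Y i)\<rbrakk>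
          \<Longrightarrow> frame_transport A D x e (\<gamma> 1) (\<lambda>i. Y i 1)"

text \<open>The holonomy group at \<open>x\<close>, as a group of matrices with respect to the frame \<open>e\<close> at \<open>x\<close>.\<close>

definition linear_holonomy_group ::
    "('a::topological_space, 'e::euclidean_space) atlas \<Rightarrow> 'a connection \<Rightarrow>
     'a \<Rightarrow> ('n::finite \<Rightarrow> 'a tangent_vector) \<Rightarrow> (real^'n^'n) set" where
  "linear_holonomy_group A D x e =
     {H. frame_transport A D x e x (\<lambda>j. \<Sum>i\<in>UNIV. tscale (H $ i $ j) (e i))}"

definition special_linear_group :: "(real^'n::finite^'n) set" where
  "special_linear_group = {H. det H = 1}"


section \<open>The universal covering\<close>

definition related_fields ::
    "('b::topological_space, 'e::euclidean_space) atlas \<Rightarrow> ('a \<Rightarrow> 'b) \<Rightarrow>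
     'a vector_field \<Rightarrow> 'b vector_field \<Rightarrow> bool" where
  "related_fields B p X' X \<longleftrightarrow> (\<forall>x. \<forall>f\<in>smooth_functions B. X' x (f \<circ> p) = X (p x) f)"

text \<open>
  \<open>p\<close> is a smooth covering with simply connected total space. The last clause says that \<open>D'\<close> is the
  pull-back of \<open>D\<close>: locally the lifts of vector fields of the base generate all vector fields over
  the smooth functions.
\<close>

definition universal_covering ::
    "('b::{t2_space, second_countable_topology}, 'e::euclidean_space) atlas \<Rightarrow> 'b connection \<Rightarrow>
     ('a::{t2_space, second_countable_topology}, 'e) atlas \<Rightarrow> 'a connection \<Rightarrow> ('b \<Rightarrow> 'a) \<Rightarrow> bool" where
  "universal_covering A' D' A D p \<longleftrightarrow>
     locally_flat_manifold A' D' \<and>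
     covering_space UNIV p UNIV \<and> simply_connected (UNIV :: 'b set) \<and>
     local_diffeomorphism A' A p \<and>
     (\<forall>X'\<in>vector_fields A'. \<forall>Y'\<in>vector_fields A'. \<forall>X\<in>vector_fields A. \<forall>Y\<in>vector_fields A.
        related_fields A p X' X \<longrightarrow> related_fields A p Y' Y \<longrightarrow>
        related_fields A p (D' X' Y') (D X Y))"


section \<open>Differential forms\<close>

text \<open>
  A form of degree \<open>q\<close> assigns to each point \<open>x\<close> a function of the lists of \<open>q\<close> tangent vectors at
  \<open>x\<close>; its values on other lists play no role.
\<close>

type_synonym 'a form = "'a \<Rightarrow> 'a tangent_vector list \<Rightarrow> real"

definition tuples :: "'x set \<Rightarrow> nat \<Rightarrow> 'x list set" where
  "tuples S q = {xs. length xs = q \<and> set xs \<subseteq> S}"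

definition eval_form :: "'a form \<Rightarrow> 'a vector_field list \<Rightarrow> 'a \<Rightarrow> real" where
  "eval_form \<omega> Xs = (\<lambda>x. \<omega> x (map (\<lambda>X. X x) Xs))"

definition differential_form ::
    "('a::topological_space, 'e::euclidean_space) atlas \<Rightarrow> nat \<Rightarrow> 'a form \<Rightarrow> bool" where
  "differential_form A q \<omega> \<longleftrightarrow>
     (\<forall>x. \<forall>us\<in>tuples (tangent_space A x) q.
        (\<forall>i<q. \<forall>u\<in>tangent_space A x. \<forall>u'\<in>tangent_space A x. \<forall>c.
           \<omega> x (us[i := u + u']) = \<omega> x (us[i := u]) + \<omega> x (us[i := u']) \<and>
           \<omega> x (us[i := tscale c u]) = c * \<omega> x (us[i := u])) \<and>
        (\<forall>i<q. \<forall>j<q. i \<noteq> j \<longrightarrow> us ! i = us ! j \<longrightarrow> \<omega> x us = 0)) \<and>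
     (\<forall>Xs\<in>tuples (vector_fields A) q. eval_form \<omega> Xs \<in> smooth_functions A)"

definition volume_form ::
    "('a::topological_space, real^'n::finite) atlas \<Rightarrow> 'a form \<Rightarrow> bool" where
  "volume_form A \<omega> \<longleftrightarrow>
     differential_form A CARD('n) \<omega> \<and>
     (\<forall>x. \<exists>us\<in>tuples (tangent_space A x) CARD('n). \<omega> x us \<noteq> 0)"

definition parallel_form ::
    "('a::topological_space, 'e::euclidean_space) atlas \<Rightarrow> 'a connection \<Rightarrow> nat \<Rightarrow> 'a form \<Rightarrow> bool" where
  "parallel_form A D q \<omega> \<longleftrightarrow>
     (\<forall>X\<in>vector_fields A. \<forall>Xs\<in>tuples (vector_fields A) q.
        deriv_along X (eval_form \<omega> Xs) - (\<Sum>i<q. eval_form \<omega> (Xs[i := D X (Xs ! i)])) = 0)"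


section \<open>The KV-complex of vector fields with values in the smooth functions\<close>

text \<open>
  Cochains of degree \<open>q\<close> are functions of lists, normalised to \<open>0\<close> outside the \<open>q\<close>-tuples of vector
  fields. The element \<open>w\<close> of \<open>J(W)\<close> is represented in degree \<open>0\<close> by the cochain with value \<open>w\<close> on the
  empty list.
\<close>

type_synonym 'a kv_cochain = "'a vector_field list \<Rightarrow> 'a \<Rightarrow> real"

definition kv_J ::
    "('a::topological_space, 'e::euclidean_space) atlas \<Rightarrow> 'a connection \<Rightarrow> ('a \<Rightarrow> real) set" where
  "kv_J A D =
     {w\<in>smooth_functions A. \<forall>a\<in>vector_fields A. \<forall>b\<in>vector_fields A.
        deriv_along (D a b) w = deriv_along a (deriv_along b w)}"

definition kv_cochains ::
    "('a::topological_space, 'e::euclidean_space) atlas \<Rightarrow> 'a connection \<Rightarrow> nat \<Rightarrow> 'a kv_cochain set" where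
  "kv_cochains A D q =
     {f. (\<forall>as. as \<notin> tuples (vector_fields A) q \<longrightarrow> f as = 0) \<and>
         (\<forall>as\<in>tuples (vector_fields A) q. f as \<in> smooth_functions A) \<and>
         (\<forall>as\<in>tuples (vector_fields A) q. \<forall>i<q. \<forall>a\<in>vector_fields A. \<forall>b\<in>vector_fields A. \<forall>c::real.
            f (as[i := a + b]) = f (as[i := a]) + f (as[i := b]) \<and>
            f (as[i := vscale (\<lambda>_. c) a]) = (\<lambda>_. c) * f (as[i := a])) \<and>
         (q = 0 \<longrightarrow> f [] \<in> kv_J A D)}"

definition omit :: "nat \<Rightarrow> 'x list \<Rightarrow> 'x list" where
  "omit j xs = take j xs @ drop (Suc j) xs"

text \<open>
  Positions are counted from \<open>0\<close>, so the sign of the term with index \<open>j\<close> is \<open>(- 1) ^ Suc j\<close>. The outer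
  sum does not include the last argument (index \<open>q\<close>), whereas \<open>i\<close> ranges over all the arguments
  but \<open>j\<close>.
\<close>

definition kv_coboundary ::
    "('a::topological_space, 'e::euclidean_space) atlas \<Rightarrow> 'a connection \<Rightarrow> nat \<Rightarrow>
     'a kv_cochain \<Rightarrow> 'a kv_cochain" where
  "kv_coboundary A D q f = (\<lambda>as.
     if as \<notin> tuples (vector_fields A) (Suc q) then 0
     else if q = 0 then - deriv_along (as ! 0) (f [])
     else (\<Sum>j<q. (- 1) ^ Suc j *
            (deriv_along (as ! j) (f (omit j as)) -
             (\<Sum>i\<in>{..q} - {j}. f (omit j (as[i := D (as ! j) (as ! i)]))))))"

definition kv_cocycles ::
    "('a::topological_space, 'e::euclidean_space) atlas \<Rightarrow> 'a connection \<Rightarrow> nat \<Rightarrow> 'a kv_cochain set" where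
  "kv_cocycles A D q = {f \<in> kv_cochains A D q. kv_coboundary A D q f = 0}"

definition kv_coboundaries ::
    "('a::topological_space, 'e::euclidean_space) atlas \<Rightarrow> 'a connection \<Rightarrow> nat \<Rightarrow> 'a kv_cochain set" where
  "kv_coboundaries A D q =
     (case q of 0 \<Rightarrow> {0} | Suc k \<Rightarrow> kv_coboundary A D k ` kv_cochains A D k)"

definition kv_cohomologous ::
    "('a::topological_space, 'e::euclidean_space) atlas \<Rightarrow> 'a connection \<Rightarrow> nat \<Rightarrow>
     ('a kv_cochain \<times> 'a kv_cochain) set" where
  "kv_cohomologous A D q =
     {(f, g). f \<in> kv_cocycles A D q \<and> g \<in> kv_cocycles A D q \<and> f - g \<in> kv_coboundaries A D q}"

definition kv_cohomology ::
    "('a::topological_space, 'e::euclidean_space) atlas \<Rightarrow> 'a connection \<Rightarrow> nat \<Rightarrow> 'a kv_cochain set set" where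
  "kv_cohomology A D q = kv_cocycles A D q // kv_cohomologous A D q"

definition kv_class ::
    "('a::topological_space, 'e::euclidean_space) atlas \<Rightarrow> 'a connection \<Rightarrow> nat \<Rightarrow>
     'a kv_cochain \<Rightarrow> 'a kv_cochain set" where
  "kv_class A D q f = kv_cohomologous A D q `` {f}"

definition form_cochain ::
    "('a::topological_space, 'e::euclidean_space) atlas \<Rightarrow> nat \<Rightarrow> 'a form \<Rightarrow> 'a kv_cochain" where
  "form_cochain A q \<omega> =
     (\<lambda>Xs. if Xs \<in> tuples (vector_fields A) q then eval_form \<omega> Xs else 0)"

end

theory Submission
  imports Defs
begin

text \<open>
  On a simply connected locally flat manifold there is a vector field \<open>H\<close> with \<open>D X H = X\<close> for
  all \<open>X\<close> (in flat coordinates the Euler field), and contraction of a parallel form with \<open>H\<close> is,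
  up to a constant, a primitive of the form in the KV-complex.

  In a chart, \<open>D X H = X\<close> is an affine total differential equation for the components of \<open>H\<close>.
  Flatness and the symmetry of the Christoffel symbols are its integrability conditions, so that
  Picard iteration along rays solves it near every point with arbitrary initial value. Thus the
  local solutions form a locally constant sheaf, which has a global section by the monodromy theorem.
\<close>

section \<open>Differentiable functions of class \<open>C\<^sup>k\<close>\<close>

text \<open>A connection takes vector fields on the whole manifold and a derivation takes functions
  on the whole manifold. Every chart computation therefore passes through cut-offs, and the locality
  of \<open>D\<close> has to be proved before Christoffel symbols can describe it.

  No parallel frame and no flat coordinates are constructed: the single equation for
  \<open>H\<close> takes their place. The Picard operator integrates along rays from a centre, so
  its fixed point is at first controlled in the radial direction only. The point of the analysis is
  that flatness also governs the other directions: it bounds the failure of an iterate by the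
  failure of its predecessor, with a factor less than one.

  Two local solutions differ by a parallel field, so they need not match on overlaps, and gluing
  with a partition of unity would destroy the equation. What remains is to continue a solution along
  paths. This is done for abstract sections with values in fibres, without forming a space of germs
  and its topology.\<close>

lemma Ck_on_cong_imp:
  assumes "open U" "\<And>x. x \<in> U \<Longrightarrow> f x = g x" "Ck_on k U f"
  shows "Ck_on k U g"
  using assms(2,3)
proof (induction k arbitrary: f g)
  case 0
  then show ?case by (auto cong: continuous_on_cong)
next
  case (Suc k)
  have d: "(g has_derivative frechet_derivative f (at x)) (at x)" if "x \<in> U" for x
    using Suc.prems that \<open>open U\<close>
    by (auto intro!: has_derivative_transform_within_open[of f _ x UNIV U g]
          simp: frechet_derivative_works)
  then have "frechet_derivative f (at x) = frechet_derivative g (at x)" if "x \<in> U" for x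
    using frechet_derivative_at that by blast
  then have "\<forall>v. Ck_on k U (\<lambda>x. frechet_derivative g (at x) v)"
    using Suc.prems(2) Suc.IH[of "\<lambda>x. frechet_derivative f (at x) _"] by simp
  with d show ?case by (auto simp: differentiable_def)
qed

lemma Ck_on_cong:
  assumes "open U" "\<And>x. x \<in> U \<Longrightarrow> f x = g x"
  shows "Ck_on k U f \<longleftrightarrow> Ck_on k U g"
  using Ck_on_cong_imp[OF assms(1)] assms(2) by metis

text \<open>\<open>Ck_on\<close> refers to the chosen \<open>frechet_derivative\<close>. Through
  this rule the inductions below can work with an explicit formula for the derivative
  instead.\<close>

lemma Ck_on_SucI:
  assumes "open U" "\<And>x. x \<in> U \<Longrightarrow> (f has_derivative f' x) (at x)"
    "\<And>v. Ck_on k U (\<lambda>x. f' x v)"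
  shows "Ck_on (Suc k) U f"
proof -
  have "frechet_derivative f (at x) = f' x" if "x \<in> U" for x
    using frechet_derivative_at assms(2) that by metis
  then have "Ck_on k U (\<lambda>x. frechet_derivative f (at x) v)" for v
    using Ck_on_cong[of U "\<lambda>x. frechet_derivative f (at x) v" "\<lambda>x. f' x v" k] assms by auto
  then show ?thesis using assms(2) by (auto simp: differentiable_def)
qed

lemma Ck_on_SucD:
  assumes "Ck_on (Suc k) U f" "x \<in> U"
  shows "(f has_derivative frechet_derivative f (at x)) (at x)"
  using assms by (simp add: frechet_derivative_works)

lemma Ck_on_subset: "Ck_on k U f \<Longrightarrow> V \<subseteq> U \<Longrightarrow> Ck_on k V f"
  by (induction k arbitrary: f) (auto intro: continuous_on_subset)

lemma Ck_on_local:
  assumes "\<And>x. x \<in> U \<Longrightarrow> \<exists>V. open V \<and> x \<in> V \<and> Ck_on k V f"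
  shows "Ck_on k U f"
  using assms
proof (induction k arbitrary: f)
  case 0
  have "continuous (at x within U) f" if x: "x \<in> U" for x
  proof -
    obtain V where "open V" "x \<in> V" "continuous_on V f" using 0[OF x] by auto
    then show ?thesis by (simp add: continuous_at_imp_continuous_at_within continuous_on_eq_continuous_at)
  qed
  then show ?case by (simp add: continuous_on_eq_continuous_within)
next
  case (Suc k)
  have "Ck_on k U (\<lambda>x. frechet_derivative f (at x) v)" for v
    by (rule Suc.IH) (use Suc.prems in fastforce)
  moreover have "f differentiable (at x)" if "x \<in> U" for x
    using Suc.prems[OF that] by auto
  ultimately show ?case by auto
qed

lemma Ck_on_continuous: "Ck_on k U f \<Longrightarrow> continuous_on U f"
  by (cases k) (auto intro: differentiable_imp_continuous_on
      simp: differentiable_on_def differentiable_at_withinI)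

lemma Ck_on_Suc_imp: "Ck_on (Suc k) U f \<Longrightarrow> Ck_on k U f"
proof (induction k arbitrary: f)
  case 0
  then show ?case using Ck_on_continuous[of "Suc 0"] by simp
qed simp

lemma Ck_on_const [simp]: "Ck_on k U (\<lambda>x. c)"
  by (induction k arbitrary: c) auto

lemma Ck_on_add:
  assumes "open U" "Ck_on k U f" "Ck_on k U g"
  shows "Ck_on k U (\<lambda>x. f x + g x)"
  using assms(2,3)
proof (induction k arbitrary: f g)
  case 0 then show ?case by (auto intro: continuous_intros)
next
  case (Suc k)
  show ?case
    by (rule Ck_on_SucI[where f' = "\<lambda>x v. frechet_derivative f (at x) v + frechet_derivative g (at x) v"])
      (use Suc \<open>open U\<close> in \<open>auto intro!: has_derivative_add simp: frechet_derivative_works[symmetric]\<close>)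
qed

lemma Ck_on_sum:
  assumes "open U" "\<And>i. i \<in> I \<Longrightarrow> Ck_on k U (f i)"
  shows "Ck_on k U (\<lambda>x. \<Sum>i\<in>I. f i x)"
  using assms(2) by (induction I rule: infinite_finite_induct) (auto intro: Ck_on_add[OF assms(1)])

lemma (in bounded_linear) Ck_on:
  assumes "open U" "Ck_on k U g"
  shows "Ck_on k U (\<lambda>x. f (g x))"
  using assms(2)
proof (induction k arbitrary: g)
  case 0 then show ?case by (auto intro: continuous_on)
next
  case (Suc k)
  show ?case
    by (rule Ck_on_SucI[where f' = "\<lambda>x v. f (frechet_derivative g (at x) v)"])
      (use Suc \<open>open U\<close> in \<open>auto intro!: has_derivative simp: frechet_derivative_works[symmetric]\<close>)
qed

lemma bounded_bilinear_Ck_on: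
  assumes B: "bounded_bilinear B" and "open U" "Ck_on k U f" "Ck_on k U g"
  shows "Ck_on k U (\<lambda>x. B (f x) (g x))"
  using assms(3,4)
proof (induction k arbitrary: f g)
  case 0 then show ?case by (auto intro: bounded_bilinear.continuous_on[OF B])
next
  case (Suc k)
  note * = Suc.prems[THEN Ck_on_Suc_imp]
  show ?case
    by (rule Ck_on_SucI[where f' = "\<lambda>x v. B (f x) (frechet_derivative g (at x) v)
          + B (frechet_derivative f (at x) v) (g x)"])
      (use Suc \<open>open U\<close> * in \<open>auto intro!: bounded_bilinear.FDERIV[OF B] Ck_on_add simp: frechet_derivative_works[symmetric]\<close>)
qed

lemmas Ck_on_scaleR = bounded_bilinear_Ck_on[OF bounded_bilinear_scaleR]
lemmas Ck_on_mult = bounded_bilinear_Ck_on[OF bounded_bilinear_mult]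
lemmas Ck_on_inner = bounded_bilinear_Ck_on[OF bounded_bilinear_inner]

lemma Ck_on_ident: "Ck_on k U (\<lambda>x. x)"
  by (cases k) auto

lemma Ck_on_minus: "open U \<Longrightarrow> Ck_on k U f \<Longrightarrow> Ck_on k U (\<lambda>x. - f x)"
  by (rule bounded_linear.Ck_on[OF bounded_linear_minus[OF bounded_linear_ident]])

lemma Ck_on_diff:
  assumes "open U" "Ck_on k U f" "Ck_on k U g"
  shows "Ck_on k U (\<lambda>x. f x - g x)"
  using Ck_on_add[OF assms(1,2) Ck_on_minus[OF assms(1,3)]] by simp

lemma linear_euclidean_expand:
  fixes f :: "'a::euclidean_space \<Rightarrow> 'b::real_vector"
  assumes "linear f"
  shows "f v = (\<Sum>b\<in>Basis. (v \<bullet> b) *\<^sub>R f b)"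
  by (metis (no_types, lifting) assms euclidean_representation linear_scale linear_sum sum.cong)

text \<open>The chain rule applies the derivative of \<open>f\<close> to a direction that varies
  with the point, whereas \<open>Ck_on\<close> speaks about fixed directions. Expanding the
  direction in the basis reduces to fixed ones, and then the induction hypothesis applies to the
  partial derivatives of \<open>f\<close>.\<close>

lemma Ck_on_compose:
  fixes g :: "'a::real_normed_vector \<Rightarrow> 'b::euclidean_space"
  assumes "open U" "open V" "g ` U \<subseteq> V" "Ck_on k U g" "Ck_on k V f"
  shows "Ck_on k U (\<lambda>x. f (g x))"
  using assms(3-5)
proof (induction k arbitrary: f)
  case 0
  then show ?case by (auto intro: continuous_on_compose2)
next
  case (Suc k)
  let ?g = "\<lambda>x. frechet_derivative g (at x)" and ?f = "\<lambda>y. frechet_derivative f (at y)"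
  note D = Ck_on_SucD[OF Suc.prems(2)] Ck_on_SucD[OF Suc.prems(3)]
  show ?case
  proof (rule Ck_on_SucI[OF assms(1), where f' = "\<lambda>x v. \<Sum>b\<in>Basis. (?g x v \<bullet> b) *\<^sub>R ?f (g x) b"])
    fix x assume x: "x \<in> U"
    then have gx: "g x \<in> V" using assms(3) by auto
    have "((\<lambda>x. f (g x)) has_derivative (\<lambda>v. ?f (g x) (?g x v))) (at x)"
      using has_derivative_compose[OF D(1)[OF x] D(2)[OF gx]] .
    moreover have "linear (?f (g x))" using D(2)[OF gx] has_derivative_linear by blast
    ultimately show "((\<lambda>x. f (g x)) has_derivative
        (\<lambda>v. \<Sum>b\<in>Basis. (?g x v \<bullet> b) *\<^sub>R ?f (g x) b)) (at x)"
      by (simp add: linear_euclidean_expand[symmetric])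
  next
    fix v
    show "Ck_on k U (\<lambda>x. \<Sum>b\<in>Basis. (?g x v \<bullet> b) *\<^sub>R ?f (g x) b)"
      using Suc.prems Ck_on_Suc_imp[OF Suc.prems(2)] assms(1)
      by (intro Ck_on_sum Ck_on_scaleR Ck_on_inner Suc.IH[of "\<lambda>y. ?f y _"]) auto
  qed
qed

lemma smooth_onD: "smooth_on U f \<Longrightarrow> Ck_on k U f"
  by (simp add: smooth_on_def)

lemma smooth_onI: "(\<And>k. Ck_on k U f) \<Longrightarrow> smooth_on U f"
  by (simp add: smooth_on_def)

lemma smooth_on_cong:
  "open U \<Longrightarrow> (\<And>x. x \<in> U \<Longrightarrow> f x = g x) \<Longrightarrow> smooth_on U f \<longleftrightarrow> smooth_on U g"
  unfolding smooth_on_def by (metis Ck_on_cong)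

lemma smooth_on_subset: "smooth_on U f \<Longrightarrow> V \<subseteq> U \<Longrightarrow> smooth_on V f"
  unfolding smooth_on_def by (metis Ck_on_subset)

lemma smooth_on_local:
  "(\<And>x. x \<in> U \<Longrightarrow> \<exists>V. open V \<and> x \<in> V \<and> smooth_on V f) \<Longrightarrow> smooth_on U f"
  unfolding smooth_on_def by (metis Ck_on_local)

lemma smooth_on_const [simp]: "smooth_on U (\<lambda>x. c)"
  by (simp add: smooth_on_def)

lemma smooth_on_ident [simp]: "smooth_on U (\<lambda>x. x)"
  by (simp add: smooth_on_def Ck_on_ident)

lemma smooth_on_continuous: "smooth_on U f \<Longrightarrow> continuous_on U f"
  using Ck_on_continuous smooth_onD by blast

lemma smooth_on_add: "open U \<Longrightarrow> smooth_on U f \<Longrightarrow> smooth_on U g \<Longrightarrow> smooth_on U (\<lambda>x. f x + g x)"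
  by (simp add: smooth_on_def Ck_on_add)

lemma smooth_on_diff: "open U \<Longrightarrow> smooth_on U f \<Longrightarrow> smooth_on U g \<Longrightarrow> smooth_on U (\<lambda>x. f x - g x)"
  by (simp add: smooth_on_def Ck_on_diff)

lemma smooth_on_sum:
  "open U \<Longrightarrow> (\<And>i. i \<in> I \<Longrightarrow> smooth_on U (f i)) \<Longrightarrow> smooth_on U (\<lambda>x. \<Sum>i\<in>I. f i x)"
  by (simp add: smooth_on_def Ck_on_sum)

lemma smooth_on_mult:
  fixes f g :: "_ \<Rightarrow> 'a::real_normed_algebra"
  shows "open U \<Longrightarrow> smooth_on U f \<Longrightarrow> smooth_on U g \<Longrightarrow> smooth_on U (\<lambda>x. f x * g x)"
  by (simp add: smooth_on_def Ck_on_mult)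

lemma smooth_on_scaleR:
  "open U \<Longrightarrow> smooth_on U f \<Longrightarrow> smooth_on U g \<Longrightarrow> smooth_on U (\<lambda>x. f x *\<^sub>R g x)"
  by (simp add: smooth_on_def Ck_on_scaleR)

lemma smooth_on_inner:
  "open U \<Longrightarrow> smooth_on U f \<Longrightarrow> smooth_on U g \<Longrightarrow> smooth_on U (\<lambda>x. f x \<bullet> g x)"
  by (simp add: smooth_on_def Ck_on_inner)

lemma smooth_on_compose:
  fixes g :: "'a::real_normed_vector \<Rightarrow> 'b::euclidean_space"
  assumes "open U" "open V" "g ` U \<subseteq> V" "smooth_on U g" "smooth_on V f"
  shows "smooth_on U (\<lambda>x. f (g x))"
  using assms Ck_on_compose unfolding smooth_on_def by blast

lemma smooth_on_has_derivative:
  "smooth_on U f \<Longrightarrow> x \<in> U \<Longrightarrow> (f has_derivative frechet_derivative f (at x)) (at x)"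
  using Ck_on_SucD smooth_onD by blast

lemma smooth_on_frechet_derivative:
  "smooth_on U f \<Longrightarrow> smooth_on U (\<lambda>x. frechet_derivative f (at x) v)"
  unfolding smooth_on_def by (metis Ck_on.simps(2))

section \<open>Cut-off functions and the Hadamard lemma\<close>

text \<open>A family around exp (-1/t) that is closed under differentiation: with s = 1/t, the
  derivative replaces p by s^2 (p - p'). This closure carries the induction for smoothness.\<close>

definition flat_exp :: "real poly \<Rightarrow> real \<Rightarrow> real" where
  "flat_exp p t = (if t > 0 then poly p (1 / t) * exp (- (1 / t)) else 0)"

lemma poly_exp_tendsto_0: "((\<lambda>s::real. poly p s * exp (- s)) \<longlongrightarrow> 0) at_top"
proof -
  have "((\<lambda>s. \<Sum>i\<le>degree p. coeff p i * (s ^ i / exp s)) \<longlongrightarrow> (\<Sum>i\<le>degree p. coeff p i * 0)) at_top"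
    by (intro tendsto_intros tendsto_power_div_exp_0)
  moreover have "(\<lambda>s. \<Sum>i\<le>degree p. coeff p i * (s ^ i / exp s)) = (\<lambda>s. poly p s * exp (- s))"
    by (auto simp: poly_altdef sum_distrib_right sum_divide_distrib exp_minus divide_inverse intro!: sum.cong)
  ultimately show ?thesis by simp
qed

lemma flat_exp_DERIV: "(flat_exp p has_real_derivative flat_exp ([:0, 0, 1:] * (p - pderiv p)) t) (at t)"
proof -
  consider "t > 0" | "t < 0" | "t = 0" by linarith
  then show ?thesis
  proof cases
    case 1
    have "((\<lambda>t. poly p (1 / t) * exp (- (1 / t))) has_real_derivative
        flat_exp ([:0, 0, 1:] * (p - pderiv p)) t) (at t)"
      using 1 by (auto intro!: derivative_eq_intros simp: flat_exp_def field_simps power2_eq_square)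
    then show ?thesis
      by (rule has_field_derivative_transform_within_open[of _ _ t "{0<..}"])
        (use 1 in \<open>auto simp: flat_exp_def\<close>)
  next
    case 2
    have "((\<lambda>t. 0) has_real_derivative 0) (at t)" by simp
    then have "(flat_exp p has_real_derivative 0) (at t)"
      by (rule has_field_derivative_transform_within_open[of _ _ t "{..<0}"])
        (use 2 in \<open>auto simp: flat_exp_def\<close>)
    with 2 show ?thesis by (simp add: flat_exp_def)
  next
    case 3
    have "((\<lambda>h. flat_exp p h / h) \<longlongrightarrow> 0) (at_left 0)"
      by (rule tendsto_eventually) (auto simp: eventually_at_left_field flat_exp_def intro!: exI[of _ "-1"])
    \<comment> \<open>Substituting h = 1/s turns the difference quotient on the right into a
      polynomial in s times exp (-s); on the left it vanishes.\<close>
    moreover have "((\<lambda>h. flat_exp p h / h) \<longlongrightarrow> 0) (at_right 0)"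
    proof -
      have "\<forall>\<^sub>F s in at_top. poly ([:0, 1:] * p) s * exp (- s) = flat_exp p (inverse s) / inverse s"
        using eventually_gt_at_top[of 0] by eventually_elim (simp add: flat_exp_def field_simps)
      then show ?thesis
        unfolding filterlim_at_right_to_top
        using poly_exp_tendsto_0[of "[:0, 1:] * p"] by (rule Lim_transform_eventually[rotated])
    qed
    ultimately have "((\<lambda>h. flat_exp p h / h) \<longlongrightarrow> 0) (at 0)"
      by (simp add: filterlim_split_at)
    with 3 show ?thesis by (simp add: DERIV_def flat_exp_def)
  qed
qed

lemma smooth_on_flat_exp: "smooth_on UNIV (flat_exp p)"
proof (rule smooth_onI)
  show "Ck_on k UNIV (flat_exp p)" for k
  proof (induction k arbitrary: p)
    case 0
    then show ?case using DERIV_isCont[OF flat_exp_DERIV] by (auto simp: continuous_on_eq_continuous_at)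
  next
    case (Suc k)
    show ?case
      by (rule Ck_on_SucI[where f' = "\<lambda>t v. flat_exp ([:0, 0, 1:] * (p - pderiv p)) t * v"])
      (use flat_exp_DERIV Ck_on_mult[OF open_UNIV Suc Ck_on_const] in
          \<open>auto simp: has_field_derivative_def\<close>)
  qed
qed

text \<open>Nesting \<psi> inside \<psi> avoids the usual quotient of two functions: the only
  division is by the constant \<psi> a, so smoothness follows from products and compositions. Where
  q \<le> 0 the inner \<psi> vanishes and the value is \<psi> a / \<psi> a = 1; where q \<ge> 1 the
  inner \<psi> is at least a = \<psi> 1 and the outer argument is not positive.\<close>

lemma smooth_bump_exists:
  fixes x :: "'a::euclidean_space"
  assumes "0 < r" "r < R"
  obtains \<beta> :: "'a \<Rightarrow> real" where "smooth_on UNIV \<beta>"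
    "\<And>y. y \<in> ball x r \<Longrightarrow> \<beta> y = 1" "\<And>y. y \<notin> ball x R \<Longrightarrow> \<beta> y = 0"
proof -
  define \<psi> where "\<psi> = flat_exp 1"
  define a where "a = \<psi> 1"
  have a: "a > 0" by (simp add: a_def \<psi>_def flat_exp_def)
  have \<psi>0: "\<psi> t = 0" if "t \<le> 0" for t
    using that by (simp add: \<psi>_def flat_exp_def)
  have \<psi>pos: "\<psi> t > 0" if "t > 0" for t using that by (auto simp: \<psi>_def flat_exp_def)
  have \<psi>1: "\<psi> t \<ge> a" if "t \<ge> 1" for t
    using that by (auto simp: a_def \<psi>_def flat_exp_def)
  have s\<psi>: "smooth_on UNIV \<psi>" by (simp add: \<psi>_def smooth_on_flat_exp)
  \<comment> \<open>Normalised to be at most 0 on the inner ball and at least 1 off the outer one;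
    the squared norm keeps it smooth at the centre.\<close>
  define q where "q y = ((y - x) \<bullet> (y - x) - r\<^sup>2) * (1 / (R\<^sup>2 - r\<^sup>2))" for y
  define \<beta> where "\<beta> y = \<psi> (a - \<psi> (q y)) * (1 / \<psi> a)" for y
  have RR: "R\<^sup>2 - r\<^sup>2 > 0" using assms by (simp add: power_strict_mono)
  have "smooth_on UNIV q"
    unfolding q_def by (intro smooth_on_mult smooth_on_diff smooth_on_inner smooth_on_const smooth_on_ident open_UNIV)
  then have "smooth_on UNIV (\<lambda>y. \<psi> (q y))"
    using smooth_on_compose[OF open_UNIV open_UNIV subset_UNIV _ s\<psi>] by blast
  then have "smooth_on UNIV (\<lambda>y. \<psi> (a - \<psi> (q y)))"
    using smooth_on_compose[OF open_UNIV open_UNIV subset_UNIV _ s\<psi>]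
      smooth_on_diff[OF open_UNIV smooth_on_const] by blast
  then have "smooth_on UNIV \<beta>"
    unfolding \<beta>_def by (intro smooth_on_mult) auto
  moreover have "\<beta> y = 1" if "y \<in> ball x r" for y
  proof -
    have "(norm (y - x))\<^sup>2 \<le> r\<^sup>2"
      using that by (intro power_mono) (auto simp: dist_norm norm_minus_commute)
    then have "q y \<le> 0" using RR by (simp add: q_def power2_norm_eq_inner field_simps)
    then show ?thesis using \<psi>0 \<psi>pos[of a] \<psi>pos[of 1] by (simp add: \<beta>_def a_def)
  qed
  moreover have "\<beta> y = 0" if "y \<notin> ball x R" for y
  proof -
    have "(norm (y - x))\<^sup>2 \<ge> R\<^sup>2"
      using that assms by (intro power_mono) (auto simp: dist_norm norm_minus_commute)
    then have "q y \<ge> 1" using RR by (simp add: q_def power2_norm_eq_inner field_simps)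
    then show ?thesis using \<psi>0 \<psi>1 by (simp add: \<beta>_def)
  qed
  ultimately show ?thesis using that by blast
qed

text \<open>The rule \<open>leibniz_rule\<close> wants a derivative that is continuous as a map into
  bounded linear functions. In finite dimension continuity in each fixed direction suffices, and
  this is what \<open>Ck_on\<close> supplies.\<close>

lemma leibniz_rule_unit_interval:
  fixes f :: "'a::euclidean_space \<Rightarrow> real \<Rightarrow> 'c::euclidean_space"
  assumes U: "open U" "convex U" "x0 \<in> U"
    and der: "\<And>x t. x \<in> U \<Longrightarrow> t \<in> {0..1} \<Longrightarrow> ((\<lambda>x. f x t) has_derivative f' x t) (at x)"
    and cf': "\<And>v. continuous_on (U \<times> {0..1}) (\<lambda>(x, t). f' x t v)"
    and cf: "\<And>x. x \<in> U \<Longrightarrow> continuous_on {0..1} (f x)"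
  shows "((\<lambda>x. integral {0..1} (f x)) has_derivative (\<lambda>v. integral {0..1} (\<lambda>t. f' x0 t v))) (at x0)"
proof -
  define fx where "fx x t = Blinfun (f' x t)" for x t
  have bl: "bounded_linear (f' x t)" if "x \<in> U" "t \<in> {0..1}" for x t
    using der[OF that] has_derivative_bounded_linear by blast
  have fx: "blinfun_apply (fx x t) = f' x t" if "x \<in> U" "t \<in> {0..1}" for x t
    unfolding fx_def by (rule bounded_linear_Blinfun_apply[OF bl[OF that]])
  have cfx: "continuous_on (U \<times> cbox 0 1) (\<lambda>(x, t). fx x t)"
  proof (rule continuous_on_blinfun_componentwise)
    fix i :: 'a
    have "continuous_on (U \<times> {0..1}) (\<lambda>z. blinfun_apply (case z of (x, t) \<Rightarrow> fx x t) i)"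
      using cf'[of i] by (rule iffD1[OF continuous_on_cong, rotated -1]) (auto simp: fx)
    then show "continuous_on (U \<times> cbox 0 1) (\<lambda>z. blinfun_apply (case z of (x, t) \<Rightarrow> fx x t) i)"
      by simp
  qed
  have D: "((\<lambda>x. integral (cbox 0 1) (f x)) has_derivative integral (cbox 0 1) (fx x0)) (at x0 within U)"
  proof (rule leibniz_rule[OF _ _ cfx U(3,2)])
    show "((\<lambda>x. f x t) has_derivative blinfun_apply (fx x t)) (at x within U)"
      if "x \<in> U" "t \<in> cbox 0 1" for x t
      using has_derivative_at_withinI[OF der] fx that by simp
    show "f x integrable_on cbox 0 1" if "x \<in> U" for x
      using integrable_continuous_interval[OF cf[OF that]] by simp
  qed
  have "continuous_on {0..1} (fx x0)"
    using continuous_on_compose2[OF cfx, of "{0..1}" "\<lambda>t. (x0, t)"] U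
    by (simp add: continuous_on_Pair image_subset_iff)
  then have "fx x0 integrable_on {0..1}" by (rule integrable_continuous_interval)
  then have "blinfun_apply (integral {0..1} (fx x0)) v = integral {0..1} (\<lambda>t. fx x0 t v)" for v
    using integral_linear[of "fx x0" "{0..1}" "\<lambda>F. blinfun_apply F v"]
    by (auto simp: o_def blinfun.bounded_linear_left)
  moreover have "integral {0..1} (\<lambda>t. fx x0 t v) = integral {0..1} (\<lambda>t. f' x0 t v)" for v
    by (rule integral_cong) (use fx U in auto)
  ultimately have "blinfun_apply (integral {0..1} (fx x0)) = (\<lambda>v. integral {0..1} (\<lambda>t. f' x0 t v))"
    by (intro ext) simp
  with D show ?thesis
    by (simp add: at_within_open[OF U(3,1)])
qed

lemma ray_in_ball:
  fixes x :: "'a::real_normed_vector"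
  assumes "y \<in> ball x r" "0 \<le> t" "t \<le> 1"
  shows "x + t *\<^sub>R (y - x) \<in> ball x r"
proof -
  have "norm (t *\<^sub>R (y - x)) \<le> norm (y - x)" using assms by (simp add: mult_left_le_one_le)
  then show ?thesis using assms by (simp add: dist_norm norm_minus_commute)
qed

lemma continuous_on_rays:
  fixes x :: "'a::real_normed_vector"
  assumes "continuous_on (ball x r) F"
  shows "continuous_on (ball x r \<times> {0..1}) (\<lambda>z. F (x + snd z *\<^sub>R (fst z - x)))"
proof (rule continuous_on_compose2[OF assms])
  show "continuous_on (ball x r \<times> {0..1}) (\<lambda>z. x + snd z *\<^sub>R (fst z - x))"
    by (intro continuous_intros)
qed (use ray_in_ball in auto)

lemma continuous_on_ray:
  fixes x :: "'a::real_normed_vector"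
  assumes "continuous_on (ball x r) F" "y \<in> ball x r"
  shows "continuous_on {0..1} (\<lambda>t. F (x + t *\<^sub>R (y - x)))"
proof (rule continuous_on_compose2[OF assms(1)])
  show "continuous_on {0..1} (\<lambda>t. x + t *\<^sub>R (y - x))"
    by (intro continuous_intros)
qed (use ray_in_ball[OF assms(2)] in auto)

text \<open>Each differentiation in y under the integral produces one more factor t. The weight
  \<open>t ^ j\<close> with arbitrary j makes the statement stable under the induction.\<close>

lemma Ck_on_ray_integral:
  fixes F :: "'a::euclidean_space \<Rightarrow> 'c::euclidean_space"
  assumes "Ck_on k (ball x r) F"
  shows "Ck_on k (ball x r) (\<lambda>y. integral {0..1} (\<lambda>t. t ^ j *\<^sub>R F (x + t *\<^sub>R (y - x))))"
  using assms
proof (induction k arbitrary: F j)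
  case 0
  have "continuous_on (ball x r \<times> cbox 0 1) (\<lambda>(y, t). t ^ j *\<^sub>R F (x + t *\<^sub>R (y - x)))"
    unfolding split_beta
    using continuous_on_rays[of x r F] 0 by (intro continuous_intros) auto
  from integral_continuous_on_param[OF this] show ?case by simp
next
  case (Suc k)
  let ?F = "\<lambda>y. frechet_derivative F (at y)"
  have c: "continuous_on (ball x r) (\<lambda>y. ?F y v)" for v
    using Suc.prems by (intro Ck_on_continuous[of k]) simp
  have cF: "continuous_on (ball x r) F" using Suc.prems Ck_on_continuous by blast
  show ?case
  proof (rule Ck_on_SucI[where f' = "\<lambda>y v. integral {0..1} (\<lambda>t. t ^ Suc j *\<^sub>R ?F (x + t *\<^sub>R (y - x)) v)"])
    fix y assume y: "y \<in> ball x r"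
    show "((\<lambda>y. integral {0..1} (\<lambda>t. t ^ j *\<^sub>R F (x + t *\<^sub>R (y - x)))) has_derivative
        (\<lambda>v. integral {0..1} (\<lambda>t. t ^ Suc j *\<^sub>R ?F (x + t *\<^sub>R (y - x)) v))) (at y)"
    proof (rule leibniz_rule_unit_interval[OF open_ball convex_ball y])
      fix y t assume yt: "y \<in> ball x r" "t \<in> {0..1::real}"
      have D: "(F has_derivative ?F (x + t *\<^sub>R (y - x))) (at (x + t *\<^sub>R (y - x)))"
        by (intro Ck_on_SucD[OF Suc.prems] ray_in_ball) (use yt in auto)
      have "((\<lambda>y. x + t *\<^sub>R (y - x)) has_derivative (\<lambda>v. t *\<^sub>R v)) (at y)"
        by (auto intro!: derivative_eq_intros)
      from has_derivative_compose[OF this D]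
      have "((\<lambda>y. t ^ j *\<^sub>R F (x + t *\<^sub>R (y - x))) has_derivative
          (\<lambda>v. t ^ j *\<^sub>R ?F (x + t *\<^sub>R (y - x)) (t *\<^sub>R v))) (at y)"
        by (rule has_derivative_scaleR_right)
      then show "((\<lambda>y. t ^ j *\<^sub>R F (x + t *\<^sub>R (y - x))) has_derivative
          (\<lambda>v. t ^ Suc j *\<^sub>R ?F (x + t *\<^sub>R (y - x)) v)) (at y)"
        using linear_scale[OF has_derivative_linear[OF D]] by (simp add: mult.commute)
    next
      show "continuous_on (ball x r \<times> {0..1}) (\<lambda>(y, t). t ^ Suc j *\<^sub>R ?F (x + t *\<^sub>R (y - x)) v)" for v
        unfolding split_beta
        by (intro continuous_intros continuous_on_rays[OF c])
    next
      fix y assume "y \<in> ball x r"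
      then show "continuous_on {0..1} (\<lambda>t. t ^ j *\<^sub>R F (x + t *\<^sub>R (y - x)))"
        by (intro continuous_intros continuous_on_ray[OF cF])
    qed
  next
    show "Ck_on k (ball x r) (\<lambda>y. integral {0..1} (\<lambda>t. t ^ Suc j *\<^sub>R ?F (x + t *\<^sub>R (y - x)) v))" for v
      using Suc.prems by (intro Suc.IH) simp
  qed simp
qed

text \<open>Integrate the derivative of f along the segment from x to y and expand the direction in
  the basis. The coefficient \<open>g b\<close> is the mean of the partial derivative along the
  segment, so at x it is that partial derivative itself.\<close>

lemma Hadamard_smooth:
  fixes f :: "'a::euclidean_space \<Rightarrow> real"
  assumes f: "smooth_on (ball x r) f" and "r > 0"
  obtains g where "\<And>b. smooth_on (ball x r) (g b)"
    "\<And>y. y \<in> ball x r \<Longrightarrow> f y = f x + (\<Sum>b\<in>Basis. ((y - x) \<bullet> b) * g b y)"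
    "\<And>b. g b x = frechet_derivative f (at x) b"
proof -
  let ?f = "\<lambda>y. frechet_derivative f (at y)"
  define g where "g b y = integral {0..1} (\<lambda>t. ?f (x + t *\<^sub>R (y - x)) b)" for b y
  have D: "(f has_derivative ?f y) (at y)" if "y \<in> ball x r" for y
    using smooth_on_has_derivative[OF f that] .
  have "smooth_on (ball x r) (g b)" for b
  proof (rule smooth_onI)
    have "Ck_on k (ball x r) (\<lambda>y. ?f y b)" for k
      using smooth_onD[OF f, of "Suc k"] by simp
    from Ck_on_ray_integral[OF this, where j = 0] show "Ck_on k (ball x r) (g b)" for k
      by (simp add: g_def[abs_def])
  qed
  moreover have "f y = f x + (\<Sum>b\<in>Basis. ((y - x) \<bullet> b) * g b y)" if y: "y \<in> ball x r" for y
  proof -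
    have c: "continuous_on {0..1} (\<lambda>t. ?f (x + t *\<^sub>R (y - x)) b)" for b
      using continuous_on_ray[OF smooth_on_continuous[OF smooth_on_frechet_derivative[OF f]] y] .
    have der: "((\<lambda>t. f (x + t *\<^sub>R (y - x))) has_vector_derivative ?f (x + t *\<^sub>R (y - x)) (y - x)) (at t within {0..1})"
      if t: "t \<in> {0..1}" for t
    proof -
      have "((\<lambda>t. x + t *\<^sub>R (y - x)) has_derivative (\<lambda>s. s *\<^sub>R (y - x))) (at t within {0..1})"
        by (auto intro!: derivative_eq_intros)
      moreover have D': "(f has_derivative ?f (x + t *\<^sub>R (y - x))) (at (x + t *\<^sub>R (y - x)))"
        by (intro D ray_in_ball[OF y]) (use t in auto)
      ultimately have "((\<lambda>t. f (x + t *\<^sub>R (y - x))) has_derivative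
          (\<lambda>s. ?f (x + t *\<^sub>R (y - x)) (s *\<^sub>R (y - x)))) (at t within {0..1})"
        by (rule has_derivative_compose)
      then show ?thesis
        using linear_scale[OF has_derivative_linear[OF D']] by (simp add: has_vector_derivative_def)
    qed
    have "((\<lambda>t. ?f (x + t *\<^sub>R (y - x)) (y - x)) has_integral f y - f x) {0..1}"
      using fundamental_theorem_of_calculus[OF _ der] by simp
    then have "f y - f x = integral {0..1} (\<lambda>t. ?f (x + t *\<^sub>R (y - x)) (y - x))"
      by (simp add: integral_unique)
    also have "\<dots> = integral {0..1} (\<lambda>t. \<Sum>b\<in>Basis. ((y - x) \<bullet> b) * ?f (x + t *\<^sub>R (y - x)) b)"
    proof (rule integral_cong)
      fix t assume "t \<in> {0..1::real}"
      then have "linear (?f (x + t *\<^sub>R (y - x)))"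
        by (intro has_derivative_linear[OF D] ray_in_ball[OF y]) auto
      from linear_euclidean_expand[OF this, of "y - x"]
      show "?f (x + t *\<^sub>R (y - x)) (y - x) = (\<Sum>b\<in>Basis. ((y - x) \<bullet> b) * ?f (x + t *\<^sub>R (y - x)) b)"
        by simp
    qed
    also have "\<dots> = (\<Sum>b\<in>Basis. ((y - x) \<bullet> b) * g b y)"
      using c by (subst integral_sum) (auto intro!: integrable_continuous_interval continuous_intros simp: g_def)
    finally show ?thesis by simp
  qed
  moreover have "g b x = ?f x b" for b by (simp add: g_def)
  ultimately show ?thesis using that by blast
qed

section \<open>Affine total differential equations\<close>

text \<open>The equation to be solved, not stated in the locale, is u'(x) v = v + \<Omega> x v (u
  x). The condition \<open>C * r \<le> 1 / 2\<close> makes the Picard operator halve distances on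
  the ball.\<close>

locale affine_total_system =
  fixes y0 :: "'e::euclidean_space" and r C :: real and \<Omega> :: "'e \<Rightarrow> 'e \<Rightarrow>\<^sub>L 'e \<Rightarrow>\<^sub>L 'e"
  assumes r: "r > 0" and C: "C \<ge> 0" "C * r \<le> 1 / 2"
    and C1: "Ck_on (Suc 0) (ball y0 r) \<Omega>"
    and bound: "x \<in> ball y0 r \<Longrightarrow> norm (\<Omega> x v z) \<le> C * norm v * norm z"
begin

abbreviation "\<Omega>' x \<equiv> frechet_derivative \<Omega> (at x)"

definition "pt x t = y0 + t *\<^sub>R (x - y0)"

text \<open>Measures how far u is from solving the equation at x in direction v.\<close>

definition defect :: "('e \<Rightarrow> 'e) \<Rightarrow> 'e \<Rightarrow> 'e \<Rightarrow> 'e" where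
  "defect u x v = frechet_derivative u (at x) v - v - \<Omega> x v (u x)"

text \<open>The equation integrated along the ray from \<open>y0\<close> to x. Its velocity is
  constantly x - y0, so the inhomogeneous term integrates to x - y0.\<close>

definition picard :: "'e \<Rightarrow> ('e \<Rightarrow> 'e) \<Rightarrow> 'e \<Rightarrow> 'e" where
  "picard c u x = c + (x - y0) + integral {0..1} (\<lambda>t. \<Omega> (pt x t) (x - y0) (u (pt x t)))"

lemma pt_in: "x \<in> ball y0 r \<Longrightarrow> t \<in> {0..1} \<Longrightarrow> pt x t \<in> ball y0 r"
  unfolding pt_def by (intro ray_in_ball) auto

lemma pt_1 [simp]: "pt x 1 = x"
  by (simp add: pt_def)

lemma cont_pt: "continuous_on (ball y0 r) F \<Longrightarrow> x \<in> ball y0 r \<Longrightarrow> continuous_on {0..1} (\<lambda>t. F (pt x t))"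
  unfolding pt_def by (rule continuous_on_ray)

lemma cont_pts: "continuous_on (ball y0 r) F \<Longrightarrow>
    continuous_on (ball y0 r \<times> {0..1}) (\<lambda>z. F (pt (fst z) (snd z)))"
  unfolding pt_def by (rule continuous_on_rays)

lemma D\<Omega>: "x \<in> ball y0 r \<Longrightarrow> (\<Omega> has_derivative \<Omega>' x) (at x)"
  using Ck_on_SucD[OF C1] .

lemma cont_\<Omega>: "continuous_on (ball y0 r) \<Omega>"
  using Ck_on_continuous[OF C1] .

lemma cont_\<Omega>': "continuous_on (ball y0 r) (\<lambda>x. \<Omega>' x v)"
  using C1 by simp

lemma picard_integrand_integrable:
  assumes "continuous_on (ball y0 r) u" "x \<in> ball y0 r"
  shows "(\<lambda>t. \<Omega> (pt x t) (x - y0) (u (pt x t))) integrable_on {0..1}"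
  by (intro integrable_continuous_interval continuous_intros cont_pt[OF cont_\<Omega>] cont_pt[OF assms(1)] assms(2))

lemma integral_norm_le:
  fixes f :: "real \<Rightarrow> 'e"
  assumes "f integrable_on {0..1}" "\<And>t. t \<in> {0..1} \<Longrightarrow> norm (f t) \<le> B"
  shows "norm (integral {0..1} f) \<le> B"
  using integral_norm_bound_integral[OF assms(1), of "\<lambda>_. B"] assms(2)
  by (auto simp: integrable_const_ivl)

text \<open>The ray has length at most r, so each integrand difference is at most C r d, which is at
  most d / 2.\<close>

lemma picard_contract:
  assumes u: "continuous_on (ball y0 r) u" "continuous_on (ball y0 r) w"
    and d: "\<And>x. x \<in> ball y0 r \<Longrightarrow> norm (u x - w x) \<le> d" and x: "x \<in> ball y0 r"
  shows "norm (picard c u x - picard c w x) \<le> d / 2"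
proof -
  have "d \<ge> 0" using d[OF x] norm_ge_zero order_trans by blast
  have "norm (integral {0..1} (\<lambda>t. \<Omega> (pt x t) (x - y0) (u (pt x t)) - \<Omega> (pt x t) (x - y0) (w (pt x t)))) \<le> d / 2"
  proof (rule integral_norm_le)
    fix t :: real assume t: "t \<in> {0..1}"
    have "norm (\<Omega> (pt x t) (x - y0) (u (pt x t) - w (pt x t))) \<le> C * norm (x - y0) * norm (u (pt x t) - w (pt x t))"
      by (rule bound[OF pt_in[OF x t]])
    also have "\<dots> \<le> (C * r) * d"
      using x d[OF pt_in[OF x t]] C r
      by (intro mult_mono) (auto simp: dist_norm norm_minus_commute intro!: mult_left_mono)
    also have "\<dots> \<le> d / 2" using mult_right_mono[OF C(2) \<open>d \<ge> 0\<close>] by simp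
    finally show "norm (\<Omega> (pt x t) (x - y0) (u (pt x t)) - \<Omega> (pt x t) (x - y0) (w (pt x t))) \<le> d / 2"
      by (simp add: blinfun.diff_right)
  qed (intro integrable_diff picard_integrand_integrable u x)
  then show ?thesis
    using integral_diff[OF picard_integrand_integrable[OF u(1) x] picard_integrand_integrable[OF u(2) x]]
    by (simp add: picard_def)
qed

end

text \<open>Integrability conditions: for a solution, the second derivative in directions v and w is
  \<Omega>' x w v u + \<Omega> x v w + \<Omega> x v (\<Omega> x w u). Its symmetry in v and w is
  \<open>sym\<close> for the part free of u and \<open>flat\<close> for the part linear in
  u.\<close>

locale flat_affine_total_system = affine_total_system +
  assumes sym: "x \<in> ball y0 r \<Longrightarrow> \<Omega> x v w = \<Omega> x w v"
    and flat: "x \<in> ball y0 r \<Longrightarrow> \<Omega>' x w v z + \<Omega> x v (\<Omega> x w z) = \<Omega>' x v w z + \<Omega> x w (\<Omega> x v z)"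
begin

text \<open>
  By flatness the derivative of a Picard iterate solves the equation up to a term that is
  controlled by the defect of the preceding iterate; no bound on the derivatives of \<open>\<Omega>\<close> is needed.
\<close>

lemma picard_has_derivative:
  assumes u: "Ck_on (Suc 0) (ball y0 r) u" and x: "x \<in> ball y0 r"
  shows "(picard c u has_derivative (\<lambda>v. v + \<Omega> x v (u x) + integral {0..1} (\<lambda>t. t *\<^sub>R
    (\<Omega> (pt x t) (x - y0) (defect u (pt x t) v) - \<Omega> (pt x t) v (defect u (pt x t) (x - y0)))))) (at x)"
proof -
  let ?u' = "\<lambda>y. frechet_derivative u (at y)"
  define f' where "f' x t v = t *\<^sub>R \<Omega>' (pt x t) v (x - y0) (u (pt x t)) + \<Omega> (pt x t) v (u (pt x t))
    + t *\<^sub>R \<Omega> (pt x t) (x - y0) (?u' (pt x t) v)" for x t v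
  have Du: "(u has_derivative ?u' y) (at y)" if "y \<in> ball y0 r" for y
    using Ck_on_SucD[OF u that] .
  have cu: "continuous_on (ball y0 r) u" using Ck_on_continuous[OF u] .
  have cu': "continuous_on (ball y0 r) (\<lambda>y. ?u' y v)" for v using u by simp
  have Dpt: "((\<lambda>x. pt x t) has_derivative (\<lambda>v. t *\<^sub>R v)) (at y)" for t y
    unfolding pt_def by (auto intro!: derivative_eq_intros)
  have linu: "?u' y (a *\<^sub>R v) = a *\<^sub>R ?u' y v" "?u' y (v - w) = ?u' y v - ?u' y w" if "y \<in> ball y0 r" for a y v w
    using has_derivative_linear[OF Du[OF that]] by (simp_all add: linear_scale linear_diff)
  have lin\<Omega>: "\<Omega>' y (a *\<^sub>R v) = a *\<^sub>R \<Omega>' y v" if "y \<in> ball y0 r" for a y v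
    using has_derivative_linear[OF D\<Omega>[OF that]] by (simp add: linear_scale)
  have "((\<lambda>x. integral {0..1} (\<lambda>t. \<Omega> (pt x t) (x - y0) (u (pt x t)))) has_derivative
      (\<lambda>v. integral {0..1} (\<lambda>t. f' x t v))) (at x)"
  proof (rule leibniz_rule_unit_interval[OF open_ball convex_ball x])
    fix y t assume y: "y \<in> ball y0 r" and t: "t \<in> {0..1::real}"
    note p = pt_in[OF y t]
    have 1: "((\<lambda>x. \<Omega> (pt x t)) has_derivative (\<lambda>v. \<Omega>' (pt y t) (t *\<^sub>R v))) (at y)"
      by (rule has_derivative_compose[OF Dpt D\<Omega>[OF p]])
    have 2: "((\<lambda>x. u (pt x t)) has_derivative (\<lambda>v. ?u' (pt y t) (t *\<^sub>R v))) (at y)"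
      by (rule has_derivative_compose[OF Dpt Du[OF p]])
    have 3: "((\<lambda>x. x - y0) has_derivative (\<lambda>v. v)) (at y)"
      by (auto intro!: derivative_eq_intros)
    have "((\<lambda>x. \<Omega> (pt x t) (x - y0) (u (pt x t))) has_derivative
        (\<lambda>v. \<Omega> (pt y t) (y - y0) (?u' (pt y t) (t *\<^sub>R v)) +
          (\<Omega> (pt y t) v + \<Omega>' (pt y t) (t *\<^sub>R v) (y - y0)) (u (pt y t)))) (at y)"
      by (rule bounded_bilinear.FDERIV[OF bounded_bilinear_blinfun_apply
          bounded_bilinear.FDERIV[OF bounded_bilinear_blinfun_apply 1 3] 2])
    then show "((\<lambda>x. \<Omega> (pt x t) (x - y0) (u (pt x t))) has_derivative f' y t) (at y)"
      by (rule has_derivative_eq_rhs)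
        (simp add: f'_def linu(1)[OF p] lin\<Omega>[OF p] blinfun.scaleR_left blinfun.scaleR_right blinfun.add_left algebra_simps fun_eq_iff)
  next
    show "continuous_on (ball y0 r \<times> {0..1}) (\<lambda>(x, t). f' x t v)" for v
      unfolding f'_def split_beta
      by (intro continuous_intros cont_pts[OF cont_\<Omega>] cont_pts[OF cont_\<Omega>'] cont_pts[OF cu] cont_pts[OF cu'])
  next
    show "continuous_on {0..1} (\<lambda>t. \<Omega> (pt y t) (y - y0) (u (pt y t)))" if "y \<in> ball y0 r" for y
      by (intro continuous_intros cont_pt[OF cont_\<Omega>] cont_pt[OF cu] that)
  qed
  then have D1: "(picard c u has_derivative (\<lambda>v. v + integral {0..1} (\<lambda>t. f' x t v))) (at x)"
    unfolding picard_def by (auto intro!: derivative_eq_intros)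
  have "integral {0..1} (\<lambda>t. f' x t v) = \<Omega> x v (u x) + integral {0..1} (\<lambda>t. t *\<^sub>R
    (\<Omega> (pt x t) (x - y0) (defect u (pt x t) v) - \<Omega> (pt x t) v (defect u (pt x t) (x - y0))))" for v
  proof -
    \<comment> \<open>The derivative in t of t \<Omega> (pt x t) v (u (pt x t)), which is 0 at t = 0
      and \<Omega> x v (u x) at t = 1. Its integral is thus the boundary term of the claim.\<close>
    define g where "g t = \<Omega> (pt x t) v (u (pt x t)) + t *\<^sub>R \<Omega>' (pt x t) (x - y0) v (u (pt x t))
        + t *\<^sub>R \<Omega> (pt x t) v (?u' (pt x t) (x - y0))" for t
    let ?h = "\<lambda>t. t *\<^sub>R (\<Omega> (pt x t) (x - y0) (defect u (pt x t) v) - \<Omega> (pt x t) v (defect u (pt x t) (x - y0)))"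
    have Dt: "(pt x has_derivative (\<lambda>s. s *\<^sub>R (x - y0))) (at t within {0..1})" for t
      unfolding pt_def by (auto intro!: derivative_eq_intros)
    have "((\<lambda>t. t *\<^sub>R \<Omega> (pt x t) v (u (pt x t))) has_vector_derivative g t) (at t within {0..1})"
      if t: "t \<in> {0..1}" for t
    proof -
      note p = pt_in[OF x t]
      have 1: "((\<lambda>t. \<Omega> (pt x t)) has_derivative (\<lambda>s. \<Omega>' (pt x t) (s *\<^sub>R (x - y0)))) (at t within {0..1})"
        by (rule has_derivative_compose[OF Dt D\<Omega>[OF p]])
      have 2: "((\<lambda>t. u (pt x t)) has_derivative (\<lambda>s. ?u' (pt x t) (s *\<^sub>R (x - y0)))) (at t within {0..1})"
        by (rule has_derivative_compose[OF Dt Du[OF p]])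
      have "((\<lambda>t. t *\<^sub>R \<Omega> (pt x t) v (u (pt x t))) has_derivative
         (\<lambda>s. t *\<^sub>R (\<Omega> (pt x t) v (?u' (pt x t) (s *\<^sub>R (x - y0))) +
          (\<Omega> (pt x t) 0 + \<Omega>' (pt x t) (s *\<^sub>R (x - y0)) v) (u (pt x t))) + s *\<^sub>R \<Omega> (pt x t) v (u (pt x t)))) (at t within {0..1})"
        by (rule has_derivative_scaleR[OF has_derivative_ident bounded_bilinear.FDERIV[OF bounded_bilinear_blinfun_apply
          bounded_bilinear.FDERIV[OF bounded_bilinear_blinfun_apply 1 has_derivative_const] 2]])
      then show ?thesis
        unfolding has_vector_derivative_def
        by (rule has_derivative_eq_rhs)
          (simp add: g_def linu(1)[OF p] lin\<Omega>[OF p] blinfun.scaleR_left blinfun.scaleR_right scaleR_add_right ac_simps fun_eq_iff)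
    qed
    from fundamental_theorem_of_calculus[OF zero_le_one this]
    have g: "(g has_integral \<Omega> x v (u x)) {0..1}" by simp
    have h: "?h integrable_on {0..1}"
      unfolding defect_def
      by (intro integrable_continuous_interval continuous_intros cont_pt[OF cont_\<Omega>] cont_pt[OF cu] cont_pt[OF cu'] x)
    \<comment> \<open>In f' - g two derivatives of \<Omega> with exchanged directions remain.
      \<open>flat\<close> trades them for compositions of \<Omega>, which complete the derivatives
      of u to defects; the terms from the summand v of the defect cancel by
      \<open>sym\<close>.\<close>
    have "integral {0..1} (\<lambda>t. f' x t v) = integral {0..1} (\<lambda>t. g t + ?h t)"
    proof (rule integral_cong)
      fix t :: real assume t: "t \<in> {0..1}"
      let ?p = "pt x t"
      define \<xi> where "\<xi> = x - y0"
      have "\<Omega>' ?p v \<xi> (u ?p) = \<Omega>' ?p \<xi> v (u ?p) + \<Omega> ?p v (\<Omega> ?p \<xi> (u ?p)) - \<Omega> ?p \<xi> (\<Omega> ?p v (u ?p))"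
        using flat[OF pt_in[OF x t], of v \<xi> "u ?p"] by (simp add: algebra_simps)
      then have "t *\<^sub>R \<Omega>' ?p v \<xi> (u ?p) = t *\<^sub>R \<Omega>' ?p \<xi> v (u ?p) + t *\<^sub>R \<Omega> ?p v (\<Omega> ?p \<xi> (u ?p))
          - t *\<^sub>R \<Omega> ?p \<xi> (\<Omega> ?p v (u ?p))"
        by (simp only: scaleR_add_right scaleR_diff_right)
      then show "f' x t v = g t + ?h t"
        using sym[OF pt_in[OF x t], of v \<xi>]
        unfolding f'_def g_def defect_def \<xi>_def[symmetric]
        by (simp add: blinfun.diff_right blinfun.add_right algebra_simps)
    qed
    also have "\<dots> = \<Omega> x v (u x) + integral {0..1} ?h"
      using g h by (simp add: integral_add has_integral_integrable integral_unique)
    finally show ?thesis .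
  qed
  with D1 show ?thesis by (simp add: add.assoc)
qed

lemma picard_C1:
  assumes u: "Ck_on (Suc 0) (ball y0 r) u"
  shows "Ck_on (Suc 0) (ball y0 r) (picard c u)"
proof (rule Ck_on_SucI[OF open_ball picard_has_derivative[OF u]])
  have cu: "continuous_on (ball y0 r) u" using Ck_on_continuous[OF u] .
  have cu': "continuous_on (ball y0 r) (\<lambda>y. frechet_derivative u (at y) v)" for v using u by simp
  fix v
  \<comment> \<open>Class C^1 gives continuity of the derivative in fixed directions, but the second
    defect is taken in the moving direction x - y0. It is therefore expanded in the basis before
    continuity is claimed.\<close>
  have "continuous_on (ball y0 r \<times> cbox 0 1) (\<lambda>(x, t). t *\<^sub>R (\<Omega> (pt x t) (x - y0) (defect u (pt x t) v)
      - (\<Sum>b\<in>Basis. ((x - y0) \<bullet> b) *\<^sub>R \<Omega> (pt x t) v (defect u (pt x t) b))))"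
    unfolding split_beta defect_def box_real
    by (intro continuous_intros cont_pts[OF cont_\<Omega>] cont_pts[OF cu] cont_pts[OF cu'])
  from integral_continuous_on_param[OF this]
  have "continuous_on (ball y0 r) (\<lambda>x. integral {0..1} (\<lambda>t. t *\<^sub>R (\<Omega> (pt x t) (x - y0) (defect u (pt x t) v)
      - (\<Sum>b\<in>Basis. ((x - y0) \<bullet> b) *\<^sub>R \<Omega> (pt x t) v (defect u (pt x t) b)))))"
    by simp
  moreover have "\<Omega> (pt x t) v (defect u (pt x t) (x - y0))
      = (\<Sum>b\<in>Basis. ((x - y0) \<bullet> b) *\<^sub>R \<Omega> (pt x t) v (defect u (pt x t) b))"
    if "x \<in> ball y0 r" "t \<in> {0..1}" for x t
  proof (rule linear_euclidean_expand)
    have "linear (frechet_derivative u (at (pt x t)))"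
      using has_derivative_linear[OF Ck_on_SucD[OF u pt_in[OF that]]] .
    then show "linear (\<lambda>w. \<Omega> (pt x t) v (defect u (pt x t) w))"
      by (auto intro!: linearI simp: defect_def linear_add linear_scale blinfun.add_right
          blinfun.diff_right blinfun.scaleR_right blinfun.add_left blinfun.scaleR_left algebra_simps)
  qed
  ultimately have "continuous_on (ball y0 r) (\<lambda>x. integral {0..1} (\<lambda>t. t *\<^sub>R
      (\<Omega> (pt x t) (x - y0) (defect u (pt x t) v) - \<Omega> (pt x t) v (defect u (pt x t) (x - y0)))))"
    by (auto intro!: integral_cong elim!: continuous_on_eq)
  then show "Ck_on 0 (ball y0 r) (\<lambda>x. v + \<Omega> x v (u x) + integral {0..1} (\<lambda>t. t *\<^sub>R
      (\<Omega> (pt x t) (x - y0) (defect u (pt x t) v) - \<Omega> (pt x t) v (defect u (pt x t) (x - y0)))))"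
    using cu cont_\<Omega> by (auto intro!: continuous_intros)
qed

text \<open>The new defect has two sources. In the integral of \<open>picard_has_derivative\<close>
  the two old defects contribute 2 C r \<le> 1 times e, and the weight t integrates to 1/2. Moreover
  the derivative contains \<Omega> applied to the old iterate where the defect subtracts it at the
  new one, which costs C d.\<close>

lemma defect_picard:
  assumes u: "Ck_on (Suc 0) (ball y0 r) u"
    and e: "\<And>y v. y \<in> ball y0 r \<Longrightarrow> norm (defect u y v) \<le> e * norm v"
    and d: "\<And>y. y \<in> ball y0 r \<Longrightarrow> norm (picard c u y - u y) \<le> d"
    and x: "x \<in> ball y0 r"
  shows "norm (defect (picard c u) x v) \<le> (C * d + e / 2) * norm v"
proof -
  let ?h = "\<lambda>t. t *\<^sub>R (\<Omega> (pt x t) (x - y0) (defect u (pt x t) v) - \<Omega> (pt x t) v (defect u (pt x t) (x - y0)))"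
  have cu: "continuous_on (ball y0 r) u" using Ck_on_continuous[OF u] .
  have cu': "continuous_on (ball y0 r) (\<lambda>y. frechet_derivative u (at y) v)" for v using u by simp
  have int: "?h integrable_on {0..1}"
    unfolding defect_def
    by (intro integrable_continuous_interval continuous_intros cont_pt[OF cont_\<Omega>] cont_pt[OF cu] cont_pt[OF cu'] x)
  \<comment> \<open>The assumed estimate, tested on a basis vector of norm 1, forces e to be
    nonnegative.\<close>
  have "0 \<le> e * norm (SOME b::'a. b \<in> Basis)"
    using e[OF x] norm_ge_zero order_trans by blast
  then have "e \<ge> 0" by (simp add: some_in_eq norm_Basis)
  have xr: "norm (x - y0) \<le> r" using x by (simp add: dist_norm norm_minus_commute)
  have bh: "norm (?h t) \<le> t * (e * norm v)" if t: "t \<in> {0..1}" for t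
  proof -
    note p = pt_in[OF x t]
    have "norm (\<Omega> (pt x t) (x - y0) (defect u (pt x t) v)) \<le> C * norm (x - y0) * (e * norm v)"
      using bound[OF p] e[OF p] C(1) by (meson mult_left_mono mult_nonneg_nonneg norm_ge_zero order_trans)
    moreover have "norm (\<Omega> (pt x t) v (defect u (pt x t) (x - y0))) \<le> C * norm v * (e * norm (x - y0))"
      using bound[OF p] e[OF p] C(1) by (meson mult_left_mono mult_nonneg_nonneg norm_ge_zero order_trans)
    ultimately have "norm (\<Omega> (pt x t) (x - y0) (defect u (pt x t) v) - \<Omega> (pt x t) v (defect u (pt x t) (x - y0)))
        \<le> 2 * (C * norm (x - y0)) * (e * norm v)"
      by (intro order_trans[OF norm_triangle_ineq4]) (simp add: algebra_simps)
    also have "\<dots> \<le> 1 * (e * norm v)"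
      using mult_left_mono[OF xr C(1)] C(2) \<open>e \<ge> 0\<close> by (intro mult_right_mono) auto
    finally show ?thesis using t by (auto intro!: mult_left_mono)
  qed
  have "((\<lambda>t. t * (e * norm v)) has_integral (1\<^sup>2 / 2 * (e * norm v) - 0\<^sup>2 / 2 * (e * norm v))) {0..1::real}"
    by (rule fundamental_theorem_of_calculus)
      (auto intro!: derivative_eq_intros simp flip: has_real_derivative_iff_has_vector_derivative)
  then have 1: "norm (integral {0..1} ?h) \<le> e / 2 * norm v"
    using integral_norm_bound_integral[OF int _ bh] by (auto simp: has_integral_iff)
  have "frechet_derivative (picard c u) (at x) = (\<lambda>v. v + \<Omega> x v (u x) + integral {0..1} (\<lambda>t. t *\<^sub>R
      (\<Omega> (pt x t) (x - y0) (defect u (pt x t) v) - \<Omega> (pt x t) v (defect u (pt x t) (x - y0)))))"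
    using frechet_derivative_at[OF picard_has_derivative[OF u x]] by simp
  then have "defect (picard c u) x v = integral {0..1} ?h - \<Omega> x v (picard c u x - u x)"
    by (simp add: defect_def[of "picard c u"] blinfun.diff_right)
  also have "norm \<dots> \<le> e / 2 * norm v + C * norm v * d"
    using 1 order_trans[OF bound[OF x] mult_left_mono[OF d[OF x], of "C * norm v"]] C(1)
    by (intro order_trans[OF norm_triangle_ineq4] add_mono) auto
  finally show ?thesis by (simp add: algebra_simps)
qed

text \<open>Successive iterates differ by O(2^-n). The defects obey e' = C d 2^-n + e / 2, whose
  solutions are of order n 2^-n and hence below a multiple of (3/4)^n. So the iterates converge
  uniformly, and by their defects so do their derivatives; the limit may be differentiated.\<close>

lemma solution_exists:
  obtains u where "u y0 = c" "\<And>x. x \<in> ball y0 r \<Longrightarrow> (u has_derivative (\<lambda>v. v + \<Omega> x v (u x))) (at x)"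
proof -
  define u where "u n = (picard c ^^ n) (\<lambda>_. c)" for n
  have u0: "u 0 = (\<lambda>_. c)" and uS: "u (Suc n) = picard c (u n)" for n by (simp_all add: u_def)
  have C1u: "Ck_on (Suc 0) (ball y0 r) (u n)" for n
    by (induction n) (simp_all only: u0 uS Ck_on_const picard_C1)
  have cu: "continuous_on (ball y0 r) (u n)" for n using Ck_on_continuous[OF C1u] .
  \<comment> \<open>Bounds the first step: the first iterate differs from c by at most r + norm c /
    2.\<close>
  define d where "d = r + norm c"
  have "d > 0" using r by (simp add: d_def add_pos_nonneg)
  have du: "norm (u (Suc n) x - u n x) \<le> d * (1 / 2) ^ n" if "x \<in> ball y0 r" for n x
    using that
  proof (induction n arbitrary: x)
    case 0
    have "norm (picard c (\<lambda>_. c) x - picard c (\<lambda>_. 0) x) \<le> norm c / 2"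
      by (rule picard_contract) (use 0 in auto)
    moreover have "picard c (\<lambda>_. 0) x - c = x - y0" by (simp add: picard_def blinfun.zero_right)
    moreover have "norm (x - y0) \<le> r" using 0 by (simp add: dist_norm norm_minus_commute)
    ultimately have "norm (picard c (\<lambda>_. c) x - picard c (\<lambda>_. 0) x + (picard c (\<lambda>_. 0) x - c)) \<le> norm c / 2 + r"
      by (metis norm_triangle_mono)
    then have "norm (picard c (\<lambda>_. c) x - c) \<le> norm c / 2 + r" by simp
    moreover have "norm c / 2 + r \<le> d" by (simp add: d_def)
    ultimately show ?case by (simp add: uS u0)
  next
    case (Suc n)
    show ?case
      using picard_contract[OF cu cu Suc.IH Suc.prems, of c] by (simp add: uS)
  qed
  have uy0: "u n y0 = c" for n
    by (cases n) (simp_all add: u0 uS picard_def blinfun.zero_left blinfun.zero_right)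
  \<comment> \<open>The part 1 + C norm c bounds the defect of the constant start function. The part
    4 C d makes C d (3/4)^n at most a quarter of K (3/4)^n, and 1/4 + 1/2 = 3/4 closes the
    induction.\<close>
  define K where "K = 4 * C * d + 1 + C * norm c"
  have K: "K \<ge> 4 * C * d" "K \<ge> 1 + C * norm c" using C(1) \<open>d > 0\<close> by (auto simp: K_def)
  then have "K > 0" using C(1) by (smt (verit) mult_nonneg_nonneg norm_ge_zero)
  have defe: "norm (defect (u n) x v) \<le> K * (3 / 4) ^ n * norm v" if "x \<in> ball y0 r" for n x v
    using that
  proof (induction n arbitrary: x v)
    case 0
    have "norm (defect (u 0) x v) \<le> norm v + norm (\<Omega> x v c)"
      unfolding defect_def u0 using norm_triangle_ineq4[of "- v" "\<Omega> x v c"] by simp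
    also have "\<dots> \<le> (1 + C * norm c) * norm v" using bound[OF 0, of v c] by (simp add: algebra_simps)
    also have "\<dots> \<le> K * norm v" using K by (intro mult_right_mono) auto
    finally show ?case by simp
  next
    case (Suc n)
    have "norm (defect (u (Suc n)) x v) \<le> (C * (d * (1 / 2) ^ n) + (K * (3 / 4) ^ n) / 2) * norm v"
      unfolding uS using defect_picard[OF C1u Suc.IH _ Suc.prems] du uS by metis
    also have "\<dots> \<le> K * (3 / 4) ^ Suc n * norm v"
    proof (rule mult_right_mono)
      have "C * (d * (1 / 2) ^ n) \<le> C * (d * (3 / 4) ^ n)"
        using C(1) \<open>d > 0\<close> by (intro mult_left_mono power_mono) auto
      also have "\<dots> \<le> (K / 4) * (3 / 4) ^ n"
        using mult_right_mono[OF K(1), of "(3 / 4) ^ n"] by (simp add: algebra_simps)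
      finally show "C * (d * (1 / 2) ^ n) + (K * (3 / 4) ^ n) / 2 \<le> K * (3 / 4) ^ Suc n" by simp
    qed simp
    finally show ?case .
  qed
  define g where "g x = c + (\<Sum>n. u (Suc n) x - u n x)" for x
  have sums: "(\<Sum>i<n. u (Suc i) x - u i x) = u n x - c" for n x
    by (induction n) (simp_all add: u0)
  have "uniform_limit (ball y0 r) (\<lambda>n x. \<Sum>i<n. u (Suc i) x - u i x) (\<lambda>x. \<Sum>n. u (Suc n) x - u n x) sequentially"
    by (rule Weierstrass_m_test[of _ _ "\<lambda>n. d * (1 / 2) ^ n"]) (use du in \<open>auto intro: summable_geometric\<close>)
  from uniform_limit_add[OF uniform_limit_const[of "\<lambda>_. c"] this]
  have lim: "uniform_limit (ball y0 r) u g sequentially"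
    by (simp add: sums g_def[abs_def])
  \<comment> \<open>The candidate derivative is formed with g. The derivative of the n-th iterate
    deviates from it by its defect plus \<Omega> applied to u n - g, and each of these gets half of
    the admissible error.\<close>
  have "\<exists>h. \<forall>x\<in>ball y0 r. (\<lambda>n. u n x) \<longlonglongrightarrow> h x \<and>
      (h has_derivative (\<lambda>v. v + \<Omega> x v (g x))) (at x within ball y0 r)"
  proof (rule has_derivative_sequence[OF convex_ball])
    show "(u n has_derivative frechet_derivative (u n) (at x)) (at x within ball y0 r)" if "x \<in> ball y0 r" for n x
      using Ck_on_SucD[OF C1u that] by (rule has_derivative_at_withinI)
    fix \<epsilon> :: real assume "\<epsilon> > 0"
    have "\<forall>\<^sub>F n in sequentially. \<forall>x\<in>ball y0 r. dist (u n x) (g x) < \<epsilon> / (2 * (C + 1))"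
      using lim \<open>\<epsilon> > 0\<close> C(1) by (intro uniform_limitD) auto
    moreover have "(\<lambda>n. K * (3 / 4) ^ n) \<longlonglongrightarrow> K * 0" by (intro tendsto_intros LIMSEQ_power_zero) auto
    then have "\<forall>\<^sub>F n in sequentially. K * (3 / 4) ^ n < \<epsilon> / 2"
      using \<open>\<epsilon> > 0\<close> by (intro order_tendstoD) auto
    ultimately show "\<forall>\<^sub>F n in sequentially. \<forall>x\<in>ball y0 r. \<forall>h.
        norm (frechet_derivative (u n) (at x) h - (h + \<Omega> x h (g x))) \<le> \<epsilon> * norm h"
    proof eventually_elim
      case (elim n)
      show ?case
      proof (intro ballI allI)
        fix x h assume x: "x \<in> ball y0 r"
        have "norm (\<Omega> x h (u n x - g x)) \<le> C * norm h * (\<epsilon> / (2 * (C + 1)))"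
          using elim x C(1) by (intro order_trans[OF bound[OF x]] mult_left_mono) (auto simp: dist_norm less_imp_le)
        also have "\<dots> = C / (C + 1) * (\<epsilon> / 2 * norm h)" using C(1) by (simp add: field_simps)
        also have "\<dots> \<le> 1 * (\<epsilon> / 2 * norm h)"
          using C(1) \<open>\<epsilon> > 0\<close> by (intro mult_right_mono) auto
        finally have 1: "norm (\<Omega> x h (u n x - g x)) \<le> \<epsilon> / 2 * norm h" by simp
        have 2: "norm (defect (u n) x h) \<le> \<epsilon> / 2 * norm h"
          using defe[OF x, of n h] elim(2) by (meson less_imp_le mult_right_mono norm_ge_zero order_trans)
        have "frechet_derivative (u n) (at x) h - (h + \<Omega> x h (g x)) = defect (u n) x h + \<Omega> x h (u n x - g x)"
          by (simp add: defect_def blinfun.diff_right)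
        also have "norm \<dots> \<le> \<epsilon> * norm h" using 1 2 norm_triangle_mono[OF 2 1] by simp
        finally show "norm (frechet_derivative (u n) (at x) h - (h + \<Omega> x h (g x))) \<le> \<epsilon> * norm h" .
      qed
    qed
  next
    show "y0 \<in> ball y0 r" using r by simp
    show "(\<lambda>n. u n y0) \<longlonglongrightarrow> c" by (simp add: uy0)
  qed
  then obtain h where h: "\<And>x. x \<in> ball y0 r \<Longrightarrow> (\<lambda>n. u n x) \<longlonglongrightarrow> h x"
    "\<And>x. x \<in> ball y0 r \<Longrightarrow> (h has_derivative (\<lambda>v. v + \<Omega> x v (g x))) (at x within ball y0 r)" by metis
  have "g x = h x" if "x \<in> ball y0 r" for x
    using tendsto_uniform_limitI[OF lim that] h(1)[OF that] LIMSEQ_unique by blast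
  moreover have "h y0 = c"
    using LIMSEQ_unique[OF h(1)[of y0]] r by (simp add: uy0)
  ultimately show ?thesis
    using that[of h] h(2) by (simp add: at_within_open[OF _ open_ball])
qed

end

section \<open>Uniqueness for the homogeneous equation\<close>

context affine_total_system
begin

text \<open>Let m maximise the norm of z on the closed ball around \<open>y0\<close> through x. By
  the mean value inequality norm (z m) \<le> C r norm (z m) \<le> norm (z m) / 2, so z vanishes
  there.\<close>

lemma solution_unique_homogeneous:
  assumes z: "\<And>x. x \<in> ball y0 r \<Longrightarrow> (z has_derivative (\<lambda>v. \<Omega> x v (z x))) (at x)"
    and "z y0 = 0" and x: "x \<in> ball y0 r"
  shows "z x = 0"
proof -
  let ?B = "cball y0 (dist y0 x)"
  have sub: "?B \<subseteq> ball y0 r" using x by auto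
  have "continuous_on ?B (\<lambda>x. norm (z x))"
  proof (rule continuous_on_norm, rule has_derivative_continuous_on)
    show "(z has_derivative (\<lambda>v. \<Omega> x v (z x))) (at x within ?B)" if "x \<in> ?B" for x
      using z sub that has_derivative_at_withinI by blast
  qed
  from continuous_attains_sup[OF compact_cball _ this]
  obtain m where m: "m \<in> ?B" "\<And>y. y \<in> ?B \<Longrightarrow> norm (z y) \<le> norm (z m)" by (auto simp: not_less)
  have "norm (z m - z y0) \<le> (C * norm (z m)) * norm (m - y0)"
  proof (rule differentiable_bound[of ?B z "\<lambda>x v. \<Omega> x v (z x)"])
    fix y assume y: "y \<in> ?B"
    show "(z has_derivative (\<lambda>v. \<Omega> y v (z y))) (at y within ?B)"
      using z sub y has_derivative_at_withinI by blast
    show "onorm (\<lambda>v. \<Omega> y v (z y)) \<le> C * norm (z m)"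
    proof (rule onorm_le)
      fix v
      have "norm (\<Omega> y v (z y)) \<le> C * norm v * norm (z y)" using bound sub y by blast
      also have "\<dots> \<le> C * norm v * norm (z m)" using m(2)[OF y] C(1) by (intro mult_left_mono) auto
      finally show "norm (\<Omega> y v (z y)) \<le> C * norm (z m) * norm v" by (simp add: mult_ac)
    qed
  qed (use m in auto)
  also have "\<dots> = (C * norm (m - y0)) * norm (z m)" by (simp add: mult_ac)
  also have "\<dots> \<le> (1 / 2) * norm (z m)"
  proof (rule mult_right_mono)
    have "m \<in> ball y0 r" using m(1) sub by blast
    then have "norm (m - y0) \<le> r" by (simp add: dist_norm norm_minus_commute)
    then show "C * norm (m - y0) \<le> 1 / 2" using C mult_left_mono by fastforce
  qed simp
  finally have "norm (z m) \<le> 0" using assms(2) by simp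
  then show ?thesis using m(2)[of x] by simp
qed

end

section \<open>Monodromy\<close>

text \<open>Sections are total functions looked at on U only, with values in fibres of one fixed
  type. \<open>agree_near\<close> and \<open>differ_near\<close> make the coincidence of two
  sections both open and closed. In \<open>local_sections\<close> one neighbourhood serves all of
  its points and all values there, like an evenly covered set.\<close>

locale locally_constant_sheaf =
  fixes sec :: "'b::topological_space set \<Rightarrow> ('b \<Rightarrow> 'f) \<Rightarrow> bool" and Fib :: "'b \<Rightarrow> 'f set"
  assumes sec_in: "sec U s \<Longrightarrow> x \<in> U \<Longrightarrow> s x \<in> Fib x"
    and sec_open: "sec U s \<Longrightarrow> open U"
    and agree_near: "sec U s \<Longrightarrow> sec V t \<Longrightarrow> x \<in> U \<Longrightarrow> x \<in> V \<Longrightarrow> s x = t x \<Longrightarrow>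
      \<exists>W. open W \<and> x \<in> W \<and> (\<forall>y\<in>W. s y = t y)"
    and differ_near: "sec U s \<Longrightarrow> sec V t \<Longrightarrow> x \<in> U \<Longrightarrow> x \<in> V \<Longrightarrow> s x \<noteq> t x \<Longrightarrow>
      \<exists>W. open W \<and> x \<in> W \<and> (\<forall>y\<in>W. s y \<noteq> t y)"
    and local_sections: "\<exists>N. open N \<and> x \<in> N \<and> path_connected N \<and> (\<forall>y\<in>N. \<forall>c\<in>Fib y. \<exists>s. sec N s \<and> s y = c)"
begin

text \<open>The continuous lifts of h to the space of germs, expressed without a topology on that
  space: locally the lift is a section composed with h.\<close>

definition lift :: "'z::topological_space set \<Rightarrow> ('z \<Rightarrow> 'b) \<Rightarrow> ('z \<Rightarrow> 'f) \<Rightarrow> bool" where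
  "lift Z h \<sigma> \<longleftrightarrow> (\<forall>z\<in>Z. \<exists>U s W. sec U s \<and> open W \<and> z \<in> W \<and> (\<forall>w\<in>W \<inter> Z. h w \<in> U \<and> \<sigma> w = s (h w)))"

definition liftable :: "'z::topological_space set \<Rightarrow> ('z \<Rightarrow> 'b) \<Rightarrow> bool" where
  "liftable Z h \<longleftrightarrow> (\<forall>z\<in>Z. \<forall>c\<in>Fib (h z). \<exists>\<sigma>. lift Z h \<sigma> \<and> \<sigma> z = c)"

lemma liftableD: "liftable Z h \<Longrightarrow> z \<in> Z \<Longrightarrow> c \<in> Fib (h z) \<Longrightarrow> \<exists>\<sigma>. lift Z h \<sigma> \<and> \<sigma> z = c"
  by (simp add: liftable_def)

lemma lift_in: "lift Z h \<sigma> \<Longrightarrow> z \<in> Z \<Longrightarrow> \<sigma> z \<in> Fib (h z)"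
  unfolding lift_def using sec_in by fastforce

lemma lift_compose:
  assumes "lift Z h \<sigma>" "continuous_on Y k" "k ` Y \<subseteq> Z"
  shows "lift Y (\<lambda>y. h (k y)) (\<lambda>y. \<sigma> (k y))"
  unfolding lift_def
proof
  fix y assume y: "y \<in> Y"
  then have "k y \<in> Z" using assms(3) by auto
  then obtain U s W where W: "sec U s" "open W" "k y \<in> W" "\<forall>w\<in>W \<inter> Z. h w \<in> U \<and> \<sigma> w = s (h w)"
    using assms(1) unfolding lift_def by metis
  obtain W' where W': "open W'" "W' \<inter> Y = k -` W \<inter> Y"
    using assms(2) W(2) unfolding continuous_on_open_invariant by blast
  have "y \<in> W'" using W' W(3) y by auto
  moreover have "h (k w) \<in> U \<and> \<sigma> (k w) = s (h (k w))" if "w \<in> W' \<inter> Y" for w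
  proof -
    have "k w \<in> W \<inter> Z" using that W'(2) assms(3) by auto
    then show ?thesis using W(4) by simp
  qed
  ultimately show "\<exists>U s W. sec U s \<and> open W \<and> y \<in> W \<and> (\<forall>w\<in>W \<inter> Y. h (k w) \<in> U \<and> \<sigma> (k w) = s (h (k w)))"
    using W(1) W'(1) by blast
qed

lemma lift_cong:
  assumes "lift Z h \<sigma>" "\<And>z. z \<in> Z \<Longrightarrow> h z = h' z" "\<And>z. z \<in> Z \<Longrightarrow> \<sigma> z = \<sigma>' z"
  shows "lift Z h' \<sigma>'"
  using assms unfolding lift_def by (metis IntD2)

lemma lift_section: "sec U s \<Longrightarrow> h ` Z \<subseteq> U \<Longrightarrow> lift Z h (\<lambda>z. s (h z))"
  unfolding lift_def by (metis IntD2 image_subset_iff open_UNIV UNIV_I)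

text \<open>Near each point both lifts come from sections, which either agree or differ throughout a
  neighbourhood. So the set of agreement is open and closed in the connected set.\<close>

lemma lift_unique:
  assumes "connected Z" "continuous_on Z h" "lift Z h \<sigma>" "lift Z h \<tau>" "z0 \<in> Z" "\<sigma> z0 = \<tau> z0" "z \<in> Z"
  shows "\<sigma> z = \<tau> z"
proof (rule connected_induction_simple[OF assms(1,5,7), where P = "\<lambda>z. \<sigma> z = \<tau> z"])
  show "\<sigma> z0 = \<tau> z0" by fact
  fix z assume z: "z \<in> Z"
  obtain U s W where W: "sec U s" "open W" "z \<in> W" "\<forall>w\<in>W \<inter> Z. h w \<in> U \<and> \<sigma> w = s (h w)"
    using assms(3) z unfolding lift_def by metis
  obtain V t W' where W': "sec V t" "open W'" "z \<in> W'" "\<forall>w\<in>W' \<inter> Z. h w \<in> V \<and> \<tau> w = t (h w)"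
    using assms(4) z unfolding lift_def by metis
  have hz: "h z \<in> U" "h z \<in> V" using z W W' by auto
  obtain X where X: "open X" "h z \<in> X" "(\<forall>y\<in>X. s y = t y) \<or> (\<forall>y\<in>X. s y \<noteq> t y)"
    using agree_near[OF W(1) W'(1) hz] differ_near[OF W(1) W'(1) hz] by blast
  obtain T where T: "open T" "T \<inter> Z = h -` X \<inter> Z"
    using assms(2) X(1) unfolding continuous_on_open_invariant by blast
  have "openin (top_of_set Z) (Z \<inter> (T \<inter> W \<inter> W'))"
    using T W W' by (intro openin_open_Int open_Int)
  moreover have "z \<in> Z \<inter> (T \<inter> W \<inter> W')" using z T W W' X by blast
  moreover have "\<sigma> w = \<tau> w \<longleftrightarrow> s (h w) = t (h w)" "h w \<in> X" if "w \<in> Z \<inter> (T \<inter> W \<inter> W')" for w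
    using that T W(4) W'(4) by auto
  ultimately show "\<exists>S. openin (top_of_set Z) S \<and> z \<in> S \<and> (\<forall>x\<in>S. \<forall>y\<in>S. \<sigma> x = \<tau> x \<longrightarrow> \<sigma> y = \<tau> y)"
    using X(3) by metis
qed

text \<open>The lift on B is chosen to meet the lift on A at one common point; by uniqueness they
  agree on the connected intersection. Off the intersection, closedness of the other set gives a
  neighbourhood where one lift is in charge. At a common point \<open>agree_near\<close> lets a
  single section describe both.\<close>

lemma liftable_Un_aux:
  assumes "closed A" "closed B" "connected (A \<inter> B)" "A \<inter> B \<noteq> {}" "continuous_on (A \<union> B) h"
    and A: "liftable A h" and B: "liftable B h" and z: "z \<in> A" and c: "c \<in> Fib (h z)"
  shows "\<exists>\<sigma>. lift (A \<union> B) h \<sigma> \<and> \<sigma> z = c"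
proof -
  obtain \<sigma> where \<sigma>: "lift A h \<sigma>" "\<sigma> z = c" using A z c unfolding liftable_def by blast
  obtain w where w: "w \<in> A" "w \<in> B" using assms(4) by blast
  obtain \<tau> where \<tau>: "lift B h \<tau>" "\<tau> w = \<sigma> w"
    using B w lift_in[OF \<sigma>(1) w(1)] unfolding liftable_def by blast
  have eq: "\<tau> y = \<sigma> y" if "y \<in> A \<inter> B" for y
  proof (rule lift_unique[OF assms(3) continuous_on_subset[OF assms(5)], of \<tau> \<sigma> w])
    show "lift (A \<inter> B) h \<tau>" using lift_compose[OF \<tau>(1), of "A \<inter> B" "\<lambda>y. y"] by auto
    show "lift (A \<inter> B) h \<sigma>" using lift_compose[OF \<sigma>(1), of "A \<inter> B" "\<lambda>y. y"] by auto
  qed (use w \<tau> that in auto)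
  define \<rho> where "\<rho> y = (if y \<in> A then \<sigma> y else \<tau> y)" for y
  have "lift (A \<union> B) h \<rho>"
    unfolding lift_def
  proof
    fix y assume "y \<in> A \<union> B"
    then consider "y \<in> A \<inter> B" | "y \<in> A - B" | "y \<in> B - A" by blast
    then show "\<exists>U s W. sec U s \<and> open W \<and> y \<in> W \<and> (\<forall>w\<in>W \<inter> (A \<union> B). h w \<in> U \<and> \<rho> w = s (h w))"
    proof cases
      case 1
      then obtain U s W where W: "sec U s" "open W" "y \<in> W" "\<forall>w\<in>W \<inter> A. h w \<in> U \<and> \<sigma> w = s (h w)"
        using \<sigma>(1) unfolding lift_def by (metis IntD1)
      obtain V t W' where W': "sec V t" "open W'" "y \<in> W'" "\<forall>w\<in>W' \<inter> B. h w \<in> V \<and> \<tau> w = t (h w)"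
        using \<tau>(1) 1 unfolding lift_def by (metis IntD2)
      have y: "h y \<in> U" "h y \<in> V" "s (h y) = t (h y)" using 1 W W' eq[OF 1] by auto
      obtain X where X: "open X" "h y \<in> X" "\<forall>x\<in>X. s x = t x"
        using agree_near[OF W(1) W'(1) y] by blast
      have "open (U \<inter> X)" using X sec_open[OF W(1)] by blast
      then obtain T where T: "open T" "T \<inter> (A \<union> B) = h -` (U \<inter> X) \<inter> (A \<union> B)"
        using assms(5) unfolding continuous_on_open_invariant by blast
      have "open (W \<inter> W' \<inter> T)" using T W W' by blast
      moreover have "y \<in> W \<inter> W' \<inter> T" using 1 T W W' X y by blast
      moreover have "h w \<in> U \<and> \<rho> w = s (h w)" if w: "w \<in> (W \<inter> W' \<inter> T) \<inter> (A \<union> B)" for w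
      proof -
        have "h w \<in> U" "h w \<in> X" using w T(2) by blast+
        then show ?thesis using w W(4) W'(4) X(3) by (auto simp: \<rho>_def)
      qed
      ultimately show ?thesis using W(1) by blast
    next
      case 2
      then obtain U s W where W: "sec U s" "open W" "y \<in> W" "\<forall>w\<in>W \<inter> A. h w \<in> U \<and> \<sigma> w = s (h w)"
        using \<sigma>(1) unfolding lift_def by (metis DiffD1)
      then have "open (W - B)" "y \<in> W - B" "\<forall>w\<in>(W - B) \<inter> (A \<union> B). h w \<in> U \<and> \<rho> w = s (h w)"
        using 2 assms(2) by (auto simp: \<rho>_def)
      with W(1) show ?thesis by blast
    next
      case 3
      then obtain U s W where W: "sec U s" "open W" "y \<in> W" "\<forall>w\<in>W \<inter> B. h w \<in> U \<and> \<tau> w = s (h w)"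
        using \<tau>(1) unfolding lift_def by (metis DiffD1)
      then have "open (W - A)" "y \<in> W - A" "\<forall>w\<in>(W - A) \<inter> (A \<union> B). h w \<in> U \<and> \<rho> w = s (h w)"
        using 3 assms(1) by (auto simp: \<rho>_def)
      with W(1) show ?thesis by blast
    qed
  qed
  then show ?thesis using \<sigma>(2) z by (auto simp: \<rho>_def)
qed

lemma liftable_Un:
  assumes "closed A" "closed B" "connected (A \<inter> B)" "A \<inter> B \<noteq> {}" "continuous_on (A \<union> B) h"
    "liftable A h" "liftable B h"
  shows "liftable (A \<union> B) h"
  using liftable_Un_aux[OF assms] liftable_Un_aux[of B A h] assms
  unfolding liftable_def[of "A \<union> B"] by (auto simp: Un_commute Int_commute)

lemma liftable_small:
  assumes "\<And>y c. y \<in> N \<Longrightarrow> c \<in> Fib y \<Longrightarrow> \<exists>s. sec N s \<and> s y = c" "h ` Z \<subseteq> N"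
  shows "liftable Z h"
  unfolding liftable_def by (metis assms image_subset_iff lift_section)

text \<open>Subdivision by \<open>Bolzano\<close> in both directions: small rectangles map into one
  evenly covered set, and adjacent rectangles meet in a segment, so that \<open>liftable_Un\<close>
  applies.\<close>

lemma liftable_rectangle:
  fixes h :: "real \<times> real \<Rightarrow> 'b"
  assumes h: "continuous_on UNIV h" and "a \<le> b" "c \<le> d"
  shows "liftable ({a..b} \<times> {c..d}) h"
proof -
  have ch: "continuous_on Z h" for Z using continuous_on_subset[OF h] by blast
  \<comment> \<open>Subdivide vertically first. The admissible width may depend on s, and passing to
    the minimum when two pieces are stacked keeps it positive.\<close>
  have strip: "\<exists>\<delta>>0. \<forall>a b. a \<le> s \<and> s \<le> b \<and> b - a < \<delta> \<longrightarrow> liftable ({a..b} \<times> {c..d}) h" for s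
    using \<open>c \<le> d\<close>
  proof (induction c d rule: Bolzano)
    case (trans c t d)
    then obtain \<delta> \<epsilon> where D: "\<delta> > 0" "\<And>a b. a \<le> s \<and> s \<le> b \<and> b - a < \<delta> \<Longrightarrow> liftable ({a..b} \<times> {c..t}) h"
      "\<epsilon> > 0" "\<And>a b. a \<le> s \<and> s \<le> b \<and> b - a < \<epsilon> \<Longrightarrow> liftable ({a..b} \<times> {t..d}) h"
      by metis
    have "liftable ({a..b} \<times> {c..d}) h" if "a \<le> s \<and> s \<le> b \<and> b - a < min \<delta> \<epsilon>" for a b
    proof -
      have "{a..b} \<times> {c..t} \<inter> {a..b} \<times> {t..d} = {a..b} \<times> {t}"
        "{a..b} \<times> {c..t} \<union> {a..b} \<times> {t..d} = {a..b} \<times> {c..d}"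
        using trans by auto
      then show ?thesis
        using liftable_Un[of "{a..b} \<times> {c..t}" "{a..b} \<times> {t..d}" h] D that ch
        by (auto simp: closed_Times connected_Times)
    qed
    then show ?case using D by (metis min_less_iff_conj)
  next
    case (local t)
    obtain N where N: "open N" "h (s, t) \<in> N" "\<And>y c. y \<in> N \<Longrightarrow> c \<in> Fib y \<Longrightarrow> \<exists>s. sec N s \<and> s y = c"
      using local_sections[of "h (s, t)"] by blast
    have "open (h -` N)" using h N(1) by (simp add: continuous_on_open_vimage)
    moreover have "(s, t) \<in> h -` N" using N(2) by simp
    ultimately obtain A B where AB: "open A" "open B" "(s, t) \<in> A \<times> B" "A \<times> B \<subseteq> h -` N"
      by (rule open_prod_elim)
    obtain \<delta> where \<delta>: "\<delta> > 0" "ball s \<delta> \<subseteq> A"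
      using AB(1,3) unfolding open_contains_ball by blast
    obtain \<epsilon> where \<epsilon>: "\<epsilon> > 0" "ball t \<epsilon> \<subseteq> B"
      using AB(2,3) unfolding open_contains_ball by blast
    have "liftable ({a..b} \<times> {c..d}) h"
      if "a \<le> s \<and> s \<le> b \<and> b - a < \<delta>" "c \<le> t \<and> t \<le> d \<and> d - c < \<epsilon>" for a b c d
    proof (rule liftable_small[OF N(3)])
      have "{a..b} \<subseteq> ball s \<delta>" "{c..d} \<subseteq> ball t \<epsilon>" using that by (auto simp: dist_real_def)
      then show "h ` ({a..b} \<times> {c..d}) \<subseteq> N" using AB(4) \<delta>(2) \<epsilon>(2) by blast
    qed
    then show ?case using \<delta>(1) \<epsilon>(1) by blast
  qed
  show ?thesis
    using \<open>a \<le> b\<close>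
  proof (induction a b rule: Bolzano)
    case (trans a s b)
    have "{a..s} \<times> {c..d} \<inter> {s..b} \<times> {c..d} = {s} \<times> {c..d}"
      "{a..s} \<times> {c..d} \<union> {s..b} \<times> {c..d} = {a..b} \<times> {c..d}"
      using trans by auto
    then show ?case
      using liftable_Un[of "{a..s} \<times> {c..d}" "{s..b} \<times> {c..d}" h] trans ch \<open>c \<le> d\<close>
      by (auto simp: closed_Times connected_Times)
  next
    case (local s)
    then show ?case using strip by blast
  qed
qed

text \<open>Composing with the retraction of the plane onto the square extends h continuously to the
  plane, where preimages of open sets are open outright.\<close>

lemma liftable_square:
  fixes h :: "real \<times> real \<Rightarrow> 'b"
  assumes "continuous_on ({0..1} \<times> {0..1}) h"
  shows "liftable ({0..1} \<times> {0..1}) h"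
proof -
  define k :: "real \<times> real \<Rightarrow> real \<times> real" where "k z = (max 0 (min 1 (fst z)), max 0 (min 1 (snd z)))" for z
  have "continuous_on UNIV k" unfolding k_def by (intro continuous_intros)
  then have "continuous_on UNIV (\<lambda>z. h (k z))"
    by (rule continuous_on_compose2[OF assms]) (auto simp: k_def)
  then have *: "liftable ({0..1} \<times> {0..1}) (\<lambda>z. h (k z))" by (rule liftable_rectangle) auto
  have k: "k z = z" if "z \<in> {0..1} \<times> {0..1}" for z using that by (auto simp: k_def)
  show ?thesis
    unfolding liftable_def
  proof (intro ballI)
    fix z c assume z: "z \<in> {0..1::real} \<times> {0..1::real}" and c: "c \<in> Fib (h z)"
    have "c \<in> Fib (h (k z))" using c k[OF z] by simp
    then obtain \<sigma> where "lift ({0..1} \<times> {0..1}) (\<lambda>z. h (k z)) \<sigma>" "\<sigma> z = c"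
      using * z unfolding liftable_def by blast
    then show "\<exists>\<sigma>. lift ({0..1} \<times> {0..1}) h \<sigma> \<and> \<sigma> z = c"
      using lift_cong[of _ "\<lambda>z. h (k z)" \<sigma> h \<sigma>] k by metis
  qed
qed

text \<open>The square lemma for a map that ignores the first coordinate, restricted to one
  edge.\<close>

lemma path_lift_exists:
  assumes "path g" "c \<in> Fib (g 0)"
  obtains \<sigma> where "lift {0..1} g \<sigma>" "\<sigma> 0 = c"
proof -
  have "continuous_on ({0..1} \<times> {0..1}) (\<lambda>z::real \<times> real. g (snd z))"
    using assms(1) unfolding path_def
    by (rule continuous_on_compose2) (auto intro: continuous_intros)
  note sq = liftable_square[OF this]
  obtain \<Sigma> :: "real \<times> real \<Rightarrow> 'f"
    where \<Sigma>: "lift ({0..1} \<times> {0..1}) (\<lambda>z. g (snd z)) \<Sigma>" "\<Sigma> (0, 0) = c"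
    using liftableD[OF sq, of "(0, 0)" c] assms(2) by auto
  have "lift {0..1} (\<lambda>t. g (snd (0::real, t))) (\<lambda>t. \<Sigma> (0, t))"
    by (rule lift_compose[OF \<Sigma>(1)]) (auto intro: continuous_intros)
  then show ?thesis using that \<Sigma>(2) by auto
qed

lemma path_lift_unique:
  assumes "path g" "lift {0..1} g \<sigma>" "lift {0..1} g \<tau>" "u \<in> {0..1}" "\<sigma> u = \<tau> u" "t \<in> {0..1}"
  shows "\<sigma> t = \<tau> t"
  using lift_unique[of "{0..1}" g \<sigma> \<tau> u t] assms by (auto simp: path_def)

text \<open>Lift a free homotopy from p to a constant loop. Over the constant edge the lift is
  constant. The two lateral edges project to the same path since every intermediate curve is a loop;
  their lifts agree at the constant end, hence also at the ends lying over p.\<close>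

lemma loop_lift_closed:
  assumes sc: "simply_connected (UNIV :: 'b set)" and p: "path p" "p 0 = p 1" and \<sigma>: "lift {0..1} p \<sigma>"
  shows "\<sigma> 0 = \<sigma> 1"
proof -
  have "path (\<lambda>_. p 0)" by (simp add: path_def)
  then have "homotopic_loops UNIV p (\<lambda>_. p 0)"
    using sc p unfolding simply_connected_def by (auto simp: pathstart_def pathfinish_def)
  then obtain h :: "real \<times> real \<Rightarrow> 'b" where H: "continuous_on ({0..1} \<times> {0..1}) h" "\<forall>t\<in>{0..1}. h (0, t) = p t"
    "\<forall>t\<in>{0..1}. h (1, t) = p 0" "\<forall>s\<in>{0..1}. h (s, 1) = h (s, 0)"
    unfolding homotopic_loops by (auto simp: pathstart_def pathfinish_def)
  note h = H(1) bspec[OF H(2)] bspec[OF H(3)] bspec[OF H(4)]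
  have "\<sigma> 0 \<in> Fib (h (0, 0))" using lift_in[OF \<sigma>, of 0] h(2)[of 0] by simp
  then obtain \<Sigma> :: "real \<times> real \<Rightarrow> 'f" where \<Sigma>: "lift ({0..1} \<times> {0..1}) h \<Sigma>" "\<Sigma> (0, 0) = \<sigma> 0"
    using liftableD[OF liftable_square[OF h(1)], of "(0, 0)"] by auto
  have ce: "path (\<lambda>t. h (k t))" "lift {0..1} (\<lambda>t. h (k t)) (\<lambda>t. \<Sigma> (k t))"
    if "continuous_on {0..1} k" "k ` {0..1} \<subseteq> {0..1} \<times> {0..1}" for k
    using lift_compose[OF \<Sigma>(1) that] continuous_on_compose2[OF h(1) that] by (auto simp: path_def)
  have "lift {0..1} p (\<lambda>t. \<Sigma> (0, t))"
    by (rule lift_cong[OF ce(2)]) (auto simp: h(2) intro!: continuous_intros)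
  from path_lift_unique[OF p(1) this \<sigma>, of 0 1] have bottom: "\<Sigma> (0, 1) = \<sigma> 1" using \<Sigma>(2) by simp
  have top: "\<Sigma> (1, 0) = \<Sigma> (1, 1)"
  proof -
    have l: "lift {0..1::real} (\<lambda>_. p 0) (\<lambda>t. \<Sigma> (1, t))"
      by (rule lift_cong[OF ce(2)]) (auto simp: h(3) intro!: continuous_intros)
    have "lift {0..1::real} (\<lambda>_. p 0) (\<lambda>t. \<Sigma> (1, 0))"
      using lift_compose[OF l, of "{0..1::real}" "\<lambda>_. 0"] by (simp add: image_subset_iff)
    from path_lift_unique[OF _ this l, of 0 1] show ?thesis by (simp add: path_def)
  qed
  have c0: "continuous_on {0..1} (\<lambda>s. (s::real, 0::real))" "(\<lambda>s. (s::real, 0::real)) ` {0..1} \<subseteq> {0..1} \<times> {0..1}"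
    by (auto intro!: continuous_intros)
  note q = ce(1)[OF c0] and l0 = ce(2)[OF c0]
  have "lift {0..1} (\<lambda>s. h (s, 0)) (\<lambda>s. \<Sigma> (s, 1))"
    by (rule lift_cong[OF ce(2)[of "\<lambda>s. (s, 1)"]]) (auto simp: h(4) intro!: continuous_intros)
  from path_lift_unique[OF q this l0, of 1 0] top have "\<Sigma> (0, 1) = \<Sigma> (0, 0)" by simp
  then show ?thesis using bottom \<Sigma>(2) by simp
qed

lemma lift_join_halves:
  assumes "path g" "path k" "g 1 = k 0" "lift {0..1} (g +++ k) \<tau>"
  shows "lift {0..1} g (\<lambda>t. \<tau> (t / 2))" "lift {0..1} k (\<lambda>t. \<tau> (1 / 2 + t / 2))"
proof -
  show "lift {0..1} g (\<lambda>t. \<tau> (t / 2))"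
    by (rule lift_cong[OF lift_compose[OF assms(4), of "{0..1}" "\<lambda>t. t / 2"]])
      (auto simp: joinpaths_def intro!: continuous_intros)
  show "lift {0..1} k (\<lambda>t. \<tau> (1 / 2 + t / 2))"
    by (rule lift_cong[OF lift_compose[OF assms(4), of "{0..1}" "\<lambda>t. 1 / 2 + t / 2"]])
      (use assms(3) in \<open>auto simp: joinpaths_def intro!: continuous_intros\<close>)
qed

text \<open>Lift the loop that runs along g and back along k. By \<open>loop_lift_closed\<close> it
  returns to its initial value; its first half is the lift of g and its second half, read backwards,
  is the lift of k.\<close>

lemma lift_end_unique:
  assumes sc: "simply_connected (UNIV :: 'b set)"
    and g: "path g" "lift {0..1} g \<sigma>" and k: "path k" "lift {0..1} k \<tau>"
    and ends: "g 0 = k 0" "g 1 = k 1" "\<sigma> 0 = \<tau> 0"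
  shows "\<sigma> 1 = \<tau> 1"
proof -
  have rk: "path (reversepath k)" using k(1) by simp
  have p: "path (g +++ reversepath k)"
    by (rule path_join_imp[OF g(1) rk]) (simp add: pathstart_def pathfinish_def reversepath_def ends)
  have "\<sigma> 0 \<in> Fib ((g +++ reversepath k) 0)"
    using lift_in[OF g(2), of 0] by (simp add: joinpaths_def)
  then obtain \<rho> where \<rho>: "lift {0..1} (g +++ reversepath k) \<rho>" "\<rho> 0 = \<sigma> 0"
    using path_lift_exists[OF p] by blast
  have e: "g 1 = reversepath k 0" using ends by (simp add: reversepath_def)
  note halves = lift_join_halves[OF g(1) rk e \<rho>(1)]
  have "\<rho> 1 = \<sigma> 0"
    using loop_lift_closed[OF sc p _ \<rho>(1)] \<rho>(2) ends by (simp add: joinpaths_def reversepath_def)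
  have "\<rho> (1 / 2) = \<sigma> 1"
    using path_lift_unique[OF g(1) halves(1) g(2), of 0 1] \<rho>(2) by simp
  moreover have "lift {0..1} k (\<lambda>t. \<rho> (1 / 2 + (1 - t) / 2))"
    by (rule lift_cong[OF lift_compose[OF halves(2), of "{0..1}" "\<lambda>t. 1 - t"]])
      (auto simp: reversepath_def intro!: continuous_intros)
  from path_lift_unique[OF k(1) this k(2), of 0 1] have "\<rho> (1 / 2) = \<tau> 1"
    using \<open>\<rho> 1 = \<sigma> 0\<close> ends by simp
  ultimately show ?thesis by simp
qed

text \<open>The value at x is the end of the lift along any path from x0 to x, which
  \<open>lift_end_unique\<close> makes well defined.\<close>

theorem global_section_exists:
  assumes sc: "simply_connected (UNIV :: 'b set)" and c: "c \<in> Fib x0"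
  obtains \<sigma> where "\<And>x. \<exists>N s. sec N s \<and> x \<in> N \<and> (\<forall>y\<in>N. \<sigma> y = s y)"
proof -
  define reaches where "reaches x v \<longleftrightarrow> (\<exists>g \<rho>. path g \<and> g 0 = x0 \<and> g 1 = x \<and> lift {0..1} g \<rho> \<and> \<rho> 0 = c \<and> \<rho> 1 = v)" for x v
  have ex: "\<exists>v. reaches x v" for x
  proof -
    \<comment> \<open>\<open>simply_connected\<close> also covers path-connectedness: constant loops
      at x0 and at x are freely homotopic, and the base point traces a path between them.\<close>
    have "homotopic_loops UNIV (\<lambda>_. x0) (\<lambda>_. x)"
      using sc unfolding simply_connected_def by (auto simp: pathstart_def pathfinish_def path_def)
    then obtain h :: "real \<times> real \<Rightarrow> 'b" where h: "continuous_on ({0..1} \<times> {0..1}) h" "\<forall>t\<in>{0..1}. h (0, t) = x0"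
      "\<forall>t\<in>{0..1}. h (1, t) = x"
      unfolding homotopic_loops by auto
    have "path (\<lambda>s. h (s, 0::real))"
      unfolding path_def by (rule continuous_on_compose2[OF h(1)]) (auto intro!: continuous_intros)
    moreover have "h (0, 0) = x0" "h (1, 0) = x" using h by auto
    ultimately show ?thesis
      unfolding reaches_def using path_lift_exists[of "\<lambda>s. h (s, 0)" c] c by metis
  qed
  have unique: "v = w" if "reaches x v" "reaches x w" for x v w
    using that lift_end_unique[OF sc] unfolding reaches_def by metis
  define \<sigma> where "\<sigma> x = (SOME v. reaches x v)" for x
  have \<sigma>: "reaches x (\<sigma> x)" for x unfolding \<sigma>_def using someI_ex[OF ex] .
  have "\<exists>N s. sec N s \<and> x \<in> N \<and> (\<forall>y\<in>N. \<sigma> y = s y)" for x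
  proof -
    obtain N where N: "x \<in> N" "path_connected N" "\<And>y c. y \<in> N \<Longrightarrow> c \<in> Fib y \<Longrightarrow> \<exists>s. sec N s \<and> s y = c"
      using local_sections[of x] by blast
    obtain g \<rho> where g: "path g" "g 0 = x0" "g 1 = x" "lift {0..1} g \<rho>" "\<rho> 0 = c" "\<rho> 1 = \<sigma> x"
      using \<sigma> unfolding reaches_def by blast
    have "\<sigma> x \<in> Fib x" using lift_in[OF g(4), of 1] g by simp
    then obtain s where s: "sec N s" "s x = \<sigma> x" using N by blast
    \<comment> \<open>Prolong the path to x by a path inside N. Along the prolongation s itself is a
      lift with the right initial value, so the continued value is s y.\<close>
    have "\<sigma> y = s y" if y: "y \<in> N" for y
    proof -
      obtain k where k: "path k" "path_image k \<subseteq> N" "k 0 = x" "k 1 = y"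
        using N(1,2) y unfolding path_connected_def pathstart_def pathfinish_def by blast
      have p: "path (g +++ k)" using g k by (intro path_join_imp) (auto simp: pathstart_def pathfinish_def)
      have "c \<in> Fib ((g +++ k) 0)" using c g by (simp add: joinpaths_def)
      then obtain \<tau> where \<tau>: "lift {0..1} (g +++ k) \<tau>" "\<tau> 0 = c" using path_lift_exists[OF p] by blast
      have e: "g 1 = k 0" using g k by simp
      note halves = lift_join_halves[OF g(1) k(1) e \<tau>(1)]
      have "\<tau> (1 / 2) = \<sigma> x"
        using path_lift_unique[OF g(1) halves(1) g(4), of 0 1] \<tau>(2) g by simp
      moreover have "lift {0..1} k (\<lambda>t. s (k t))"
        using k(2) by (intro lift_section[OF s(1)]) (simp add: path_image_def)
      ultimately have "\<tau> 1 = s y"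
        using path_lift_unique[OF k(1) halves(2), of "\<lambda>t. s (k t)" 0 1] s k by simp
      then have "reaches y (s y)"
        unfolding reaches_def using p \<tau> g k by (intro exI[of _ "g +++ k"] exI[of _ \<tau>]) (auto simp: joinpaths_def)
      then show ?thesis using unique \<sigma> by blast
    qed
    then show ?thesis using s(1) N(1) by blast
  qed
  then show ?thesis using that by blast
qed

end

section \<open>Tangent vectors in a chart\<close>

locale smooth_manifold_atlas =
  fixes A :: "('a::{t2_space, second_countable_topology}, 'e::euclidean_space) atlas"
  assumes smooth_manifold: "smooth_manifold A"
begin

lemma chart_at: obtains U \<phi> where "(U, \<phi>) \<in> A" "x \<in> U"
  using smooth_manifold unfolding smooth_manifold_def by fast

lemma chart:
  assumes "(U, \<phi>) \<in> A"
  shows "open U" "open (\<phi> ` U)" "homeomorphism U (\<phi> ` U) \<phi> (inv_into U \<phi>)"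
  using smooth_manifold assms unfolding smooth_manifold_def by fast+

lemma chart_transition:
  assumes "(U, \<phi>) \<in> A" "(V, \<psi>) \<in> A"
  shows "smooth_on (\<phi> ` (U \<inter> V)) (\<psi> \<circ> inv_into U \<phi>)"
  using smooth_manifold assms unfolding smooth_manifold_def by fast

lemma chart_inverse:
  assumes "(U, \<phi>) \<in> A"
  shows "x \<in> U \<Longrightarrow> inv_into U \<phi> (\<phi> x) = x" "\<xi> \<in> \<phi> ` U \<Longrightarrow> \<phi> (inv_into U \<phi> \<xi>) = \<xi>"
    "\<xi> \<in> \<phi> ` U \<Longrightarrow> inv_into U \<phi> \<xi> \<in> U"
  using chart(3)[OF assms] by (auto simp: homeomorphism_def)

lemma chart_open_image:
  assumes "(U, \<phi>) \<in> A" "open N"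
  shows "open (\<phi> ` (U \<inter> N))"
proof -
  have "openin (top_of_set (\<phi> ` U)) (\<phi> ` (U \<inter> N))"
    using chart(3)[OF assms(1)] openin_open_Int[OF assms(2)] by (rule homeomorphism_imp_open_map)
  then show ?thesis using chart(2)[OF assms(1)] by (rule openin_open_trans)
qed

lemma chart_open_vimage:
  assumes "(U, \<phi>) \<in> A" "open W"
  shows "open (U \<inter> \<phi> -` W)"
proof -
  have "continuous_on U \<phi>" using chart(3)[OF assms(1)] by (simp add: homeomorphism_def)
  then show ?thesis using chart(1)[OF assms(1)] assms(2) by (rule continuous_open_preimage)
qed

text \<open>The continuity clause of \<open>smooth_map_on\<close> follows from smoothness in charts,
  as f is near each point a continuous function of continuous coordinates.\<close>

lemma smooth_functions_iff:
  "f \<in> smooth_functions A \<longleftrightarrow> (\<forall>(U, \<phi>)\<in>A. smooth_on (\<phi> ` U) (\<lambda>\<xi>. f (inv_into U \<phi> \<xi>)))"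
proof -
  have "continuous_on UNIV f" if *: "\<forall>(U, \<phi>)\<in>A. smooth_on (\<phi> ` U) (\<lambda>\<xi>. f (inv_into U \<phi> \<xi>))"
  proof (rule continuous_at_imp_continuous_on, rule ballI)
    fix x
    obtain U \<phi> where U: "(U, \<phi>) \<in> A" "x \<in> U" by (rule chart_at)
    have "continuous_on (\<phi> ` U) (\<lambda>\<xi>. f (inv_into U \<phi> \<xi>))"
      using * U smooth_on_continuous by blast
    moreover have "continuous_on U \<phi>" using chart(3)[OF U(1)] by (simp add: homeomorphism_def)
    ultimately have "continuous_on U (\<lambda>x. f (inv_into U \<phi> (\<phi> x)))"
      by (rule continuous_on_compose2) auto
    then have "continuous_on U f" by (rule continuous_on_eq) (simp add: chart_inverse[OF U(1)])
    then show "isCont f x" using U chart(1)[OF U(1)] continuous_on_eq_continuous_at by blast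
  qed
  then show ?thesis
    unfolding smooth_functions_def smooth_map_on_def euclidean_atlas_def by (auto simp: o_def)
qed

lemma smooth_functionsD:
  "f \<in> smooth_functions A \<Longrightarrow> (U, \<phi>) \<in> A \<Longrightarrow> smooth_on (\<phi> ` U) (\<lambda>\<xi>. f (inv_into U \<phi> \<xi>))"
  unfolding smooth_functions_iff by blast

lemma smooth_functions_continuous: "f \<in> smooth_functions A \<Longrightarrow> continuous_on UNIV f"
  unfolding smooth_functions_def smooth_map_on_def by simp

lemma smooth_functions_const [simp]: "(\<lambda>_. c) \<in> smooth_functions A"
  by (auto simp: smooth_functions_iff)

lemma smooth_functions_add:
  "f \<in> smooth_functions A \<Longrightarrow> g \<in> smooth_functions A \<Longrightarrow> (\<lambda>x. f x + g x) \<in> smooth_functions A"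
  using chart(2) by (auto simp: smooth_functions_iff intro!: smooth_on_add)

lemma smooth_functions_mult:
  "f \<in> smooth_functions A \<Longrightarrow> g \<in> smooth_functions A \<Longrightarrow> (\<lambda>x. f x * g x) \<in> smooth_functions A"
  using chart(2) by (auto simp: smooth_functions_iff intro!: smooth_on_mult)

lemma smooth_functions_diff:
  "f \<in> smooth_functions A \<Longrightarrow> g \<in> smooth_functions A \<Longrightarrow> (\<lambda>x. f x - g x) \<in> smooth_functions A"
  using chart(2) by (auto simp: smooth_functions_iff intro!: smooth_on_diff)

lemma smooth_functions_sum:
  "(\<And>i. i \<in> I \<Longrightarrow> f i \<in> smooth_functions A) \<Longrightarrow> (\<lambda>x. \<Sum>i\<in>I. f i x) \<in> smooth_functions A"
  by (induction I rule: infinite_finite_induct) (auto intro: smooth_functions_add)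

lemma smooth_functions_local:
  assumes "\<And>x. \<exists>g\<in>smooth_functions A. \<exists>N. open N \<and> x \<in> N \<and> (\<forall>y\<in>N. f y = g y)"
  shows "f \<in> smooth_functions A"
  unfolding smooth_functions_iff
proof (intro ballI, clarify)
  fix U \<phi> assume U: "(U, \<phi>) \<in> A"
  show "smooth_on (\<phi> ` U) (\<lambda>\<xi>. f (inv_into U \<phi> \<xi>))"
  proof (rule smooth_on_local)
    fix \<xi> assume \<xi>: "\<xi> \<in> \<phi> ` U"
    obtain g N where g: "g \<in> smooth_functions A" "open N" "inv_into U \<phi> \<xi> \<in> N" "\<And>y. y \<in> N \<Longrightarrow> f y = g y"
      using assms[of "inv_into U \<phi> \<xi>"] by blast
    have o: "open (\<phi> ` (U \<inter> N))" using chart_open_image[OF U g(2)] .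
    have "smooth_on (\<phi> ` (U \<inter> N)) (\<lambda>\<xi>. g (inv_into U \<phi> \<xi>))"
      using smooth_functionsD[OF g(1) U] by (rule smooth_on_subset) auto
    then have "smooth_on (\<phi> ` (U \<inter> N)) (\<lambda>\<xi>. f (inv_into U \<phi> \<xi>))"
      by (rule iffD1[OF smooth_on_cong[OF o], rotated]) (auto simp: chart_inverse[OF U] g(4))
    moreover have "\<xi> \<in> \<phi> ` (U \<inter> N)"
      using g(3) chart_inverse(2,3)[OF U \<xi>] by (metis IntI imageI)
    ultimately show "\<exists>V. open V \<and> \<xi> \<in> V \<and> smooth_on V (\<lambda>\<xi>. f (inv_into U \<phi> \<xi>))"
      using o by blast
  qed
qed

text \<open>The Hausdorff property makes the compact support closed, so that the extension by zero is smooth.\<close>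

lemma smooth_extension_by_zero:
  assumes U: "(U, \<phi>) \<in> A" and K: "compact K" "K \<subseteq> \<phi> ` U"
    and G: "smooth_on (\<phi> ` U) G" "\<And>\<xi>. \<xi> \<in> \<phi> ` U \<Longrightarrow> \<xi> \<notin> K \<Longrightarrow> G \<xi> = 0"
  shows "(\<lambda>x. if x \<in> U then G (\<phi> x) else 0) \<in> smooth_functions A"
  unfolding smooth_functions_iff
proof (intro ballI, clarify)
  let ?f = "\<lambda>x. if x \<in> U then G (\<phi> x) else 0"
  let ?K = "inv_into U \<phi> ` K"
  have "continuous_on K (inv_into U \<phi>)"
    by (rule continuous_on_subset[OF _ K(2)]) (use chart(3)[OF U] in \<open>simp add: homeomorphism_def\<close>)
  then have "closed ?K" using K(1) compact_continuous_image compact_imp_closed by blast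
  have KU: "?K \<subseteq> U" using K(2) chart_inverse(3)[OF U] by blast
  fix V \<psi> assume V: "(V, \<psi>) \<in> A"
  show "smooth_on (\<psi> ` V) (\<lambda>\<xi>. ?f (inv_into V \<psi> \<xi>))"
  proof (rule smooth_on_local)
    fix \<eta> assume \<eta>: "\<eta> \<in> \<psi> ` V"
    let ?y = "inv_into V \<psi> \<eta>"
    show "\<exists>W. open W \<and> \<eta> \<in> W \<and> smooth_on W (\<lambda>\<xi>. ?f (inv_into V \<psi> \<xi>))"
    proof (cases "?y \<in> U")
      case True
      let ?W = "\<psi> ` (V \<inter> U)"
      have o: "open ?W" using chart_open_image[OF V chart(1)[OF U]] .
      have "smooth_on ?W (\<lambda>\<xi>. G ((\<phi> \<circ> inv_into V \<psi>) \<xi>))"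
        using smooth_on_compose[OF o chart(2)[OF U] _ chart_transition[OF V U] G(1)]
        by (auto simp: chart_inverse[OF V] image_subset_iff)
      then have "smooth_on ?W (\<lambda>\<xi>. ?f (inv_into V \<psi> \<xi>))"
        by (rule iffD1[OF smooth_on_cong[OF o], rotated]) (auto simp: chart_inverse[OF V])
      moreover have "\<eta> \<in> ?W" using True chart_inverse(2,3)[OF V \<eta>] by (metis IntI imageI)
      ultimately show ?thesis using o by blast
    next
      case False
      let ?W = "\<psi> ` (V \<inter> - ?K)"
      have o: "open ?W" using chart_open_image[OF V, of "- ?K"] \<open>closed ?K\<close> by auto
      have "?f (inv_into V \<psi> \<xi>) = 0" if "\<xi> \<in> ?W" for \<xi>
      proof -
        have "inv_into V \<psi> \<xi> \<notin> ?K" using that chart_inverse(1)[OF V] by auto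
        then have "\<phi> (inv_into V \<psi> \<xi>) \<notin> K" if "inv_into V \<psi> \<xi> \<in> U"
          using chart_inverse(1)[OF U that] by force
        then show ?thesis using G(2) by auto
      qed
      then have "smooth_on ?W (\<lambda>\<xi>. ?f (inv_into V \<psi> \<xi>))"
        using smooth_on_cong[OF o, of "\<lambda>\<xi>. ?f (inv_into V \<psi> \<xi>)" "\<lambda>_. 0"] by simp
      moreover have "\<eta> \<in> ?W"
        using False KU chart_inverse(2,3)[OF V \<eta>] by (metis ComplI IntI imageI subsetD)
      ultimately show ?thesis using o by blast
    qed
  qed
qed

text \<open>Multiplication with a bump supported inside W gives a function on the whole manifold
  with the same germ at x, which is what derivations accept. The last clause, on the support, serves
  for building cut-offs.\<close>

lemma smooth_extension:
  assumes U: "(U, \<phi>) \<in> A" and x: "x \<in> U" and W: "open W" "W \<subseteq> \<phi> ` U" "\<phi> x \<in> W" and F: "smooth_on W F"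
  obtains g N where "g \<in> smooth_functions A" "open N" "x \<in> N" "N \<subseteq> U" "\<phi> ` N \<subseteq> W"
    "\<And>y. y \<in> N \<Longrightarrow> g y = F (\<phi> y)" "\<And>y. g y \<noteq> 0 \<Longrightarrow> y \<in> U \<and> \<phi> y \<in> W"
proof -
  obtain R where R: "R > 0" "cball (\<phi> x) R \<subseteq> W" using W open_contains_cball by blast
  have "0 < R / 2" "R / 2 < R" using R by auto
  then obtain \<beta> :: "'e \<Rightarrow> real" where \<beta>: "smooth_on UNIV \<beta>" "\<And>y. y \<in> ball (\<phi> x) (R / 2) \<Longrightarrow> \<beta> y = 1"
    "\<And>y. y \<notin> ball (\<phi> x) R \<Longrightarrow> \<beta> y = 0" by (metis smooth_bump_exists)
  define G where "G \<xi> = \<beta> \<xi> * F \<xi>" for \<xi>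
  have G0: "G \<xi> = 0" if "\<xi> \<notin> cball (\<phi> x) R" for \<xi> using \<beta>(3)[of \<xi>] that by (simp add: G_def)
  have "smooth_on (\<phi> ` U) G"
  proof (rule smooth_on_local)
    fix \<xi> assume "\<xi> \<in> \<phi> ` U"
    show "\<exists>V. open V \<and> \<xi> \<in> V \<and> smooth_on V G"
    proof (cases "\<xi> \<in> W")
      case True
      have "smooth_on W G" unfolding G_def
        using W(1) smooth_on_subset[OF \<beta>(1)] F by (intro smooth_on_mult) auto
      then show ?thesis using W(1) True by blast
    next
      case False
      have "smooth_on (- cball (\<phi> x) R) G"
        using smooth_on_cong[of "- cball (\<phi> x) R" G "\<lambda>_. 0"] G0 by auto
      moreover have "\<xi> \<in> - cball (\<phi> x) R" using False R by auto
      ultimately show ?thesis using open_Compl[OF closed_cball] by blast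
    qed
  qed
  then have g: "(\<lambda>x. if x \<in> U then G (\<phi> x) else 0) \<in> smooth_functions A"
    using R W G0 by (intro smooth_extension_by_zero[OF U compact_cball]) auto
  show thesis
  proof (rule that[OF g, of "U \<inter> \<phi> -` ball (\<phi> x) (R / 2)"])
    show "open (U \<inter> \<phi> -` ball (\<phi> x) (R / 2))" by (rule chart_open_vimage[OF U open_ball])
    show "\<phi> ` (U \<inter> \<phi> -` ball (\<phi> x) (R / 2)) \<subseteq> W" using R by (auto simp: subset_iff)
    show "y \<in> U \<and> \<phi> y \<in> W" if "(if y \<in> U then G (\<phi> y) else 0) \<noteq> 0" for y
      using that G0[of "\<phi> y"] R(2) by (metis subsetD)
  qed (use x R \<beta>(2) in \<open>auto simp: G_def\<close>)
qed

text \<open>The extension of the constant 1 from the part of a chart inside N; injectivity of the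
  coordinate map turns the condition on its support into vanishing off N.\<close>

lemma smooth_cutoff:
  assumes "open N" "x \<in> N"
  obtains \<kappa> N' where "\<kappa> \<in> smooth_functions A" "open N'" "x \<in> N'" "\<And>y. y \<in> N' \<Longrightarrow> \<kappa> y = 1"
    "\<And>y. y \<notin> N \<Longrightarrow> \<kappa> y = 0"
proof -
  obtain U \<phi> where U: "(U, \<phi>) \<in> A" "x \<in> U" by (rule chart_at)
  have "\<phi> ` (U \<inter> N) \<subseteq> \<phi> ` U" "\<phi> x \<in> \<phi> ` (U \<inter> N)" using U assms(2) by auto
  from smooth_extension[OF U chart_open_image[OF U(1) assms(1)] this smooth_on_const[of _ 1]]
  obtain \<kappa> N' where \<kappa>: "\<kappa> \<in> smooth_functions A" "open N'" "x \<in> N'" "\<And>y. y \<in> N' \<Longrightarrow> \<kappa> y = 1"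
    "\<And>y. \<kappa> y \<noteq> 0 \<Longrightarrow> y \<in> U \<and> \<phi> y \<in> \<phi> ` (U \<inter> N)"
    by metis
  have "\<kappa> y = 0" if "y \<notin> N" for y
  proof (rule ccontr)
    assume "\<kappa> y \<noteq> 0"
    then obtain z where "y \<in> U" "z \<in> U" "z \<in> N" "\<phi> y = \<phi> z" using \<kappa>(5) by blast
    then have "y = z" using chart_inverse(1)[OF U(1)] by metis
    then show False using \<open>z \<in> N\<close> that by simp
  qed
  with \<kappa> show ?thesis using that by blast
qed

section \<open>Derivations of the algebra of smooth functions\<close>

lemma tangent_outside: "u \<in> tangent_space A x \<Longrightarrow> f \<notin> smooth_functions A \<Longrightarrow> u f = 0"
  unfolding tangent_space_def by blast

lemma tangent_add:
  "u \<in> tangent_space A x \<Longrightarrow> f \<in> smooth_functions A \<Longrightarrow> g \<in> smooth_functions A \<Longrightarrow>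
    u (\<lambda>y. f y + g y) = u f + u g"
  unfolding tangent_space_def plus_fun_def by blast

lemma tangent_scale:
  "u \<in> tangent_space A x \<Longrightarrow> f \<in> smooth_functions A \<Longrightarrow> u (\<lambda>y. c * f y) = c * u f"
  unfolding tangent_space_def by blast

lemma tangent_mult:
  "u \<in> tangent_space A x \<Longrightarrow> f \<in> smooth_functions A \<Longrightarrow> g \<in> smooth_functions A \<Longrightarrow>
    u (\<lambda>y. f y * g y) = u f * g x + f x * u g"
  unfolding tangent_space_def times_fun_def by blast

lemma tangent_const: "u \<in> tangent_space A x \<Longrightarrow> u (\<lambda>_. c) = 0"
  using tangent_mult[of u x "\<lambda>_. 1" "\<lambda>_. 1"] tangent_scale[of u x "\<lambda>_. 1" c] by simp

lemma tangent_diff: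
  "u \<in> tangent_space A x \<Longrightarrow> f \<in> smooth_functions A \<Longrightarrow> g \<in> smooth_functions A \<Longrightarrow>
    u (\<lambda>y. f y - g y) = u f - u g"
  using tangent_add[of u x "\<lambda>y. f y - g y" g] smooth_functions_diff[of f g] by simp

lemma tangent_sum:
  "u \<in> tangent_space A x \<Longrightarrow> (\<And>i. i \<in> I \<Longrightarrow> f i \<in> smooth_functions A) \<Longrightarrow>
    u (\<lambda>y. \<Sum>i\<in>I. f i y) = (\<Sum>i\<in>I. u (f i))"
proof (induction I rule: infinite_finite_induct)
  case (insert i I)
  then show ?case
    using tangent_add[of u x "f i" "\<lambda>y. \<Sum>i\<in>I. f i y"] smooth_functions_sum[of I f] by simp
qed (simp_all add: tangent_const)

text \<open>With a cut-off \<kappa> supported in N the product of \<kappa> and f - g is identically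
  zero. The Leibniz rule at x, where f = g and \<kappa> = 1, leaves u (f - g) = 0.\<close>

lemma tangent_local:
  assumes u: "u \<in> tangent_space A x" and fg: "f \<in> smooth_functions A" "g \<in> smooth_functions A"
    and N: "open N" "x \<in> N" "\<And>y. y \<in> N \<Longrightarrow> f y = g y"
  shows "u f = u g"
proof -
  obtain \<kappa> N' where \<kappa>: "\<kappa> \<in> smooth_functions A" "x \<in> N'" "\<And>y. y \<in> N' \<Longrightarrow> \<kappa> y = 1" "\<And>y. y \<notin> N \<Longrightarrow> \<kappa> y = 0"
    using smooth_cutoff[OF N(1,2)] by metis
  have "(\<lambda>y. \<kappa> y * (f y - g y)) = (\<lambda>_. 0)" using N(3) \<kappa>(4) by (intro ext) fastforce
  moreover have "u (\<lambda>y. \<kappa> y * (f y - g y)) = u \<kappa> * (f x - g x) + \<kappa> x * u (\<lambda>y. f y - g y)"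
    by (rule tangent_mult[OF u \<kappa>(1) smooth_functions_diff[OF fg]])
  ultimately show ?thesis
    using tangent_const[OF u] tangent_diff[OF u fg] N \<kappa>(2,3) by simp
qed

lemma tangent_space_add: "u \<in> tangent_space A x \<Longrightarrow> u' \<in> tangent_space A x \<Longrightarrow> u + u' \<in> tangent_space A x"
  unfolding tangent_space_def by (simp add: algebra_simps)

lemma tangent_space_tscale: "u \<in> tangent_space A x \<Longrightarrow> tscale c u \<in> tangent_space A x"
  unfolding tangent_space_def tscale_def by (simp add: algebra_simps)

lemma tangent_space_zero: "0 \<in> tangent_space A x"
  unfolding tangent_space_def by simp

lemma vector_fieldsD: "X \<in> vector_fields A \<Longrightarrow> X x \<in> tangent_space A x"
  "X \<in> vector_fields A \<Longrightarrow> f \<in> smooth_functions A \<Longrightarrow> (\<lambda>x. X x f) \<in> smooth_functions A"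
  unfolding vector_fields_def deriv_along_def by auto

lemma vector_fields_add: "X \<in> vector_fields A \<Longrightarrow> Y \<in> vector_fields A \<Longrightarrow> X + Y \<in> vector_fields A"
  unfolding vector_fields_def deriv_along_def by (auto intro: tangent_space_add smooth_functions_add)

lemma vector_fields_vscale: "f \<in> smooth_functions A \<Longrightarrow> X \<in> vector_fields A \<Longrightarrow> vscale f X \<in> vector_fields A"
  unfolding vector_fields_def deriv_along_def vscale_def
  by (auto intro!: tangent_space_tscale) (auto intro: smooth_functions_mult simp: tscale_def)

lemma vector_fields_zero [simp]: "0 \<in> vector_fields A"
  unfolding vector_fields_def deriv_along_def by (auto simp: tangent_space_zero)

lemma vector_fields_sum: "(\<And>i. i \<in> I \<Longrightarrow> X i \<in> vector_fields A) \<Longrightarrow> (\<Sum>i\<in>I. X i) \<in> vector_fields A"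
  by (induction I rule: infinite_finite_induct) (auto intro: vector_fields_add)

lemma vector_fields_uminus: "X \<in> vector_fields A \<Longrightarrow> - X \<in> vector_fields A"
  using vector_fields_vscale[of "\<lambda>_. - 1" X]
  by (simp add: vscale_def tscale_def fun_Compl_def)

lemma vector_fields_diff: "X \<in> vector_fields A \<Longrightarrow> Y \<in> vector_fields A \<Longrightarrow> X - Y \<in> vector_fields A"
  using vector_fields_add[of X "- Y"] vector_fields_uminus by simp

end

text \<open>
  A chart with a cut-off function that is \<open>1\<close> on \<open>ball \<xi>0 r\<close>. Multiplication with the cut-off turns
  the coordinates and the coordinate vector fields into global objects.
\<close>

locale cutoff_chart = smooth_manifold_atlas A
  for A :: "('a::{t2_space, second_countable_topology}, 'e::euclidean_space) atlas" +
  fixes U :: "'a set" and \<phi> :: "'a \<Rightarrow> 'e" and \<xi>0 :: 'e and r R :: real and \<beta> :: "'e \<Rightarrow> real"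
  assumes U: "(U, \<phi>) \<in> A" and r: "0 < r" "r < R" "cball \<xi>0 R \<subseteq> \<phi> ` U"
    and \<beta>: "smooth_on UNIV \<beta>" "\<And>\<xi>. \<xi> \<in> ball \<xi>0 r \<Longrightarrow> \<beta> \<xi> = 1" "\<And>\<xi>. \<xi> \<notin> ball \<xi>0 R \<Longrightarrow> \<beta> \<xi> = 0"
begin

abbreviation "\<theta> \<equiv> inv_into U \<phi>"

definition "patch = U \<inter> \<phi> -` ball \<xi>0 r"

definition "coord b x = (if x \<in> U then \<beta> (\<phi> x) * (\<phi> x \<bullet> b) else 0)"

definition coord_field :: "'e \<Rightarrow> 'a vector_field" where
  "coord_field w x f = (if f \<in> smooth_functions A \<and> x \<in> U
     then \<beta> (\<phi> x) * frechet_derivative (\<lambda>\<xi>. f (\<theta> \<xi>)) (at (\<phi> x)) w else 0)"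

text \<open>Read off from the values on the cut-off coordinates, without reference to a base point.
  It is thus additive and homogeneous on all functionals, tangent or not.\<close>

definition components :: "'a tangent_vector \<Rightarrow> 'e" where
  "components u = (\<Sum>b\<in>Basis. u (coord b) *\<^sub>R b)"

lemma open_patch: "open patch"
  unfolding patch_def by (rule chart_open_vimage[OF U open_ball])

lemma patch_iff: "x \<in> patch \<longleftrightarrow> x \<in> U \<and> \<phi> x \<in> ball \<xi>0 r"
  by (auto simp: patch_def)

lemma ball_sub: "ball \<xi>0 r \<subseteq> \<phi> ` U"
  using r by auto

lemma \<theta>_patch: "\<xi> \<in> ball \<xi>0 r \<Longrightarrow> \<theta> \<xi> \<in> patch" "\<xi> \<in> ball \<xi>0 r \<Longrightarrow> \<phi> (\<theta> \<xi>) = \<xi>" "x \<in> patch \<Longrightarrow> \<theta> (\<phi> x) = x"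
  using chart_inverse[OF U] ball_sub by (auto simp: patch_iff subset_iff)

lemma ext_smooth:
  assumes "smooth_on (\<phi> ` U) F"
  shows "(\<lambda>x. if x \<in> U then \<beta> (\<phi> x) * F (\<phi> x) else 0) \<in> smooth_functions A"
  by (rule smooth_extension_by_zero[OF U compact_cball r(3)])
    (use assms \<beta> chart(2)[OF U] smooth_on_subset[OF \<beta>(1)] in \<open>auto intro!: smooth_on_mult\<close>)

lemma coord_smooth: "coord b \<in> smooth_functions A"
  unfolding coord_def[abs_def]
  by (rule ext_smooth) (intro smooth_on_inner chart(2)[OF U] smooth_on_const smooth_on_ident)

lemma coord_patch: "x \<in> patch \<Longrightarrow> coord b x = \<phi> x \<bullet> b"
  by (simp add: coord_def patch_iff \<beta>(2)[unfolded mem_ball])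

lemma local_smooth: "f \<in> smooth_functions A \<Longrightarrow> smooth_on (\<phi> ` U) (\<lambda>\<xi>. f (\<theta> \<xi>))"
  by (rule smooth_functionsD[OF _ U])

lemma local_derivative:
  "f \<in> smooth_functions A \<Longrightarrow> x \<in> U \<Longrightarrow>
    ((\<lambda>\<xi>. f (\<theta> \<xi>)) has_derivative frechet_derivative (\<lambda>\<xi>. f (\<theta> \<xi>)) (at (\<phi> x))) (at (\<phi> x))"
  using smooth_on_has_derivative[OF local_smooth] by blast

lemma local_frechet:
  assumes "((\<lambda>\<xi>. f (\<theta> \<xi>)) has_derivative f') (at \<xi>)"
  shows "frechet_derivative (\<lambda>\<xi>. f (\<theta> \<xi>)) (at \<xi>) = f'"
  using frechet_derivative_at[OF assms] by simp

lemma coord_field_tangent: "coord_field w x \<in> tangent_space A x"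
proof (cases "x \<in> U")
  case True
  note D = local_derivative[OF _ True]
  have "frechet_derivative (\<lambda>\<xi>. f (\<theta> \<xi>) + g (\<theta> \<xi>)) (at (\<phi> x)) =
      (\<lambda>w. frechet_derivative (\<lambda>\<xi>. f (\<theta> \<xi>)) (at (\<phi> x)) w + frechet_derivative (\<lambda>\<xi>. g (\<theta> \<xi>)) (at (\<phi> x)) w)"
    "frechet_derivative (\<lambda>\<xi>. c * f (\<theta> \<xi>)) (at (\<phi> x)) = (\<lambda>w. c * frechet_derivative (\<lambda>\<xi>. f (\<theta> \<xi>)) (at (\<phi> x)) w)"
    "frechet_derivative (\<lambda>\<xi>. f (\<theta> \<xi>) * g (\<theta> \<xi>)) (at (\<phi> x)) =
      (\<lambda>w. f x * frechet_derivative (\<lambda>\<xi>. g (\<theta> \<xi>)) (at (\<phi> x)) w + frechet_derivative (\<lambda>\<xi>. f (\<theta> \<xi>)) (at (\<phi> x)) w * g x)"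
    if "f \<in> smooth_functions A" "g \<in> smooth_functions A" for f g c
    using has_derivative_add[OF D D, of f g] has_derivative_mult_right[OF D, of f c] has_derivative_mult[OF D D, of f g] that
      chart_inverse(1)[OF U True]
    by (auto dest!: frechet_derivative_at[symmetric])
  with True show ?thesis
    unfolding tangent_space_def coord_field_def
    by (auto simp: plus_fun_def times_fun_def smooth_functions_add smooth_functions_mult algebra_simps)
next
  case False
  then show ?thesis by (simp add: tangent_space_def coord_field_def)
qed

lemma coord_field: "coord_field w \<in> vector_fields A"
  unfolding vector_fields_def deriv_along_def
proof (intro CollectI conjI allI ballI coord_field_tangent)
  fix f assume f: "f \<in> smooth_functions A"
  have "(\<lambda>x. if x \<in> U then \<beta> (\<phi> x) * frechet_derivative (\<lambda>\<xi>. f (\<theta> \<xi>)) (at (\<phi> x)) w else 0) \<in> smooth_functions A"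
    by (rule ext_smooth[OF smooth_on_frechet_derivative[OF local_smooth[OF f]]])
  then show "(\<lambda>x. coord_field w x f) \<in> smooth_functions A"
    using f by (simp add: coord_field_def)
qed

lemma coord_field_patch:
  "x \<in> patch \<Longrightarrow> f \<in> smooth_functions A \<Longrightarrow> coord_field w x f = frechet_derivative (\<lambda>\<xi>. f (\<theta> \<xi>)) (at (\<phi> x)) w"
  by (simp add: coord_field_def patch_iff \<beta>(2)[unfolded mem_ball])

lemma coord_field_linear: "linear (\<lambda>w. coord_field w x f)"
proof (cases "f \<in> smooth_functions A \<and> x \<in> U")
  case True
  then have "linear (frechet_derivative (\<lambda>\<xi>. f (\<theta> \<xi>)) (at (\<phi> x)))"
    using local_derivative has_derivative_linear by blast
  with True show ?thesis
    by (auto intro!: linearI simp: coord_field_def linear_add linear_scale algebra_simps)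
qed (auto intro!: linearI simp: coord_field_def)

lemma coord_field_add: "coord_field (v + w) = coord_field v + coord_field w"
  by (intro ext) (simp add: linear_add[OF coord_field_linear])

lemma coord_field_scaleR: "coord_field (c *\<^sub>R v) = vscale (\<lambda>_. c) (coord_field v)"
  by (intro ext) (simp add: linear_scale[OF coord_field_linear] vscale_def tscale_def)

lemma local_frechet_eq:
  assumes "x \<in> patch" "\<And>\<xi>. \<xi> \<in> ball \<xi>0 r \<Longrightarrow> f (\<theta> \<xi>) = F \<xi>" "(F has_derivative F') (at (\<phi> x))"
  shows "frechet_derivative (\<lambda>\<xi>. f (\<theta> \<xi>)) (at (\<phi> x)) = F'"
  by (rule local_frechet, rule has_derivative_transform_within_open[OF assms(3), of "ball \<xi>0 r"])
    (use assms(1,2) in \<open>auto simp: patch_iff\<close>)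

lemma components_coord_field: "x \<in> patch \<Longrightarrow> components (coord_field w x) = w"
proof -
  assume x: "x \<in> patch"
  have "frechet_derivative (\<lambda>\<xi>. coord b (\<theta> \<xi>)) (at (\<phi> x)) = (\<lambda>w. w \<bullet> b)" for b
    by (rule local_frechet_eq[OF x, where F = "\<lambda>\<xi>. \<xi> \<bullet> b"])
      (auto simp: coord_patch \<theta>_patch intro!: derivative_eq_intros)
  then show ?thesis
    by (simp add: components_def coord_field_patch[OF x coord_smooth] euclidean_representation)
qed

text \<open>By the Hadamard lemma f is near x the constant f x plus a sum of products of a
  coordinate difference, which vanishes at x, and a coefficient. The Leibniz rule leaves
  \<open>u (coord b)\<close> times the coefficient at x, which is a partial derivative of f.\<close>

lemma tangent_representation:
  assumes x: "x \<in> patch" and u: "u \<in> tangent_space A x"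
  shows "u = coord_field (components u) x"
proof
  fix f
  show "u f = coord_field (components u) x f"
  proof (cases "f \<in> smooth_functions A")
    case False
    then show ?thesis using tangent_outside[OF u] by (simp add: coord_field_def)
  next
    case f: True
    let ?F = "\<lambda>\<xi>. f (\<theta> \<xi>)"
    have xi: "x \<in> U" "\<phi> x \<in> ball \<xi>0 r" using x by (auto simp: patch_iff)
    obtain \<rho> where \<rho>: "\<rho> > 0" "ball (\<phi> x) \<rho> \<subseteq> ball \<xi>0 r"
      using openE[OF open_ball xi(2)] by metis
    have sub: "ball (\<phi> x) \<rho> \<subseteq> \<phi> ` U" using \<rho> ball_sub by blast
    obtain g where g: "\<And>b. smooth_on (ball (\<phi> x) \<rho>) (g b)"
      "\<And>\<xi>. \<xi> \<in> ball (\<phi> x) \<rho> \<Longrightarrow> ?F \<xi> = ?F (\<phi> x) + (\<Sum>b\<in>Basis. ((\<xi> - \<phi> x) \<bullet> b) * g b \<xi>)"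
      "\<And>b. g b (\<phi> x) = frechet_derivative ?F (at (\<phi> x)) b"
      by (rule Hadamard_smooth[OF smooth_on_subset[OF local_smooth[OF f] sub] \<rho>(1)]) blast
    \<comment> \<open>The Hadamard coefficients exist on a coordinate ball only; they are replaced
      by global functions with the same germs before u is applied.\<close>
    have "\<exists>G N. G \<in> smooth_functions A \<and> open N \<and> x \<in> N \<and> N \<subseteq> U \<and> \<phi> ` N \<subseteq> ball (\<phi> x) \<rho> \<and> (\<forall>y\<in>N. G y = g b (\<phi> y))" for b
    proof -
      have "\<phi> x \<in> ball (\<phi> x) \<rho>" using \<rho>(1) by simp
      from smooth_extension[OF U xi(1) open_ball sub this g(1)[of b]] show ?thesis by metis
    qed
    then obtain G N where G: "\<And>b. G b \<in> smooth_functions A" "\<And>b. open (N b)" "\<And>b. x \<in> N b" "\<And>b. N b \<subseteq> U"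
      "\<And>b. \<phi> ` N b \<subseteq> ball (\<phi> x) \<rho>" "\<And>b y. y \<in> N b \<Longrightarrow> G b y = g b (\<phi> y)" by metis
    define M where "M = patch \<inter> (U \<inter> \<phi> -` ball (\<phi> x) \<rho>) \<inter> (\<Inter>b\<in>Basis. N b)"
    define f1 where "f1 y = (\<Sum>b\<in>Basis. (coord b y - coord b x) * G b y)" for y
    have s1: "(\<lambda>y. (coord b y - coord b x) * G b y) \<in> smooth_functions A" for b
      by (intro smooth_functions_mult smooth_functions_diff smooth_functions_const coord_smooth G)
    have f1: "f1 \<in> smooth_functions A" unfolding f1_def[abs_def] by (intro smooth_functions_sum s1)
    have "u f = u (\<lambda>y. f x + f1 y)"
    proof (rule tangent_local[OF u f])
      show "(\<lambda>y. f x + f1 y) \<in> smooth_functions A" by (intro smooth_functions_add f1 smooth_functions_const)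
      show "open M" unfolding M_def
        by (intro open_Int open_INT open_patch chart_open_vimage[OF U open_ball] G finite_Basis ballI)
      show "x \<in> M" using x xi \<rho> G(3) by (auto simp: M_def)
      show "f y = f x + f1 y" if "y \<in> M" for y
      proof -
        have y: "y \<in> patch" "y \<in> U" "\<phi> y \<in> ball (\<phi> x) \<rho>" "\<And>b. b \<in> Basis \<Longrightarrow> y \<in> N b" using that by (auto simp: M_def)
        have "f1 y = (\<Sum>b\<in>Basis. ((\<phi> y - \<phi> x) \<bullet> b) * g b (\<phi> y))"
          unfolding f1_def using y x G(6) by (intro sum.cong) (auto simp: coord_patch inner_diff_left)
        then show ?thesis using g(2)[OF y(3)] \<theta>_patch(3)[OF y(1)] \<theta>_patch(3)[OF x] by simp
      qed
    qed
    also have "\<dots> = u f1" using tangent_add[OF u smooth_functions_const f1] tangent_const[OF u] by simp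
    also have "\<dots> = (\<Sum>b\<in>Basis. u (\<lambda>y. (coord b y - coord b x) * G b y))"
      unfolding f1_def[abs_def] by (rule tangent_sum[OF u s1])
    also have "\<dots> = (\<Sum>b\<in>Basis. u (coord b) * frechet_derivative ?F (at (\<phi> x)) b)"
    proof (intro sum.cong refl)
      fix b :: 'e
      have "u (\<lambda>y. (coord b y - coord b x) * G b y) = u (\<lambda>y. coord b y - coord b x) * G b x"
        using tangent_mult[OF u smooth_functions_diff[OF coord_smooth smooth_functions_const] G(1), of b "coord b x" b] by simp
      also have "\<dots> = u (coord b) * g b (\<phi> x)"
        using tangent_diff[OF u coord_smooth smooth_functions_const] tangent_const[OF u] G(6)[OF G(3)] by simp
      finally show "u (\<lambda>y. (coord b y - coord b x) * G b y) = u (coord b) * frechet_derivative ?F (at (\<phi> x)) b"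
        by (simp add: g(3))
    qed
    also have "\<dots> = frechet_derivative ?F (at (\<phi> x)) (components u)"
      using has_derivative_linear[OF local_derivative[OF f xi(1)]]
      by (simp add: components_def linear_sum linear_scale)
    finally show ?thesis by (simp add: coord_field_patch[OF x f])
  qed
qed

lemma tangent_eqI:
  "x \<in> patch \<Longrightarrow> u \<in> tangent_space A x \<Longrightarrow> u' \<in> tangent_space A x \<Longrightarrow> components u = components u' \<Longrightarrow> u = u'"
  using tangent_representation by metis

lemma components_add: "components (u + u') = components u + components u'"
  by (simp add: components_def sum.distrib scaleR_add_left)

lemma components_tscale: "components (tscale c u) = c *\<^sub>R components u"
  by (simp add: components_def tscale_def scaleR_sum_right)

lemma components_zero [simp]: "components 0 = 0"
  by (simp add: components_def)

lemma components_sum: "components (\<Sum>i\<in>I. u i) = (\<Sum>i\<in>I. components (u i))"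
  by (induction I rule: infinite_finite_induct)
    (simp_all only: sum.infinite sum.empty sum.insert components_add components_zero not_False_eq_True)

lemma components_inner: "b \<in> Basis \<Longrightarrow> components u \<bullet> b = u (coord b)"
  unfolding components_def by (simp add: inner_sum_left_Basis)

lemma components_smooth:
  assumes "X \<in> vector_fields A"
  shows "smooth_on (\<phi> ` U) (\<lambda>\<xi>. components (X (\<theta> \<xi>)))"
  unfolding components_def
  by (intro smooth_on_sum smooth_on_scaleR chart(2)[OF U] smooth_on_const
      local_smooth[OF vector_fieldsD(2)[OF assms coord_smooth]])

end

lemma (in smooth_manifold_atlas) cutoff_chart_at:
  obtains U \<phi> \<xi>0 r R \<beta> where "cutoff_chart A U \<phi> \<xi>0 r R \<beta>" "x \<in> U" "\<phi> x = \<xi>0"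
proof -
  obtain U \<phi> where U: "(U, \<phi>) \<in> A" "x \<in> U" by (rule chart_at)
  then obtain R where R: "R > 0" "cball (\<phi> x) R \<subseteq> \<phi> ` U"
    using chart(2)[OF U(1)] open_contains_cball by blast
  have "0 < R / 2" "R / 2 < R" using R by auto
  then obtain \<beta> :: "'e \<Rightarrow> real" where \<beta>: "smooth_on UNIV \<beta>" "\<And>y. y \<in> ball (\<phi> x) (R / 2) \<Longrightarrow> \<beta> y = 1"
    "\<And>y. y \<notin> ball (\<phi> x) R \<Longrightarrow> \<beta> y = 0" by (metis smooth_bump_exists)
  have "cutoff_chart A U \<phi> (\<phi> x) (R / 2) R \<beta>"
    by unfold_locales (use U R \<beta> in auto)
  then show ?thesis using that U by blast
qed

section \<open>Connections in a chart\<close>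

lemma sum_fun_apply: "(\<Sum>i\<in>I. f i) x = (\<Sum>i\<in>I. f i x)"
  by (induction I rule: infinite_finite_induct) auto

locale connection_manifold = smooth_manifold_atlas A
  for A :: "('a::{t2_space, second_countable_topology}, 'e::euclidean_space) atlas" +
  fixes D :: "'a connection"
  assumes linear_connection: "linear_connection A D"
begin

lemma D_closed: "X \<in> vector_fields A \<Longrightarrow> Y \<in> vector_fields A \<Longrightarrow> D X Y \<in> vector_fields A"
  using linear_connection unfolding linear_connection_def by blast

lemma D_add_left: "X \<in> vector_fields A \<Longrightarrow> X' \<in> vector_fields A \<Longrightarrow> Y \<in> vector_fields A \<Longrightarrow>
    D (X + X') Y = D X Y + D X' Y"
  using linear_connection unfolding linear_connection_def by blast

lemma D_vscale_left: "f \<in> smooth_functions A \<Longrightarrow> X \<in> vector_fields A \<Longrightarrow> Y \<in> vector_fields A \<Longrightarrow>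
    D (vscale f X) Y = vscale f (D X Y)"
  using linear_connection unfolding linear_connection_def by blast

lemma D_add_right: "X \<in> vector_fields A \<Longrightarrow> Y \<in> vector_fields A \<Longrightarrow> Y' \<in> vector_fields A \<Longrightarrow>
    D X (Y + Y') = D X Y + D X Y'"
  using linear_connection unfolding linear_connection_def by blast

lemma D_vscale_right: "f \<in> smooth_functions A \<Longrightarrow> X \<in> vector_fields A \<Longrightarrow> Y \<in> vector_fields A \<Longrightarrow>
    D X (vscale f Y) = vscale (deriv_along X f) Y + vscale f (D X Y)"
  using linear_connection unfolding linear_connection_def by blast

lemma D_zero_left: "Y \<in> vector_fields A \<Longrightarrow> D 0 Y = 0"
  using D_add_left[of 0 0 Y] vector_fields_zero by simp

lemma D_zero_right: "X \<in> vector_fields A \<Longrightarrow> D X 0 = 0"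
  using D_add_right[of X 0 0] vector_fields_zero by simp

lemma D_sum_left: "(\<And>i. i \<in> I \<Longrightarrow> X i \<in> vector_fields A) \<Longrightarrow> Y \<in> vector_fields A \<Longrightarrow>
    D (\<Sum>i\<in>I. X i) Y = (\<Sum>i\<in>I. D (X i) Y)"
proof (induction I rule: infinite_finite_induct)
  case (insert i I)
  have "D (X i + sum X I) Y = D (X i) Y + D (sum X I) Y"
    using insert.prems by (intro D_add_left vector_fields_sum) auto
  with insert show ?case by (simp only: sum.insert not_False_eq_True insertI2)
qed (simp_all only: sum.infinite sum.empty not_False_eq_True D_zero_left)

lemma D_sum_right: "(\<And>i. i \<in> I \<Longrightarrow> Y i \<in> vector_fields A) \<Longrightarrow> X \<in> vector_fields A \<Longrightarrow>
    D X (\<Sum>i\<in>I. Y i) = (\<Sum>i\<in>I. D X (Y i))"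
proof (induction I rule: infinite_finite_induct)
  case (insert i I)
  have "D X (Y i + sum Y I) = D X (Y i) + D X (sum Y I)"
    using insert.prems by (intro D_add_right vector_fields_sum) auto
  with insert show ?case by (simp only: sum.insert not_False_eq_True insertI2)
qed (simp_all only: sum.infinite sum.empty not_False_eq_True D_zero_right)

lemma vscale_cutoff_zero:
  assumes "\<And>y. y \<in> N \<Longrightarrow> Z y = 0" "\<And>y. y \<notin> N \<Longrightarrow> \<kappa> y = 0"
  shows "vscale \<kappa> Z = 0"
proof
  fix y
  show "vscale \<kappa> Z y = 0 y"
    using assms by (cases "y \<in> N") (auto simp: vscale_def tscale_def zero_fun_def)
qed

text \<open>A cut-off times X - X' vanishes identically, and \<open>D\<close> is linear over
  functions in its first argument.\<close>

lemma D_local_left: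
  assumes X: "X \<in> vector_fields A" "X' \<in> vector_fields A" and Y: "Y \<in> vector_fields A"
    and N: "open N" "x \<in> N" "\<And>y. y \<in> N \<Longrightarrow> X y = X' y"
  shows "D X Y x = D X' Y x"
proof -
  obtain \<kappa> N' where \<kappa>: "\<kappa> \<in> smooth_functions A" "x \<in> N'" "\<And>y. y \<in> N' \<Longrightarrow> \<kappa> y = 1" "\<And>y. y \<notin> N \<Longrightarrow> \<kappa> y = 0"
    using smooth_cutoff[OF N(1,2)] by metis
  let ?Z = "X - X'"
  have Z: "?Z \<in> vector_fields A" by (rule vector_fields_diff[OF X])
  have "vscale \<kappa> ?Z = 0" by (rule vscale_cutoff_zero[of N]) (use N(3) \<kappa>(4) in \<open>auto simp: zero_fun_def\<close>)
  then have "vscale \<kappa> (D ?Z Y) = 0"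
    using D_vscale_left[OF \<kappa>(1) Z Y] D_zero_left[OF Y] by simp
  then have "vscale \<kappa> (D ?Z Y) x = 0" by simp
  then have "D ?Z Y x = 0" using \<kappa>(2,3) by (simp add: vscale_def tscale_def)
  moreover have "D X Y = D ?Z Y + D X' Y" using D_add_left[OF Z X(2) Y] by simp
  ultimately show ?thesis by simp
qed

text \<open>As for the first argument, except that the Leibniz rule adds a multiple of Y - Y', which
  vanishes at x.\<close>

lemma D_local_right:
  assumes X: "X \<in> vector_fields A" and Y: "Y \<in> vector_fields A" "Y' \<in> vector_fields A"
    and N: "open N" "x \<in> N" "\<And>y. y \<in> N \<Longrightarrow> Y y = Y' y"
  shows "D X Y x = D X Y' x"
proof -
  obtain \<kappa> N' where \<kappa>: "\<kappa> \<in> smooth_functions A" "x \<in> N'" "\<And>y. y \<in> N' \<Longrightarrow> \<kappa> y = 1" "\<And>y. y \<notin> N \<Longrightarrow> \<kappa> y = 0"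
    using smooth_cutoff[OF N(1,2)] by metis
  let ?Z = "Y - Y'"
  have Z: "?Z \<in> vector_fields A" by (rule vector_fields_diff[OF Y])
  have "vscale \<kappa> ?Z = 0" by (rule vscale_cutoff_zero[of N]) (use N(3) \<kappa>(4) in \<open>auto simp: zero_fun_def\<close>)
  then have "vscale (deriv_along X \<kappa>) ?Z + vscale \<kappa> (D X ?Z) = 0"
    using D_vscale_right[OF \<kappa>(1) X Z] D_zero_right[OF X] by simp
  then have "(vscale (deriv_along X \<kappa>) ?Z + vscale \<kappa> (D X ?Z)) x f = 0" for f
    by (metis zero_fun_apply)
  then have "D X ?Z x = 0" using \<kappa>(2,3) N(2,3) by (auto simp: vscale_def tscale_def)
  moreover have "D X Y = D X ?Z + D X Y'" using D_add_right[OF X Z Y(2)] by simp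
  ultimately show ?thesis by simp
qed

end

locale connection_chart = connection_manifold A D + cutoff_chart A U \<phi> \<xi>0 r R \<beta>
  for A :: "('a::{t2_space, second_countable_topology}, 'e::euclidean_space) atlas" and D U \<phi> \<xi>0 r R \<beta>
begin

definition christoffel :: "'e \<Rightarrow> 'e \<Rightarrow> 'e \<Rightarrow> 'e" where
  "christoffel \<xi> v w = components (D (coord_field v) (coord_field w) (\<theta> \<xi>))"

text \<open>A global field with global coefficients that agrees with X on the patch. Its shape lets
  the function-linearity and the Leibniz rule of \<open>D\<close> act termwise.\<close>

definition extend :: "'a vector_field \<Rightarrow> 'a vector_field" where
  "extend X = (\<Sum>b\<in>Basis. vscale (\<lambda>y. X y (coord b)) (coord_field b))"

lemma coefficient_smooth: "X \<in> vector_fields A \<Longrightarrow> (\<lambda>y. X y (coord b)) \<in> smooth_functions A"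
  using coord_smooth vector_fieldsD(2) by blast

lemma extend: "X \<in> vector_fields A \<Longrightarrow> extend X \<in> vector_fields A"
  unfolding extend_def
  by (intro vector_fields_sum vector_fields_vscale coefficient_smooth coord_field)

lemma coord_field_expand: "coord_field w x = (\<Sum>b\<in>Basis. tscale (w \<bullet> b) (coord_field b x))"
proof
  fix f
  show "coord_field w x f = (\<Sum>b\<in>Basis. tscale (w \<bullet> b) (coord_field b x)) f"
    using linear_euclidean_expand[OF coord_field_linear, of w x f]
    by (simp add: sum_fun_apply tscale_def)
qed

lemma extend_patch: "X \<in> vector_fields A \<Longrightarrow> x \<in> patch \<Longrightarrow> X x = extend X x"
  using tangent_representation[OF _ vector_fieldsD(1), of x X] coord_field_expand[of "components (X x)" x]
  by (simp add: extend_def sum_fun_apply vscale_def components_inner)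

text \<open>Near x the field X is a combination of coordinate fields whose coefficients come out of
  \<open>D\<close>; at x only the values of the coefficients remain.\<close>

lemma D_tensorial:
  assumes X: "X \<in> vector_fields A" and Y: "Y \<in> vector_fields A" and x: "x \<in> patch"
  shows "D X Y x = D (coord_field (components (X x))) Y x"
proof -
  have const: "D (vscale g (coord_field b)) Y = vscale g (D (coord_field b) Y)" if "g \<in> smooth_functions A" for g b
    by (rule D_vscale_left[OF that coord_field Y])
  have "D X Y x = D (extend X) Y x"
    by (rule D_local_left[OF X extend[OF X] Y open_patch x extend_patch[OF X]])
  also have "D (extend X) Y = (\<Sum>b\<in>Basis. vscale (\<lambda>y. X y (coord b)) (D (coord_field b) Y))"
    unfolding extend_def
    by (subst D_sum_left[OF vector_fields_vscale[OF coefficient_smooth[OF X] coord_field] Y])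
      (intro sum.cong refl const coefficient_smooth[OF X])
  also have "\<dots> x = (\<Sum>b\<in>Basis. tscale (components (X x) \<bullet> b) (D (coord_field b) Y x))"
    by (simp add: sum_fun_apply vscale_def components_inner)
  also have "\<dots> = D (coord_field (components (X x))) Y x"
  proof -
    have "coord_field (components (X x)) = (\<Sum>b\<in>Basis. vscale (\<lambda>_. components (X x) \<bullet> b) (coord_field b))"
      by (intro ext) (simp add: sum_fun_apply vscale_def coord_field_expand[of "components (X x)"])
    then have "D (coord_field (components (X x))) Y = (\<Sum>b\<in>Basis. vscale (\<lambda>_. components (X x) \<bullet> b) (D (coord_field b) Y))"
      by (simp only: D_sum_left[OF vector_fields_vscale[OF smooth_functions_const coord_field] Y]
          const[OF smooth_functions_const])
    then show ?thesis by (simp add: sum_fun_apply vscale_def)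
  qed
  finally show ?thesis .
qed

lemma christoffel_linear: "\<xi> \<in> ball \<xi>0 r \<Longrightarrow> linear (\<lambda>v. christoffel \<xi> v w)" "linear (\<lambda>w. christoffel \<xi> v w)"
proof -
  have 1: "D (vscale (\<lambda>_. c) (coord_field v)) (coord_field w) = vscale (\<lambda>_. c) (D (coord_field v) (coord_field w))" for c :: real and v w
    by (rule D_vscale_left) (auto intro: coord_field)
  show "linear (\<lambda>v. christoffel \<xi> v w)"
    by (auto intro!: linearI simp: christoffel_def coord_field_add coord_field_scaleR D_add_left coord_field
        1 components_add components_tscale vscale_def[of _ "D _ _"])
  have 0: "deriv_along (coord_field v) (\<lambda>_. c) = (\<lambda>_. 0)" for v and c :: real
    by (intro ext) (simp add: deriv_along_def tangent_const[OF coord_field_tangent])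
  have "vscale (\<lambda>_. 0) X = 0" for X :: "'a vector_field"
    by (intro ext) (simp add: vscale_def tscale_def)
  then have 2: "D (coord_field v) (vscale (\<lambda>_. c) (coord_field w)) = vscale (\<lambda>_. c) (D (coord_field v) (coord_field w))" for c :: real and v w
    using D_vscale_right[OF smooth_functions_const coord_field coord_field, of v c w] 0 by simp
  show "linear (\<lambda>w. christoffel \<xi> v w)"
    by (auto intro!: linearI simp: christoffel_def coord_field_add coord_field_scaleR D_add_right coord_field
        2 components_add components_tscale vscale_def[of _ "D _ _"])
qed

lemma smooth_christoffel: "smooth_on (ball \<xi>0 r) (\<lambda>\<xi>. christoffel \<xi> v w)"
  unfolding christoffel_def
  by (rule smooth_on_subset[OF components_smooth ball_sub]) (intro D_closed coord_field)

text \<open>Replace Y by \<open>extend Y\<close> near x. The Leibniz rule splits each summand: the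
  derivatives of the coefficients make up the derivative of the components, and the remaining terms
  add up to the Christoffel map by linearity.\<close>

lemma components_D:
  assumes X: "X \<in> vector_fields A" and Y: "Y \<in> vector_fields A" and x: "x \<in> patch"
  shows "components (D X Y x) = frechet_derivative (\<lambda>\<xi>. components (Y (\<theta> \<xi>))) (at (\<phi> x)) (components (X x))
    + christoffel (\<phi> x) (components (X x)) (components (Y x))"
proof -
  let ?v = "components (X x)"
  let ?y = "\<lambda>b y. Y y (coord b)"
  have y: "?y b \<in> smooth_functions A" for b by (rule vector_fieldsD(2)[OF Y coord_smooth])
  have "D X Y x = D (coord_field ?v) Y x" by (rule D_tensorial[OF X Y x])
  also have "\<dots> = D (coord_field ?v) (extend Y) x"
    by (rule D_local_right[OF coord_field Y extend[OF Y] open_patch x extend_patch[OF Y]])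
  finally have 1: "D X Y x = D (coord_field ?v) (extend Y) x" .
  have 2: "D (coord_field ?v) (extend Y) = (\<Sum>b\<in>Basis. vscale (deriv_along (coord_field ?v) (?y b)) (coord_field b)
      + vscale (?y b) (D (coord_field ?v) (coord_field b)))"
    unfolding extend_def
    by (subst D_sum_right[OF vector_fields_vscale[OF y coord_field] coord_field])
      (intro sum.cong refl D_vscale_right[OF y coord_field coord_field])
  have "components (D X Y x) = (\<Sum>b\<in>Basis. components ((vscale (deriv_along (coord_field ?v) (?y b)) (coord_field b)) x)
      + components (vscale (?y b) (D (coord_field ?v) (coord_field b)) x))"
    unfolding 1 2 sum_fun_apply components_sum plus_fun_apply components_add ..
  also have "\<dots> = (\<Sum>b\<in>Basis. frechet_derivative (\<lambda>\<xi>. ?y b (\<theta> \<xi>)) (at (\<phi> x)) ?v *\<^sub>R b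
      + (components (Y x) \<bullet> b) *\<^sub>R christoffel (\<phi> x) ?v b)"
    unfolding vscale_def components_tscale deriv_along_def christoffel_def
    by (intro sum.cong refl) (simp add: components_coord_field[OF x] coord_field_patch[OF x y] \<theta>_patch(3)[OF x] components_inner)
  also have "\<dots> = (\<Sum>b\<in>Basis. frechet_derivative (\<lambda>\<xi>. ?y b (\<theta> \<xi>)) (at (\<phi> x)) ?v *\<^sub>R b)
      + (\<Sum>b\<in>Basis. (components (Y x) \<bullet> b) *\<^sub>R christoffel (\<phi> x) ?v b)"
    by (rule sum.distrib)
  also have "(\<Sum>b\<in>Basis. (components (Y x) \<bullet> b) *\<^sub>R christoffel (\<phi> x) ?v b) = christoffel (\<phi> x) ?v (components (Y x))"
    by (rule linear_euclidean_expand[symmetric, OF christoffel_linear(2)])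
  also have "(\<Sum>b\<in>Basis. frechet_derivative (\<lambda>\<xi>. ?y b (\<theta> \<xi>)) (at (\<phi> x)) ?v *\<^sub>R b)
      = frechet_derivative (\<lambda>\<xi>. components (Y (\<theta> \<xi>))) (at (\<phi> x)) ?v"
  proof -
    have "((\<lambda>\<xi>. components (Y (\<theta> \<xi>))) has_derivative
        (\<lambda>v. \<Sum>b\<in>Basis. frechet_derivative (\<lambda>\<xi>. ?y b (\<theta> \<xi>)) (at (\<phi> x)) v *\<^sub>R b)) (at (\<phi> x))"
      unfolding components_def using x y
      by (intro has_derivative_sum has_derivative_scaleR_left local_derivative) (auto simp: patch_iff)
    from fun_cong[OF frechet_derivative_at[OF this], of ?v] show ?thesis by simp
  qed
  finally show ?thesis .
qed

text \<open>The negative Christoffel map as a bounded linear function. Written in constant basis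
  maps with scalar coefficients, it is visibly smooth as a map into the space of bounded linear
  functions.\<close>

definition omega :: "'e \<Rightarrow> 'e \<Rightarrow>\<^sub>L 'e \<Rightarrow>\<^sub>L 'e" where
  "omega \<xi> = (\<Sum>i\<in>Basis. \<Sum>j\<in>Basis. \<Sum>k\<in>Basis. (- (christoffel \<xi> i j \<bullet> k)) *\<^sub>R
     (blinfun_scaleR_left (blinfun_scaleR_left k o\<^sub>L blinfun_inner_left j) o\<^sub>L blinfun_inner_left i))"

lemma omega_apply:
  assumes "\<xi> \<in> ball \<xi>0 r"
  shows "omega \<xi> v w = - christoffel \<xi> v w"
proof -
  have "christoffel \<xi> v w = (\<Sum>i\<in>Basis. (v \<bullet> i) *\<^sub>R (\<Sum>j\<in>Basis. (w \<bullet> j) *\<^sub>R christoffel \<xi> i j))"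
    using linear_euclidean_expand[OF christoffel_linear(1)[OF assms], of v w]
      linear_euclidean_expand[OF christoffel_linear(2), of \<xi> _ w] by simp
  also have "\<dots> = (\<Sum>i\<in>Basis. \<Sum>j\<in>Basis. \<Sum>k\<in>Basis. (christoffel \<xi> i j \<bullet> k) *\<^sub>R (v \<bullet> i) *\<^sub>R (w \<bullet> j) *\<^sub>R k)"
  proof -
    have "(w \<bullet> j) *\<^sub>R christoffel \<xi> i j = (\<Sum>k\<in>Basis. (christoffel \<xi> i j \<bullet> k) *\<^sub>R (w \<bullet> j) *\<^sub>R k)" for i j
      by (subst (1) euclidean_representation[of "christoffel \<xi> i j", symmetric])
        (simp add: scaleR_sum_right mult.commute)
    then show ?thesis by (simp add: scaleR_sum_right mult_ac)
  qed
  finally show ?thesis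
    by (simp add: omega_def blinfun.sum_left blinfun.scaleR_left sum_negf blinfun.minus_left mult.assoc)
qed

lemma smooth_omega: "smooth_on (ball \<xi>0 r) omega"
proof -
  have "smooth_on (ball \<xi>0 r) (\<lambda>\<xi>. - (christoffel \<xi> i j \<bullet> k))" for i j k
    using smooth_on_diff[OF open_ball smooth_on_const[of _ 0]
        smooth_on_inner[OF open_ball smooth_christoffel smooth_on_const]] by simp
  then show ?thesis
    unfolding omega_def[abs_def] by (intro smooth_on_sum smooth_on_scaleR smooth_on_const open_ball)
qed

lemma frechet_omega:
  assumes "\<xi> \<in> ball \<xi>0 r"
  shows "frechet_derivative omega (at \<xi>) u v w = - frechet_derivative (\<lambda>\<xi>. christoffel \<xi> v w) (at \<xi>) u"
proof -
  have "((\<lambda>\<xi>. omega \<xi> v w) has_derivative (\<lambda>u. frechet_derivative omega (at \<xi>) u v w)) (at \<xi>)"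
    by (rule bounded_linear.has_derivative[OF blinfun.bounded_linear_left
          bounded_linear.has_derivative[OF blinfun.bounded_linear_left smooth_on_has_derivative[OF smooth_omega assms]]])
  then have "((\<lambda>\<xi>. - christoffel \<xi> v w) has_derivative (\<lambda>u. frechet_derivative omega (at \<xi>) u v w)) (at \<xi>)"
    by (rule has_derivative_transform_within_open[of _ _ _ _ "ball \<xi>0 r"]) (use assms omega_apply in auto)
  from has_derivative_minus[OF this]
  have "((\<lambda>\<xi>. christoffel \<xi> v w) has_derivative (\<lambda>u. - frechet_derivative omega (at \<xi>) u v w)) (at \<xi>)" by simp
  from fun_cong[OF frechet_derivative_at[OF this], of u]
  have "- frechet_derivative omega (at \<xi>) u v w = frechet_derivative (\<lambda>\<xi>. christoffel \<xi> v w) (at \<xi>) u"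
    by blast
  from this[symmetric] show ?thesis by simp
qed

end

section \<open>The radial vector field\<close>

context connection_chart
begin

text \<open>Bootstrapping: the equation expresses the derivative of h by h and the smooth
  \<open>omega\<close>, so h gains one order of differentiability with each use.\<close>

lemma solution_smooth:
  assumes B: "open B" "B \<subseteq> ball \<xi>0 r"
    and h: "\<And>\<xi>. \<xi> \<in> B \<Longrightarrow> (h has_derivative (\<lambda>v. v + omega \<xi> v (h \<xi>))) (at \<xi>)"
  shows "smooth_on B h"
proof (rule smooth_onI)
  show "Ck_on k B h" for k
  proof (induction k)
    case 0
    show ?case
      using has_derivative_continuous[OF h] B(1) by (simp add: continuous_on_eq_continuous_at)
  next
    case (Suc k)
    have "Ck_on k B omega" using smooth_onD[OF smooth_omega] B(2) by (rule Ck_on_subset)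
    then have "Ck_on k B (\<lambda>\<xi>. omega \<xi> v (h \<xi>))" for v
      by (intro bounded_bilinear_Ck_on[OF bounded_bilinear_blinfun_apply B(1)
            bounded_bilinear_Ck_on[OF bounded_bilinear_blinfun_apply B(1)] Suc] Ck_on_const)
    then show ?case
      by (intro Ck_on_SucI[OF B(1) h] Ck_on_add[OF B(1) Ck_on_const])
  qed
qed

text \<open>One radius and one constant serve for all centres near \<xi>0. This uniformity is needed
  because initial values will be prescribed at every point of a neighbourhood.\<close>

lemma affine_system_near:
  obtains \<rho>0 C where "\<rho>0 > 0" "\<rho>0 \<le> r / 2"
    "\<And>\<eta> \<rho>. \<eta> \<in> ball \<xi>0 \<rho>0 \<Longrightarrow> 0 < \<rho> \<Longrightarrow> \<rho> \<le> \<rho>0 \<Longrightarrow> affine_total_system \<eta> \<rho> C omega \<and> ball \<eta> \<rho> \<subseteq> ball \<xi>0 r"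
proof -
  have sub: "cball \<xi>0 (r / 2) \<subseteq> ball \<xi>0 r" using r by auto
  have "compact (omega ` cball \<xi>0 (r / 2))"
    by (rule compact_continuous_image[OF continuous_on_subset[OF smooth_on_continuous[OF smooth_omega] sub]]) simp
  then obtain C where C: "C > 0" "\<And>\<xi>. \<xi> \<in> cball \<xi>0 (r / 2) \<Longrightarrow> norm (omega \<xi>) \<le> C"
    using compact_imp_bounded bounded_pos by (metis imageI)
  define \<rho>0 where "\<rho>0 = min (r / 4) (1 / (2 * C))"
  show thesis
  proof (rule that[of \<rho>0 C])
    show "\<rho>0 > 0" "\<rho>0 \<le> r / 2" using C r by (auto simp: \<rho>0_def)
    fix \<eta> \<rho> assume \<eta>: "\<eta> \<in> ball \<xi>0 \<rho>0" and \<rho>: "0 < \<rho>" "\<rho> \<le> \<rho>0"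
    have "\<rho>0 + \<rho> \<le> r / 2" using \<rho> by (auto simp: \<rho>0_def)
    then have b: "ball \<eta> \<rho> \<subseteq> cball \<xi>0 (r / 2)"
    proof (intro subsetI)
      fix \<zeta> assume "\<zeta> \<in> ball \<eta> \<rho>"
      then have "dist \<xi>0 \<zeta> \<le> \<rho>0 + \<rho>" using \<eta> dist_triangle[of \<xi>0 \<zeta> \<eta>] by auto
      then show "\<zeta> \<in> cball \<xi>0 (r / 2)" using \<open>\<rho>0 + \<rho> \<le> r / 2\<close> by simp
    qed
    have "affine_total_system \<eta> \<rho> C omega"
    proof
      show "\<rho> > 0" by fact
      show "C \<ge> 0" using C by simp
      have "C * \<rho> \<le> C * (1 / (2 * C))" using \<rho> C by (intro mult_left_mono) (auto simp: \<rho>0_def)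
      then show "C * \<rho> \<le> 1 / 2" using C by simp
      show "Ck_on (Suc 0) (ball \<eta> \<rho>) omega"
        using b sub by (intro smooth_onD smooth_on_subset[OF smooth_omega]) auto
      fix x v z assume "x \<in> ball \<eta> \<rho>"
      then have "norm (omega x) \<le> C" using b C by blast
      have "norm (omega x v z) \<le> norm (omega x v) * norm z" by (rule norm_blinfun)
      also have "\<dots> \<le> (norm (omega x) * norm v) * norm z" by (intro mult_right_mono norm_blinfun) simp
      also have "\<dots> \<le> C * norm v * norm z" using \<open>norm (omega x) \<le> C\<close> by (intro mult_right_mono) auto
      finally show "norm (omega x v z) \<le> C * norm v * norm z" .
    qed
    then show "affine_total_system \<eta> \<rho> C omega \<and> ball \<eta> \<rho> \<subseteq> ball \<xi>0 r" using b sub by blast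
  qed
qed

text \<open>By \<open>components_D\<close> both sides say that the derivative of the components in
  direction v plus the Christoffel term is v; coordinate fields realise every v.\<close>

lemma radial_field_equation:
  assumes S: "S \<in> vector_fields A" and x: "x \<in> patch"
  shows "(\<forall>X\<in>vector_fields A. D X S x = X x) \<longleftrightarrow>
    ((\<lambda>\<xi>. components (S (\<theta> \<xi>))) has_derivative (\<lambda>v. v + omega (\<phi> x) v (components (S x)))) (at (\<phi> x))"
    (is "?L \<longleftrightarrow> (?S has_derivative ?S') _")
proof -
  have \<phi>x: "\<phi> x \<in> ball \<xi>0 r" using x by (simp add: patch_iff)
  have "(?S has_derivative frechet_derivative ?S (at (\<phi> x))) (at (\<phi> x))"
    using smooth_on_has_derivative[OF components_smooth[OF S]] \<phi>x ball_sub by blast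
  then have "(?S has_derivative ?S') (at (\<phi> x)) \<longleftrightarrow> frechet_derivative ?S (at (\<phi> x)) = ?S'"
    by (auto dest: frechet_derivative_at[symmetric])
  also have "\<dots> \<longleftrightarrow> (\<forall>v. frechet_derivative ?S (at (\<phi> x)) v + christoffel (\<phi> x) v (components (S x)) = v)"
    using omega_apply[OF \<phi>x] by (auto simp: fun_eq_iff algebra_simps)
  also have "\<dots> \<longleftrightarrow> ?L"
  proof safe
    fix X assume *: "\<forall>v. frechet_derivative ?S (at (\<phi> x)) v + christoffel (\<phi> x) v (components (S x)) = v"
      and X: "X \<in> vector_fields A"
    show "D X S x = X x"
      by (rule tangent_eqI[OF x]) (use components_D[OF X S x] * vector_fieldsD D_closed X S in auto)
  next
    fix v assume ?L
    then have "D (coord_field v) S x = coord_field v x" using coord_field by blast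
    then show "frechet_derivative ?S (at (\<phi> x)) v + christoffel (\<phi> x) v (components (S x)) = v"
      using components_D[OF coord_field S x, of v] components_coord_field[OF x] by metis
  qed
  finally show ?thesis by blast
qed

end

section \<open>Vanishing torsion and curvature in a chart\<close>

locale flat_manifold = connection_manifold A D
  for A :: "('a::{t2_space, second_countable_topology}, 'e::euclidean_space) atlas" and D +
  assumes torsion_free: "torsion_free A D" and flat_connection: "flat_connection A D"

locale flat_chart = flat_manifold A D + connection_chart A D U \<phi> \<xi>0 r R \<beta>
  for A :: "('a::{t2_space, second_countable_topology}, 'e::euclidean_space) atlas" and D U \<phi> \<xi>0 r R \<beta>
begin

text \<open>On the patch a coordinate field takes a constant value on each coordinate, and
  derivations kill constants.\<close>

lemma bracket_coord_field:
  assumes x: "x \<in> patch"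
  shows "components (lie_bracket (coord_field v) (coord_field w) x) = 0"
proof -
  have "coord_field v x (\<lambda>y. coord_field w y (coord b)) = 0" if b: "b \<in> Basis" for v w b
  proof -
    have "coord_field v x (\<lambda>y. coord_field w y (coord b)) = coord_field v x (\<lambda>_. w \<bullet> b)"
      using components_coord_field components_inner[OF b]
      by (intro tangent_local[OF coord_field_tangent vector_fieldsD(2)[OF coord_field coord_smooth]
            smooth_functions_const open_patch x]) metis
    then show ?thesis by (simp add: tangent_const[OF coord_field_tangent])
  qed
  then show ?thesis by (simp add: components_def lie_bracket_def deriv_along_def)
qed

lemma bracket_eq:
  "lie_bracket (coord_field v) (coord_field w) = D (coord_field v) (coord_field w) - D (coord_field w) (coord_field v)"
  using torsion_free coord_field unfolding torsion_free_def by metis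

lemma bracket_field: "lie_bracket (coord_field v) (coord_field w) \<in> vector_fields A"
  unfolding bracket_eq by (intro vector_fields_diff D_closed coord_field)

lemma bracket_zero: "x \<in> patch \<Longrightarrow> lie_bracket (coord_field v) (coord_field w) x = 0"
  by (rule tangent_eqI[OF _ vector_fieldsD(1)[OF bracket_field] tangent_space_zero])
    (simp_all only: bracket_coord_field components_zero)

lemma components_diff: "components (u - u') = components u - components u'"
  using components_add[of "u - u'" u'] by simp

lemma christoffel_sym:
  assumes "\<xi> \<in> ball \<xi>0 r"
  shows "christoffel \<xi> v w = christoffel \<xi> w v"
  using bracket_coord_field[OF \<theta>_patch(1)[OF assms], of v w]
  by (simp add: bracket_eq components_diff christoffel_def)

text \<open>Vanishing curvature evaluated on coordinate fields. Their bracket is known to vanish on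
  the patch only, because of the cut-off, so locality in the first argument is what removes the
  bracket term.\<close>

lemma christoffel_flat:
  assumes \<xi>: "\<xi> \<in> ball \<xi>0 r"
  shows "frechet_derivative (\<lambda>\<xi>. christoffel \<xi> v w) (at \<xi>) u + christoffel \<xi> u (christoffel \<xi> v w)
    = frechet_derivative (\<lambda>\<xi>. christoffel \<xi> u w) (at \<xi>) v + christoffel \<xi> v (christoffel \<xi> u w)"
proof -
  let ?E = coord_field and ?x = "\<theta> \<xi>"
  have x: "?x \<in> patch" by (rule \<theta>_patch(1)[OF \<xi>])
  have "D (lie_bracket (?E u) (?E v)) (?E w) ?x = D 0 (?E w) ?x"
    by (rule D_local_left[OF bracket_field vector_fields_zero coord_field open_patch x])
      (simp add: bracket_zero)
  then have "D (lie_bracket (?E u) (?E v)) (?E w) ?x = 0"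
    by (simp only: D_zero_left[OF coord_field] zero_fun_apply)
  moreover have "(D (?E u) (D (?E v) (?E w)) - D (?E v) (D (?E u) (?E w)) - D (lie_bracket (?E u) (?E v)) (?E w)) ?x = 0"
    using flat_connection coord_field unfolding flat_connection_def by (metis zero_fun_apply)
  ultimately have "D (?E u) (D (?E v) (?E w)) ?x = D (?E v) (D (?E u) (?E w)) ?x"
    by (simp only: minus_apply diff_zero right_minus_eq)
  moreover have "components (D (?E u) (D (?E v) (?E w)) ?x) =
      frechet_derivative (\<lambda>\<xi>. christoffel \<xi> v w) (at \<xi>) u + christoffel \<xi> u (christoffel \<xi> v w)" for u v
    using components_D[OF coord_field D_closed[OF coord_field coord_field] x, of u v w]
    by (simp add: components_coord_field[OF x] christoffel_def[abs_def] \<theta>_patch(2)[OF \<xi>])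
  ultimately show ?thesis by metis
qed

text \<open>As \<open>omega\<close> is minus the Christoffel map, the derivative terms carry one
  sign and the quadratic terms two; the curvature identity thus becomes \<open>flat\<close>.\<close>

lemma flat_affine_system:
  assumes "affine_total_system \<eta> \<rho> C omega" "ball \<eta> \<rho> \<subseteq> ball \<xi>0 r"
  shows "flat_affine_total_system \<eta> \<rho> C omega"
proof -
  interpret affine_total_system \<eta> \<rho> C omega by fact
  show ?thesis
  proof
    fix x v w z assume "x \<in> ball \<eta> \<rho>"
    then have x: "x \<in> ball \<xi>0 r" using assms(2) by blast
    show "omega x v w = omega x w v" by (simp only: omega_apply[OF x] christoffel_sym[OF x, of v w])
    show "frechet_derivative omega (at x) w v z + omega x v (omega x w z) =
        frechet_derivative omega (at x) v w z + omega x w (omega x v z)"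
      using christoffel_flat[OF x, of v z w] linear_neg[OF christoffel_linear(2)]
      by (simp add: omega_apply[OF x] frechet_omega[OF x]) (simp add: algebra_simps add_eq_0_iff neg_eq_iff_add_eq_0)
  qed
qed

end

section \<open>The sheaf of local radial fields and its global section\<close>

context flat_manifold
begin

text \<open>Since \<open>D\<close> acts on global fields, the equation is imposed on global fields S
  that represent s near the points of V; S may change from point to point.\<close>

definition radial_section :: "'a set \<Rightarrow> 'a vector_field \<Rightarrow> bool" where
  "radial_section V s \<longleftrightarrow> open V \<and> (\<forall>x\<in>V. \<exists>S\<in>vector_fields A. \<exists>W. open W \<and> x \<in> W \<and>
     (\<forall>y\<in>W. s y = S y \<and> (\<forall>X\<in>vector_fields A. D X S y = X y)))"

lemma flat_chart_at:
  obtains U \<phi> \<xi>0 r R \<beta> where "flat_chart A D U \<phi> \<xi>0 r R \<beta>" "x \<in> U" "\<phi> x = \<xi>0"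
proof -
  obtain U \<phi> \<xi>0 r R \<beta> where c: "cutoff_chart A U \<phi> \<xi>0 r R \<beta>" "x \<in> U" "\<phi> x = \<xi>0" by (rule cutoff_chart_at)
  interpret cutoff_chart A U \<phi> \<xi>0 r R \<beta> by fact
  have "flat_chart A D U \<phi> \<xi>0 r R \<beta>" by unfold_locales
  with c show ?thesis using that by blast
qed

text \<open>In coordinates the inhomogeneous term cancels in the difference, which solves the
  homogeneous equation with value 0 at x and so vanishes on a ball.\<close>

lemma radial_sections_agree:
  assumes s: "radial_section V s" "x \<in> V" and t: "radial_section V' t" "x \<in> V'" and eq: "s x = t x"
  shows "\<exists>W. open W \<and> x \<in> W \<and> (\<forall>y\<in>W. s y = t y)"
proof -
  obtain S W where S: "S \<in> vector_fields A" "open W" "x \<in> W" "\<And>y. y \<in> W \<Longrightarrow> s y = S y"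
    "\<And>y. y \<in> W \<Longrightarrow> \<forall>X\<in>vector_fields A. D X S y = X y"
    using s unfolding radial_section_def by metis
  obtain T W' where T: "T \<in> vector_fields A" "open W'" "x \<in> W'" "\<And>y. y \<in> W' \<Longrightarrow> t y = T y"
    "\<And>y. y \<in> W' \<Longrightarrow> \<forall>X\<in>vector_fields A. D X T y = X y"
    using t unfolding radial_section_def by metis
  obtain U \<phi> \<xi>0 r R \<beta> where c: "flat_chart A D U \<phi> \<xi>0 r R \<beta>" "x \<in> U" "\<phi> x = \<xi>0" by (rule flat_chart_at)
  interpret flat_chart A D U \<phi> \<xi>0 r R \<beta> by fact
  obtain \<rho>0 C where \<rho>0: "\<rho>0 > 0"
    "\<And>\<eta> \<rho>. \<eta> \<in> ball \<xi>0 \<rho>0 \<Longrightarrow> 0 < \<rho> \<Longrightarrow> \<rho> \<le> \<rho>0 \<Longrightarrow> affine_total_system \<eta> \<rho> C omega \<and> ball \<eta> \<rho> \<subseteq> ball \<xi>0 r"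
    by (rule affine_system_near) blast
  have "x \<in> patch" using c(2,3) r(1) by (simp add: patch_iff)
  have "open (\<phi> ` (U \<inter> (W \<inter> W')))" by (rule chart_open_image[OF U open_Int[OF S(2) T(2)]])
  moreover have "\<xi>0 \<in> \<phi> ` (U \<inter> (W \<inter> W'))" using c S T by blast
  ultimately obtain \<epsilon> where \<epsilon>: "\<epsilon> > 0" "ball \<xi>0 \<epsilon> \<subseteq> \<phi> ` (U \<inter> (W \<inter> W'))" by (rule openE)
  define \<rho> where "\<rho> = min \<epsilon> \<rho>0"
  have \<rho>: "0 < \<rho>" "\<rho> \<le> \<rho>0" "ball \<xi>0 \<rho> \<subseteq> \<phi> ` (U \<inter> (W \<inter> W'))" using \<epsilon> \<rho>0(1) by (auto simp: \<rho>_def)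
  have sys: "affine_total_system \<xi>0 \<rho> C omega" "ball \<xi>0 \<rho> \<subseteq> ball \<xi>0 r"
    using \<rho>0(2)[of \<xi>0 \<rho>] \<rho>0(1) \<rho> by auto
  define z where "z \<xi> = components (S (\<theta> \<xi>)) - components (T (\<theta> \<xi>))" for \<xi>
  have z: "(z has_derivative (\<lambda>v. omega \<xi> v (z \<xi>))) (at \<xi>)" if \<xi>: "\<xi> \<in> ball \<xi>0 \<rho>" for \<xi>
  proof -
    have p: "\<theta> \<xi> \<in> patch" "\<phi> (\<theta> \<xi>) = \<xi>" using \<theta>_patch \<xi> sys(2) by blast+
    have w: "\<theta> \<xi> \<in> W" "\<theta> \<xi> \<in> W'" using \<xi> \<rho>(3) chart_inverse(1)[OF U] by auto
    have "((\<lambda>\<xi>. components (S (\<theta> \<xi>))) has_derivative (\<lambda>v. v + omega \<xi> v (components (S (\<theta> \<xi>))))) (at \<xi>)"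
      "((\<lambda>\<xi>. components (T (\<theta> \<xi>))) has_derivative (\<lambda>v. v + omega \<xi> v (components (T (\<theta> \<xi>))))) (at \<xi>)"
      using radial_field_equation[OF S(1) p(1)] radial_field_equation[OF T(1) p(1)] S(5)[OF w(1)] T(5)[OF w(2)] p(2)
      by auto
    from has_derivative_diff[OF this] show ?thesis
      by (simp add: z_def[abs_def] blinfun.diff_right)
  qed
  have "S x = T x" using S T eq by metis
  then have "z \<xi>0 = 0" using c(3) \<theta>_patch(3)[OF \<open>x \<in> patch\<close>] by (simp add: z_def)
  then have z0: "z \<xi> = 0" if "\<xi> \<in> ball \<xi>0 \<rho>" for \<xi>
    using affine_total_system.solution_unique_homogeneous[OF sys(1), of z] z that by blast
  let ?N = "(U \<inter> \<phi> -` ball \<xi>0 \<rho>) \<inter> (W \<inter> W')"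
  have "open ?N" by (intro open_Int S T chart_open_vimage[OF U open_ball])
  moreover have "x \<in> ?N" using c \<rho>(1) S T by simp
  moreover have "s y = t y" if y: "y \<in> ?N" for y
  proof -
    have "y \<in> patch" using y sys(2) by (auto simp: patch_def)
    then have "components (S y) = components (T y)" using z0[of "\<phi> y"] y \<theta>_patch(3) by (simp add: z_def)
    then have "S y = T y"
      using tangent_eqI[OF \<open>y \<in> patch\<close>] vector_fieldsD(1) S(1) T(1) by blast
    then show ?thesis using y S(4) T(4) by simp
  qed
  ultimately show ?thesis by blast
qed

text \<open>Different tangent vectors are separated by some smooth function f, and S f - T f is
  continuous, so it stays nonzero nearby.\<close>

lemma radial_sections_differ:
  assumes s: "radial_section V s" "x \<in> V" and t: "radial_section V' t" "x \<in> V'" and neq: "s x \<noteq> t x"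
  shows "\<exists>W. open W \<and> x \<in> W \<and> (\<forall>y\<in>W. s y \<noteq> t y)"
proof -
  obtain S W where S: "S \<in> vector_fields A" "open W" "x \<in> W" "\<And>y. y \<in> W \<Longrightarrow> s y = S y"
    using s unfolding radial_section_def by metis
  obtain T W' where T: "T \<in> vector_fields A" "open W'" "x \<in> W'" "\<And>y. y \<in> W' \<Longrightarrow> t y = T y"
    using t unfolding radial_section_def by metis
  have "S x \<noteq> T x" using neq S T by metis
  then obtain f where f: "S x f \<noteq> T x f" by blast
  then have f': "f \<in> smooth_functions A"
    using tangent_outside[OF vector_fieldsD(1)[OF S(1)], of f x] tangent_outside[OF vector_fieldsD(1)[OF T(1)], of f x]
    by metis
  have "continuous_on UNIV (\<lambda>y. S y f - T y f)"
    by (rule smooth_functions_continuous[OF smooth_functions_diff[OF vector_fieldsD(2)[OF S(1) f'] vector_fieldsD(2)[OF T(1) f']]])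
  then have "open ((\<lambda>y. S y f - T y f) -` (- {0}))" by (intro open_vimage) auto
  then have "open ((\<lambda>y. S y f - T y f) -` (- {0}) \<inter> (W \<inter> W'))" using S T by blast
  moreover have "x \<in> (\<lambda>y. S y f - T y f) -` (- {0}) \<inter> (W \<inter> W')" using f S T by simp
  moreover have "s y \<noteq> t y" if "y \<in> (\<lambda>y. S y f - T y f) -` (- {0}) \<inter> (W \<inter> W')" for y
    using that S(4) T(4) by auto
  ultimately show ?thesis by blast
qed

text \<open>The affine system is centred at the point where the value is prescribed, not at the
  centre of the chart.\<close>

lemma radial_sections_local:
  "\<exists>N. open N \<and> x0 \<in> N \<and> path_connected N \<and>
     (\<forall>y\<in>N. \<forall>c\<in>tangent_space A y. \<exists>s. radial_section N s \<and> s y = c)"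
proof -
  obtain U \<phi> \<xi>0 r R \<beta> where c: "flat_chart A D U \<phi> \<xi>0 r R \<beta>" "x0 \<in> U" "\<phi> x0 = \<xi>0" by (rule flat_chart_at)
  interpret flat_chart A D U \<phi> \<xi>0 r R \<beta> by fact
  obtain \<rho>0 C where \<rho>0: "\<rho>0 > 0" "\<rho>0 \<le> r / 2"
    "\<And>\<eta> \<rho>. \<eta> \<in> ball \<xi>0 \<rho>0 \<Longrightarrow> 0 < \<rho> \<Longrightarrow> \<rho> \<le> \<rho>0 \<Longrightarrow> affine_total_system \<eta> \<rho> C omega \<and> ball \<eta> \<rho> \<subseteq> ball \<xi>0 r"
    by (rule affine_system_near) blast
  \<comment> \<open>Half the radius: a ball of radius \<rho>0 around any point of this one covers
    it, so every solution is defined on all of N.\<close>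
  let ?B = "ball \<xi>0 (\<rho>0 / 2)"
  define N where "N = U \<inter> \<phi> -` ?B"
  have B: "?B \<subseteq> ball \<xi>0 r" using \<rho>0 r by auto
  then have BU: "?B \<subseteq> \<phi> ` U" using ball_sub by blast
  have N: "open N" "x0 \<in> N" "N \<subseteq> patch"
    using chart_open_vimage[OF U open_ball] c \<rho>0(1) B by (auto simp: N_def patch_def)
  have "N = \<theta> ` ?B"
    using chart_inverse[OF U] BU by (force simp: N_def)
  moreover have "continuous_on ?B \<theta>"
    by (rule continuous_on_subset[OF _ BU]) (use chart(3)[OF U] in \<open>simp add: homeomorphism_def\<close>)
  ultimately have "path_connected N"
    using path_connected_continuous_image convex_imp_path_connected convex_ball by metis
  moreover have "\<exists>s. radial_section N s \<and> s y = u" if y: "y \<in> N" and u: "u \<in> tangent_space A y" for y u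
  proof -
    define \<eta> where "\<eta> = \<phi> y"
    have \<eta>: "\<eta> \<in> ?B" using y by (simp add: N_def \<eta>_def)
    have "affine_total_system \<eta> \<rho>0 C omega" "ball \<eta> \<rho>0 \<subseteq> ball \<xi>0 r" using \<rho>0(3)[of \<eta> \<rho>0] \<rho>0(1) \<eta> by auto
    from flat_affine_system[OF this] interpret sys: flat_affine_total_system \<eta> \<rho>0 C omega .
    obtain h where h: "h \<eta> = components u"
      "\<And>\<xi>. \<xi> \<in> ball \<eta> \<rho>0 \<Longrightarrow> (h has_derivative (\<lambda>v. v + omega \<xi> v (h \<xi>))) (at \<xi>)"
      by (rule sys.solution_exists) blast
    have "?B \<subseteq> ball \<eta> \<rho>0"
    proof
      fix \<zeta> assume "\<zeta> \<in> ?B"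
      then show "\<zeta> \<in> ball \<eta> \<rho>0" using \<eta> dist_triangle[of \<eta> \<zeta> \<xi>0] by (simp add: dist_commute)
    qed
    then have hB: "(h has_derivative (\<lambda>v. v + omega \<xi> v (h \<xi>))) (at \<xi>)" if "\<xi> \<in> ?B" for \<xi>
      using h(2) that by blast
    have sh: "smooth_on ?B (\<lambda>\<xi>. h \<xi> \<bullet> b)" for b
      by (intro smooth_on_inner solution_smooth[OF open_ball B hB] smooth_on_const open_ball)
    define s where "s z = coord_field (h (\<phi> z)) z" for z
    have "radial_section N s"
      unfolding radial_section_def
    proof (intro conjI ballI)
      fix x assume x: "x \<in> N"
      \<comment> \<open>s is controlled on N only; around x its coefficients are replaced by global
        functions with the same germs, from which a global field is built.\<close>
      have "\<exists>g M. g \<in> smooth_functions A \<and> open M \<and> x \<in> M \<and> (\<forall>z\<in>M. g z = h (\<phi> z) \<bullet> b)" for b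
      proof -
        have xx: "x \<in> U" "\<phi> x \<in> ?B" using x by (auto simp: N_def)
        from smooth_extension[OF U xx(1) open_ball BU xx(2) sh[of b]] show ?thesis by metis
      qed
      then obtain g M where g: "\<And>b. g b \<in> smooth_functions A" "\<And>b. open (M b)" "\<And>b. x \<in> M b"
        "\<And>b z. z \<in> M b \<Longrightarrow> g b z = h (\<phi> z) \<bullet> b" by metis
      define S where "S = (\<Sum>b\<in>Basis. vscale (g b) (coord_field b))"
      define W where "W = N \<inter> (\<Inter>b\<in>Basis. M b)"
      have S: "S \<in> vector_fields A" unfolding S_def by (intro vector_fields_sum vector_fields_vscale g coord_field)
      have W: "open W" "x \<in> W" unfolding W_def using N x g by (auto intro!: open_Int open_INT)
      have Ss: "S z = s z" if "z \<in> W" for z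
        using that g(4) by (simp add: S_def s_def sum_fun_apply vscale_def W_def coord_field_expand[of "h (\<phi> z)"])
      have "D X S z = X z" if X: "X \<in> vector_fields A" and z: "z \<in> W" for X z
      proof -
        have zp: "z \<in> patch" "z \<in> U" "\<phi> z \<in> ?B" using z N(3) by (auto simp: W_def N_def)
        have o: "open (\<phi> ` (U \<inter> W))" by (rule chart_open_image[OF U W(1)])
        have eq: "components (S w) = h (\<phi> w)" if "w \<in> W" for w
          using Ss[OF that] components_coord_field that N(3) by (auto simp: s_def W_def)
        have "((\<lambda>\<xi>. components (S (\<theta> \<xi>))) has_derivative (\<lambda>v. v + omega (\<phi> z) v (h (\<phi> z)))) (at (\<phi> z))"
          by (rule has_derivative_transform_within_open[OF hB[OF zp(3)] o])
            (use z zp eq chart_inverse(1)[OF U] in auto)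
        then show ?thesis
          using radial_field_equation[OF S zp(1)] eq[OF z] X by metis
      qed
      with S W Ss show "\<exists>S\<in>vector_fields A. \<exists>W. open W \<and> x \<in> W \<and>
          (\<forall>y\<in>W. s y = S y \<and> (\<forall>X\<in>vector_fields A. D X S y = X y))" by metis
    qed (rule N)
    moreover have "s y = u"
      using tangent_representation[OF _ u] y N(3) h(1) by (auto simp: s_def \<eta>_def)
    ultimately show ?thesis by blast
  qed
  ultimately show ?thesis using N by blast
qed

theorem radial_field_exists:
  assumes "simply_connected (UNIV :: 'a set)"
  obtains H where "H \<in> vector_fields A" "\<And>X. X \<in> vector_fields A \<Longrightarrow> D X H = X"
proof -
  interpret locally_constant_sheaf radial_section "tangent_space A"
  proof
    fix V s x assume "radial_section V s" "x \<in> V"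
    then show "s x \<in> tangent_space A x" unfolding radial_section_def using vector_fieldsD(1) by metis
  qed (use radial_sections_agree radial_sections_differ radial_sections_local in \<open>auto simp: radial_section_def\<close>)
  \<comment> \<open>Any initial value would do, since every tangent vector lies on a local section;
    the zero vector is taken.\<close>
  obtain H where H: "\<And>x. \<exists>N s. radial_section N s \<and> x \<in> N \<and> (\<forall>y\<in>N. H y = s y)"
    using global_section_exists[OF assms tangent_space_zero] by metis
  have loc: "\<exists>S\<in>vector_fields A. \<exists>W. open W \<and> x \<in> W \<and> (\<forall>y\<in>W. H y = S y \<and> (\<forall>X\<in>vector_fields A. D X S y = X y))" for x
  proof -
    obtain N s where N: "radial_section N s" "x \<in> N" "\<And>y. y \<in> N \<Longrightarrow> H y = s y" using H by metis
    then obtain S W where "open N" "S \<in> vector_fields A" "open W" "x \<in> W"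
      "\<And>y. y \<in> W \<Longrightarrow> s y = S y \<and> (\<forall>X\<in>vector_fields A. D X S y = X y)"
      unfolding radial_section_def by metis
    with N show ?thesis by (intro bexI[of _ S] exI[of _ "N \<inter> W"]) auto
  qed
  have "H \<in> vector_fields A"
    unfolding vector_fields_def deriv_along_def
  proof (intro CollectI conjI allI ballI)
    show "H x \<in> tangent_space A x" for x using loc[of x] vector_fieldsD(1) by metis
    fix f assume f: "f \<in> smooth_functions A"
    show "(\<lambda>x. H x f) \<in> smooth_functions A"
    proof (rule smooth_functions_local)
      fix x
      obtain S W where "S \<in> vector_fields A" "open W" "x \<in> W" "\<And>y. y \<in> W \<Longrightarrow> H y = S y" using loc[of x] by metis
      then show "\<exists>g\<in>smooth_functions A. \<exists>N. open N \<and> x \<in> N \<and> (\<forall>y\<in>N. H y f = g y)"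
        using vector_fieldsD(2)[OF _ f, of S] by (intro bexI[of _ "\<lambda>x. S x f"] exI[of _ W]) auto
    qed
  qed
  moreover have "D X H = X" if X: "X \<in> vector_fields A" for X
  proof
    fix x
    obtain S W where S: "S \<in> vector_fields A" "open W" "x \<in> W" "\<And>y. y \<in> W \<Longrightarrow> H y = S y" "D X S x = X x"
      using loc[of x] X by metis
    show "D X H x = X x"
      using D_local_right[OF X \<open>H \<in> vector_fields A\<close> S(1-3)] S(4,5) by simp
  qed
  ultimately show ?thesis using that by blast
qed

end

section \<open>Primitives of parallel forms\<close>

lemma fun_power_apply: "(f ^ n) x = f x ^ n" for f :: "'a \<Rightarrow> 'b::monoid_mult"
  by (induction n) auto

lemma tuples_update: "xs \<in> tuples S q \<Longrightarrow> a \<in> S \<Longrightarrow> xs[i := a] \<in> tuples S q"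
  unfolding tuples_def using set_update_subset_insert[of xs i a] by auto

lemma tuples_nth: "xs \<in> tuples S q \<Longrightarrow> i < q \<Longrightarrow> xs ! i \<in> S"
  unfolding tuples_def by (auto simp: subset_iff)

lemma tuples_Cons: "x # xs \<in> tuples S (Suc q) \<longleftrightarrow> x \<in> S \<and> xs \<in> tuples S q"
  unfolding tuples_def by auto

lemma length_omit: "j < length xs \<Longrightarrow> length (omit j xs) = length xs - 1"
  by (simp add: omit_def)

lemma omit_nth:
  "j < length xs \<Longrightarrow> i < length xs - 1 \<Longrightarrow> omit j xs ! i = xs ! (if i < j then i else Suc i)"
  by (auto simp: omit_def nth_append)

lemma omit_tuples:
  assumes "xs \<in> tuples S (Suc q)" "j \<le> q"
  shows "omit j xs \<in> tuples S q"
  using assms set_take_subset[of j xs] set_drop_subset[of "Suc j" xs] by (auto simp: omit_def tuples_def)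

lemma omit_update:
  assumes "j < length xs" "i < length xs - 1"
  shows "omit j (xs[(if i < j then i else Suc i) := a]) = (omit j xs)[i := a]"
  using assms by (intro nth_equalityI) (auto simp: length_omit omit_nth nth_list_update)

text \<open>Deleting position j shifts the later positions by one. After this renumbering the inner
  sum of the coboundary runs over all arguments of the shortened list, as in the covariant
  derivative of a form.\<close>

lemma sum_omit_update:
  assumes "length xs = Suc q" "j \<le> q"
  shows "(\<Sum>i\<in>{..q} - {j}. F (omit j (xs[i := h (xs ! i)]))) = (\<Sum>i<q. F ((omit j xs)[i := h (omit j xs ! i)]))"
proof -
  let ?\<sigma> = "\<lambda>i. if i < j then i else Suc i"
  have "(\<Sum>i\<in>{..q} - {j}. F (omit j (xs[i := h (xs ! i)]))) = (\<Sum>i<q. F (omit j (xs[?\<sigma> i := h (xs ! ?\<sigma> i)])))"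
    by (rule sum.reindex_bij_witness[where i = ?\<sigma> and j = "\<lambda>i. if i < j then i else i - 1"])
      (use assms(2) in \<open>auto split: if_splits\<close>)
  also have "\<dots> = (\<Sum>i<q. F ((omit j xs)[i := h (omit j xs ! i)]))"
    using assms by (intro sum.cong refl) (simp only: omit_update omit_nth lessThan_iff diff_Suc_1 less_Suc_eq_le)
  finally show ?thesis .
qed

section \<open>Alternating forms on vector fields\<close>

context smooth_manifold_atlas
begin

lemma form_multilinear:
  assumes "differential_form A q \<omega>" "us \<in> tuples (tangent_space A x) q" "i < q" "u \<in> tangent_space A x"
  shows "u' \<in> tangent_space A x \<Longrightarrow> \<omega> x (us[i := u + u']) = \<omega> x (us[i := u]) + \<omega> x (us[i := u'])"
    "\<omega> x (us[i := tscale c u]) = c * \<omega> x (us[i := u])"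
  using assms unfolding differential_form_def by blast+

lemma form_swap:
  assumes \<omega>: "differential_form A q \<omega>" and us: "us \<in> tuples (tangent_space A x) q"
    and ij: "i < q" "j < q" "i \<noteq> j"
  shows "\<omega> x (us[i := us ! j, j := us ! i]) = - \<omega> x us"
proof -
  let ?T = "tangent_space A x"
  note add = form_multilinear(1)[OF \<omega>]
  have alt: "\<omega> x (us[i := u, j := u]) = 0" if "u \<in> ?T" for u
  proof -
    have "us[i := u, j := u] ! i = us[i := u, j := u] ! j"
      using ij us by (auto simp: nth_list_update tuples_def)
    then show ?thesis
      using \<omega> tuples_update[OF tuples_update[OF us that] that] ij unfolding differential_form_def by blast
  qed
  define a b where "a = us ! i" and "b = us ! j"
  have ab: "a \<in> ?T" "b \<in> ?T" "a + b \<in> ?T"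
    using tuples_nth[OF us] ij tangent_space_add by (auto simp: a_def b_def)
  have left: "\<omega> x (us[i := a + b, j := u]) = \<omega> x (us[i := a, j := u]) + \<omega> x (us[i := b, j := u])" if "u \<in> ?T" for u
    using add[OF tuples_update[OF us that] ij(1) ab(1,2)] ij(3) by (simp add: list_update_swap)
  have "0 = \<omega> x (us[i := a + b, j := a + b])" using alt ab by simp
  also have "\<dots> = \<omega> x (us[i := a + b, j := a]) + \<omega> x (us[i := a + b, j := b])"
    by (rule add[OF tuples_update[OF us ab(3)] ij(2) ab(1,2)])
  also have "\<dots> = \<omega> x (us[i := b, j := a]) + \<omega> x (us[i := a, j := b])"
    using left ab alt by simp
  also have "us[i := a, j := b] = us" by (simp add: a_def b_def)
  finally show ?thesis by (simp add: a_def b_def)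
qed

text \<open>The list with entry Suc j in front arises from the one with entry j in front by
  exchanging positions 0 and Suc j, so each step costs one sign.\<close>

lemma form_move_to_front:
  assumes \<omega>: "differential_form A q \<omega>" and us: "us \<in> tuples (tangent_space A x) q" and j: "j < q"
  shows "\<omega> x (us ! j # omit j us) = (- 1) ^ j * \<omega> x us"
  using j
proof (induction j)
  case 0
  have "us ! 0 # omit 0 us = us"
    using us 0 by (auto simp: omit_def tuples_def Cons_nth_drop_Suc)
  then show ?case by simp
next
  case (Suc j)
  let ?w = "\<lambda>j. us ! j # omit j us"
  have len: "length us = q" using us by (simp add: tuples_def)
  have "?w (Suc j) = (?w j)[0 := ?w j ! Suc j, Suc j := ?w j ! 0]"
    using Suc.prems len
    by (intro nth_equalityI) (auto simp: length_omit omit_nth nth_list_update nth_Cons split: nat.splits)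
  moreover have "?w j \<in> tuples (tangent_space A x) q"
  proof -
    obtain k where k: "q = Suc k" using Suc.prems by (cases q) auto
    show ?thesis
      using us Suc.prems omit_tuples[of us "tangent_space A x" k j] tuples_nth[OF us, of j]
      unfolding k by (simp add: tuples_Cons)
  qed
  ultimately have "\<omega> x (?w (Suc j)) = - \<omega> x (?w j)"
    using form_swap[OF \<omega>, of "?w j" x 0 "Suc j"] Suc.prems by simp
  then show ?case using Suc by simp
qed

lemma tangent_tuple:
  "Xs \<in> tuples (vector_fields A) q \<Longrightarrow> map (\<lambda>X. X x) Xs \<in> tuples (tangent_space A x) q"
  unfolding tuples_def using vector_fieldsD(1) by auto

lemma eval_form_add:
  assumes "differential_form A q \<omega>" "Xs \<in> tuples (vector_fields A) q" "i < q" "a \<in> vector_fields A" "b \<in> vector_fields A"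
  shows "eval_form \<omega> (Xs[i := a + b]) = eval_form \<omega> (Xs[i := a]) + eval_form \<omega> (Xs[i := b])"
  using form_multilinear(1)[OF assms(1) tangent_tuple[OF assms(2)] assms(3) vector_fieldsD(1)[OF assms(4)] vector_fieldsD(1)[OF assms(5)]]
  by (intro ext) (simp add: eval_form_def map_update)

lemma eval_form_scale:
  assumes "differential_form A q \<omega>" "Xs \<in> tuples (vector_fields A) q" "i < q" "a \<in> vector_fields A"
  shows "eval_form \<omega> (Xs[i := vscale (\<lambda>_. c) a]) = (\<lambda>_. c) * eval_form \<omega> (Xs[i := a])"
  using form_multilinear(2)[OF assms(1) tangent_tuple[OF assms(2)] assms(3) vector_fieldsD(1)[OF assms(4)]]
  by (intro ext) (simp add: eval_form_def map_update vscale_def)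

lemma eval_form_smooth:
  "differential_form A q \<omega> \<Longrightarrow> Xs \<in> tuples (vector_fields A) q \<Longrightarrow> eval_form \<omega> Xs \<in> smooth_functions A"
  unfolding differential_form_def by blast

lemma deriv_along_diff:
  "X \<in> vector_fields A \<Longrightarrow> f \<in> smooth_functions A \<Longrightarrow> g \<in> smooth_functions A \<Longrightarrow>
    deriv_along X (f - g) = deriv_along X f - deriv_along X g"
  unfolding deriv_along_def fun_diff_def
  by (intro ext) (simp add: tangent_diff[OF vector_fieldsD(1)])

lemma deriv_along_scale:
  "X \<in> vector_fields A \<Longrightarrow> f \<in> smooth_functions A \<Longrightarrow>
    deriv_along X (\<lambda>x. c * f x) = (\<lambda>x. c * deriv_along X f x)"
  unfolding deriv_along_def by (intro ext) (simp add: tangent_scale[OF vector_fieldsD(1)])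

lemma deriv_along_smooth:
  "X \<in> vector_fields A \<Longrightarrow> f \<in> smooth_functions A \<Longrightarrow> deriv_along X f \<in> smooth_functions A"
  unfolding deriv_along_def by (rule vector_fieldsD(2))

end

section \<open>Cocycles and coboundaries of the KV-complex\<close>

context connection_manifold
begin

lemma kv_J_diff:
  assumes w: "w \<in> kv_J A D" and w': "w' \<in> kv_J A D"
  shows "w - w' \<in> kv_J A D"
  unfolding kv_J_def
proof (intro CollectI conjI ballI)
  have s: "w \<in> smooth_functions A" "w' \<in> smooth_functions A" using w w' unfolding kv_J_def by auto
  then show "w - w' \<in> smooth_functions A" using smooth_functions_diff by (simp add: fun_diff_def)
  fix a b assume ab: "a \<in> vector_fields A" "b \<in> vector_fields A"
  have "deriv_along (D a b) w = deriv_along a (deriv_along b w)"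
    "deriv_along (D a b) w' = deriv_along a (deriv_along b w')"
    using w w' ab unfolding kv_J_def by auto
  then show "deriv_along (D a b) (w - w') = deriv_along a (deriv_along b (w - w'))"
    using ab s by (simp only: deriv_along_diff D_closed deriv_along_smooth)
qed

lemma kv_cochainsD:
  assumes "f \<in> kv_cochains A D q"
  shows "as \<notin> tuples (vector_fields A) q \<Longrightarrow> f as = 0"
    "as \<in> tuples (vector_fields A) q \<Longrightarrow> f as \<in> smooth_functions A"
  using assms unfolding kv_cochains_def by auto

lemma kv_cochains_diff:
  assumes "f \<in> kv_cochains A D q" "g \<in> kv_cochains A D q"
  shows "f - g \<in> kv_cochains A D q"
proof -
  have "f as - g as \<in> smooth_functions A" if "as \<in> tuples (vector_fields A) q" for as
    using smooth_functions_diff assms[THEN kv_cochainsD(2)] that by (simp add: fun_diff_def)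
  then show ?thesis
    using assms kv_J_diff unfolding kv_cochains_def by (auto simp: algebra_simps)
qed

lemma kv_coboundary_diff:
  assumes f: "f \<in> kv_cochains A D q" and g: "g \<in> kv_cochains A D q"
  shows "kv_coboundary A D q (f - g) = kv_coboundary A D q f - kv_coboundary A D q g"
proof
  fix as
  show "kv_coboundary A D q (f - g) as = (kv_coboundary A D q f - kv_coboundary A D q g) as"
  proof (cases "as \<in> tuples (vector_fields A) (Suc q)")
    case as: True
    have nth: "as ! j \<in> vector_fields A" if "j \<le> q" for j using tuples_nth[OF as] that by simp
    have om: "omit j as \<in> tuples (vector_fields A) q" if "j \<le> q" for j using omit_tuples[OF as that] .
    have der: "deriv_along (as ! j) (f bs - g bs) = deriv_along (as ! j) (f bs) - deriv_along (as ! j) (g bs)"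
      if "j \<le> q" "bs \<in> tuples (vector_fields A) q" for j bs
      using deriv_along_diff nth that f g kv_cochainsD(2) by blast
    show ?thesis
    proof (cases "q = 0")
      case True
      then show ?thesis
        using as der[of 0 "[]"] by (simp add: kv_coboundary_def tuples_def)
    next
      case False
      then show ?thesis
        using as der[OF _ om]
        by (simp add: kv_coboundary_def sum_subtractf right_diff_distrib)
    qed
  qed (simp add: kv_coboundary_def)
qed

lemma kv_cochains_zero: "0 \<in> kv_cochains A D q"
proof -
  have "deriv_along X 0 = 0" if "X \<in> vector_fields A" for X
    using tangent_const[OF vector_fieldsD(1)[OF that]] by (intro ext) (simp add: deriv_along_def zero_fun_def)
  then show ?thesis
    unfolding kv_cochains_def kv_J_def
    using D_closed smooth_functions_const[of 0] by (auto simp: zero_fun_def[symmetric])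
qed

lemma kv_coboundary_zero: "kv_coboundary A D q 0 = 0"
  using kv_coboundary_diff[OF kv_cochains_zero kv_cochains_zero] by simp

lemma kv_coboundaries_diff:
  "f \<in> kv_coboundaries A D q \<Longrightarrow> g \<in> kv_coboundaries A D q \<Longrightarrow> f - g \<in> kv_coboundaries A D q"
  by (cases q) (auto simp: kv_coboundaries_def kv_coboundary_diff[symmetric] kv_cochains_diff)

lemma kv_coboundaries_zero: "0 \<in> kv_coboundaries A D q"
  by (cases q) (auto simp: kv_coboundaries_def image_iff kv_coboundary_zero intro!: bexI[of _ 0] kv_cochains_zero)

text \<open>Coboundaries are closed under differences, so f - g is one exactly when 0 - g
  is.\<close>

lemma kv_class_coboundary:
  assumes f: "f \<in> kv_cocycles A D q" "f \<in> kv_coboundaries A D q"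
  shows "kv_class A D q f = kv_class A D q 0"
proof -
  have "0 \<in> kv_cocycles A D q"
    by (simp add: kv_cocycles_def kv_cochains_zero kv_coboundary_zero)
  moreover have "f - g \<in> kv_coboundaries A D q \<longleftrightarrow> 0 - g \<in> kv_coboundaries A D q" for g
    using kv_coboundaries_diff[OF _ f(2), of "f - g"] kv_coboundaries_diff[OF f(2), of "0 - (0 - g)"]
      kv_coboundaries_diff[OF kv_coboundaries_zero, of "0 - g"] by auto
  ultimately show ?thesis
    using f(1) unfolding kv_class_def kv_cohomologous_def by (auto simp: Image_def)
qed

lemma form_cochain_in:
  assumes \<omega>: "differential_form A q \<omega>" and "q > 0"
  shows "form_cochain A q \<omega> \<in> kv_cochains A D q"
  unfolding kv_cochains_def form_cochain_def
  using assms eval_form_smooth[OF \<omega>] eval_form_add[OF \<omega>] eval_form_scale[OF \<omega>]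
    vector_fields_add vector_fields_vscale[OF smooth_functions_const]
  by (auto simp: tuples_update)

lemma parallel_formD:
  assumes "parallel_form A D q \<omega>" "X \<in> vector_fields A" "Xs \<in> tuples (vector_fields A) q"
  shows "deriv_along X (eval_form \<omega> Xs) = (\<Sum>i<q. eval_form \<omega> (Xs[i := D X (Xs ! i)]))"
  using assms unfolding parallel_form_def by simp

text \<open>Each summand of the outer sum vanishes by itself: it is the parallel condition for the
  list without its j-th entry, differentiated along that entry.\<close>

lemma parallel_form_cocycle:
  assumes \<omega>: "differential_form A q \<omega>" "parallel_form A D q \<omega>" and "q > 0"
  shows "form_cochain A q \<omega> \<in> kv_cocycles A D q"
proof -
  have "kv_coboundary A D q (form_cochain A q \<omega>) as = 0" for as
  proof (cases "as \<in> tuples (vector_fields A) (Suc q)")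
    case as: True
    have "deriv_along (as ! j) (form_cochain A q \<omega> (omit j as)) =
        (\<Sum>i\<in>{..q} - {j}. form_cochain A q \<omega> (omit j (as[i := D (as ! j) (as ! i)])))" if j: "j < q" for j
    proof -
      have X: "as ! j \<in> vector_fields A" using tuples_nth[OF as] j by simp
      have om: "omit j as \<in> tuples (vector_fields A) q" using omit_tuples[OF as] j by simp
      have "(\<Sum>i\<in>{..q} - {j}. form_cochain A q \<omega> (omit j (as[i := D (as ! j) (as ! i)]))) =
          (\<Sum>i<q. form_cochain A q \<omega> ((omit j as)[i := D (as ! j) (omit j as ! i)]))"
        by (rule sum_omit_update) (use as j in \<open>auto simp: tuples_def\<close>)
      also have "\<dots> = (\<Sum>i<q. eval_form \<omega> ((omit j as)[i := D (as ! j) (omit j as ! i)]))"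
        using tuples_update[OF om D_closed[OF X tuples_nth[OF om]]]
        by (intro sum.cong) (auto simp: form_cochain_def)
      also have "\<dots> = deriv_along (as ! j) (eval_form \<omega> (omit j as))"
        by (rule parallel_formD[OF \<omega>(2) X om, symmetric])
      finally show ?thesis using om by (simp add: form_cochain_def)
    qed
    then show ?thesis using \<open>q > 0\<close> by (simp add: kv_coboundary_def)
  qed (simp add: kv_coboundary_def)
  then show ?thesis
    using form_cochain_in[OF \<omega>(1) \<open>q > 0\<close>] by (auto simp: kv_cocycles_def)
qed

text \<open>
  In the covariant derivative of \<open>\<omega>(H, \<dots>)\<close> only the term with \<open>D X H = X\<close> survives. Hence, up to a
  constant, contraction with \<open>H\<close> is a primitive of \<open>\<omega>\<close>: moving \<open>X\<close> back to its position in the \<open>j\<close>-th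
  term of the coboundary absorbs the sign of this term. As the last argument is left out of the
  outer sum, there are \<open>k\<close> terms for a form of degree \<open>k + 1\<close>; the case \<open>k = 0\<close> is separate since the
  coboundary is defined differently there.
\<close>

lemma parallel_form_coboundary:
  assumes \<omega>: "differential_form A (Suc k) \<omega>" "parallel_form A D (Suc k) \<omega>"
    and H: "H \<in> vector_fields A" "\<And>X. X \<in> vector_fields A \<Longrightarrow> D X H = X"
  shows "form_cochain A (Suc k) \<omega> \<in> kv_coboundaries A D (Suc k)"
proof -
  let ?V = "vector_fields A"
  \<comment> \<open>In degree 0 the coboundary of w is - a w, which forces -1. Otherwise each of the
    k summands equals -c times the form, which forces -1 / k.\<close>
  define c :: real where "c = (if k = 0 then - 1 else - 1 / k)"
  define F where "F as = (if as \<in> tuples ?V k then \<lambda>x. c * eval_form \<omega> (H # as) x else 0)" for as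
  have HT: "H # as \<in> tuples ?V (Suc k)" if "as \<in> tuples ?V k" for as
    using that H by (simp add: tuples_Cons)
  have F0: "F as = 0" if "as \<notin> tuples ?V k" for as using that by (simp add: F_def)
  have F1: "F as = (\<lambda>_. c) * eval_form \<omega> (H # as)" if "as \<in> tuples ?V k" for as
    using that by (simp add: F_def times_fun_def)
  \<comment> \<open>The slot of H yields X; the other slots yield exactly the terms that the inner
    sum of the coboundary subtracts.\<close>
  have deriv: "deriv_along X (F bs) = (\<lambda>_. c) * eval_form \<omega> (X # bs) + (\<Sum>i<k. F (bs[i := D X (bs ! i)]))"
    if X: "X \<in> ?V" and bs: "bs \<in> tuples ?V k" for X bs
  proof -
    have "deriv_along X (F bs) = (\<lambda>_. c) * deriv_along X (eval_form \<omega> (H # bs))"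
      using deriv_along_scale[OF X eval_form_smooth[OF \<omega>(1) HT[OF bs]], of c] bs
      by (simp add: F_def times_fun_def)
    also have "deriv_along X (eval_form \<omega> (H # bs)) = eval_form \<omega> (X # bs) + (\<Sum>i<k. eval_form \<omega> (H # bs[i := D X (bs ! i)]))"
      using parallel_formD[OF \<omega>(2) X HT[OF bs]] H(2)[OF X] by (simp add: sum.lessThan_Suc_shift del: sum.lessThan_Suc)
    also have "(\<lambda>_. c) * \<dots> = (\<lambda>_. c) * eval_form \<omega> (X # bs) + (\<Sum>i<k. F (bs[i := D X (bs ! i)]))"
      using F1[OF tuples_update[OF bs D_closed[OF X tuples_nth[OF bs]]]]
      by (simp add: distrib_left sum_distrib_left)
    finally show ?thesis .
  qed
  have F: "F \<in> kv_cochains A D k"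
    unfolding kv_cochains_def
  proof (intro CollectI conjI allI ballI impI)
    show "F as = 0" if "as \<notin> tuples ?V k" for as by (rule F0[OF that])
    show smooth: "F as \<in> smooth_functions A" if "as \<in> tuples ?V k" for as
      using smooth_functions_mult[OF smooth_functions_const eval_form_smooth[OF \<omega>(1) HT[OF that]]] that
      by (simp add: F_def)
    fix as i a b and d :: real
    assume as: "as \<in> tuples ?V k" and i: "i < k" and a: "a \<in> ?V" and b: "b \<in> ?V"
    show "F (as[i := a + b]) = F (as[i := a]) + F (as[i := b])"
      using eval_form_add[OF \<omega>(1) HT[OF as], of "Suc i" a b] i a b as vector_fields_add
      by (simp add: F1 tuples_update distrib_left)
    show "F (as[i := vscale (\<lambda>_. d) a]) = (\<lambda>_. d) * F (as[i := a])"
      using eval_form_scale[OF \<omega>(1) HT[OF as], of "Suc i" a d] i a as vector_fields_vscale[OF smooth_functions_const]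
      by (simp add: F1 tuples_update mult_ac)
  next
    assume k: "k = 0"
    have nil: "[] \<in> tuples ?V k" by (simp add: k tuples_def)
    \<comment> \<open>The derivative of the function \<open>F []\<close> along X is c times the
      1-form at X, so membership in J(W) amounts to the 1-form being parallel.\<close>
    have dF: "deriv_along X (F []) = (\<lambda>x. c * eval_form \<omega> [X] x)" if "X \<in> ?V" for X
      using deriv[OF that nil] k by (simp add: times_fun_def zero_fun_def)
    show "F [] \<in> kv_J A D"
      unfolding kv_J_def
    proof (intro CollectI conjI ballI)
      show "F [] \<in> smooth_functions A"
        using smooth_functions_mult[OF smooth_functions_const eval_form_smooth[OF \<omega>(1) HT[OF nil]]] nil
        by (simp add: F_def)
      fix a b assume a: "a \<in> ?V" and b: "b \<in> ?V"
      have bt: "[b] \<in> tuples ?V (Suc k)" using b nil by (simp add: tuples_Cons)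
      have "deriv_along a (eval_form \<omega> [b]) = eval_form \<omega> [D a b]"
        using parallel_formD[OF \<omega>(2) a bt] k by simp
      then show "deriv_along (D a b) (F []) = deriv_along a (deriv_along b (F []))"
        using deriv_along_scale[OF a eval_form_smooth[OF \<omega>(1) bt], of c]
        by (simp add: dF D_closed a b)
    qed
  qed
  moreover have "kv_coboundary A D k F as = form_cochain A (Suc k) \<omega> as" for as
  proof (cases "as \<in> tuples ?V (Suc k)")
    case as: True
    have nth: "as ! j \<in> ?V" if "j \<le> k" for j using tuples_nth[OF as] that by simp
    show ?thesis
    proof (cases "k = 0")
      case True
      then have "as = [as ! 0]" using as by (auto simp: tuples_def length_Suc_conv)
      then show ?thesis
        using True as deriv[OF nth[of 0], of "[]"]
        by (simp add: kv_coboundary_def form_cochain_def c_def tuples_def fun_eq_iff)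
    next
      case False
      have "deriv_along (as ! j) (F (omit j as)) - (\<Sum>i\<in>{..k} - {j}. F (omit j (as[i := D (as ! j) (as ! i)])))
          = (\<lambda>_. c) * eval_form \<omega> (as ! j # omit j as)" if j: "j < k" for j
      proof -
        have "(\<Sum>i\<in>{..k} - {j}. F (omit j (as[i := D (as ! j) (as ! i)]))) =
            (\<Sum>i<k. F ((omit j as)[i := D (as ! j) (omit j as ! i)]))"
          by (rule sum_omit_update) (use as j in \<open>auto simp: tuples_def\<close>)
        then show ?thesis using deriv[OF nth omit_tuples[OF as]] j by simp
      qed
      then have "kv_coboundary A D k F as = (\<Sum>j<k. (- 1) ^ Suc j * ((\<lambda>_. c) * eval_form \<omega> (as ! j # omit j as)))"
        using as False by (simp add: kv_coboundary_def)
      also have "\<dots> = form_cochain A (Suc k) \<omega> as"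
      proof
        fix x
        have "eval_form \<omega> (as ! j # omit j as) x = (- 1) ^ j * eval_form \<omega> as x" if "j < k" for j
        proof -
          have "length as = Suc k" using as by (simp add: tuples_def)
          then have "map (\<lambda>X. X x) (as ! j # omit j as) = map (\<lambda>X. X x) as ! j # omit j (map (\<lambda>X. X x) as)"
            using that by (simp add: omit_def take_map drop_map)
          then show ?thesis
            using form_move_to_front[OF \<omega>(1) tangent_tuple[OF as], of j x] that by (simp add: eval_form_def)
        qed
        then have "(\<Sum>j<k. (- 1) ^ Suc j * ((\<lambda>_. c) * eval_form \<omega> (as ! j # omit j as))) x
            = (\<Sum>j<k. - c * ((- 1) ^ j * (- 1) ^ j) * eval_form \<omega> as x)"
          by (simp add: sum_fun_apply fun_power_apply mult_ac)
        also have "\<dots> = eval_form \<omega> as x"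
          using False by (simp add: c_def flip: power_mult_distrib)
        finally show "(\<Sum>j<k. (- 1) ^ Suc j * ((\<lambda>_. c) * eval_form \<omega> (as ! j # omit j as))) x = form_cochain A (Suc k) \<omega> as x"
          using as by (simp add: form_cochain_def)
      qed
      finally show ?thesis .
    qed
  qed (simp add: kv_coboundary_def form_cochain_def)
  then have "kv_coboundary A D k F = form_cochain A (Suc k) \<omega>" by (rule ext)
  ultimately show ?thesis unfolding kv_coboundaries_def by (auto intro!: image_eqI[of _ _ F])
qed

end

theorem proposition9p2:
  fixes A :: "('a::{t2_space, second_countable_topology}, real^'n::finite) atlas"
    and D :: "'a connection"
    and A' :: "('b::{t2_space, second_countable_topology}, real^'n) atlas"
    and D' :: "'b connection"
    and p :: "'b \<Rightarrow> 'a"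
    and x :: 'a and e :: "'n \<Rightarrow> 'a tangent_vector"
    and v :: "'b form"
  assumes "locally_flat_manifold A D"
    and "universal_covering A' D' A D p"
    and "frame_at A x e" and "linear_holonomy_group A D x e \<subseteq> special_linear_group"
    and "volume_form A' v" and "parallel_form A' D' CARD('n) v"
    and "geodesically_complete A D"
  shows "form_cochain A' CARD('n) v \<in> kv_cocycles A' D' CARD('n) \<and>
         kv_class A' D' CARD('n) (form_cochain A' CARD('n) v) = kv_class A' D' CARD('n) 0"
proof -
  have flat: "locally_flat_manifold A' D'" and sc: "simply_connected (UNIV :: 'b set)"
    using assms(2) unfolding universal_covering_def by blast+
  interpret flat_manifold A' D'
    by unfold_locales (use flat in \<open>auto simp: locally_flat_manifold_def\<close>)
  \<comment> \<open>Index types are nonempty, so the degree is positive and there is a degree below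
    it for the primitive.\<close>
  obtain k where k: "CARD('n) = Suc k"
    using zero_less_card_finite gr0_implies_Suc by metis
  have v: "differential_form A' (Suc k) v" "parallel_form A' D' (Suc k) v"
    using assms(5,6) unfolding volume_form_def k by auto
  obtain H where H: "H \<in> vector_fields A'" "\<And>X. X \<in> vector_fields A' \<Longrightarrow> D' X H = X"
    using radial_field_exists[OF sc] by metis
  have cocycle: "form_cochain A' (Suc k) v \<in> kv_cocycles A' D' (Suc k)"
    using parallel_form_cocycle[OF v] by simp
  with kv_class_coboundary[OF cocycle parallel_form_coboundary[OF v H]]
  show ?thesis unfolding k by blast
qed

end
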